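(* Let $A\in\mathbb{R}^{n\times n}$, $B\in\mathbb{R}^{n\times m}$, let $U\subset\mathbb{R}^m$ be a compact and convex neighborhood of $0$, and consider the linear control system $\dot x(t)=Ax(t)+Bu(t)$, $u\in\mathcal{U}$, with its chain control set $E$ in $\mathbb{R}^n$. Then the chain control set $E_c^1$ on the Poincaré sphere $\mathbb{P}^n$ coincides with the closure of the image of $E$: $$E_c^1=\overline{\mathbb{P}(E\times\{1\})}.$$
   Context: $\mathcal{U}=\{u\in L^\infty(\mathbb{R},\mathbb{R}^m): u(t)\in U \text{ for a.a. } t\in\mathbb{R}\}$; $\varphi(t,x_0,u)$ denotes the solution of the linear control system with $x(0)=x_0$. For a control system with state space $M$, metric $d$ on $M$ and trajectories $\varphi(t,x,u)$, a controlled $(\varepsilon,T)$-chain from $x$ to $y$ is given by $k\in\mathbb{N}$, points $x_0=x,\ldots,x_k=y$ in $M$, controls $u_0,\ldots,u_{k-1}\in\mathcal{U}$ and times $t_0,\ldots,t_{k-1}\ge T$ with $d(\varphi(t_j,x_j,u_j),x_{j+1})<\varepsilon$ for all $j$. A chain control set is a nonvoid set, maximal with the property that for all its points $x,y$ and all $\varepsilon,T>0$ there is a controlled $(\varepsilon,T)$-chain from $x$ to $y$. The linear control system on $\mathbb{R}^n$ (with metric given by a norm) has a unique chain control set $E$. The lifted system on $\mathbb{R}^n\times\mathbb{R}=\mathbb{R}^{n+1}$ is $\dot x=Ax+yBu$, $\dot y=0$, $u\in\mathcal{U}$, with solutions $\varphi^1(t,x_0,r,u)=\left(e^{At}x_0+r\int_0^te^{A(t-s)}Bu(s)\,ds,\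 r\right)$. It induces a control system on projective space $\mathbb{P}^n$ (the projective Poincaré sphere) with trajectories $\mathbb{P}\varphi^1(t,x,r,u)$ starting in $\mathbb{P}(x,r)$, where $\mathbb{P}:\mathbb{R}^{n+1}\setminus\{0\}\to\mathbb{P}^n$ is the projection. The metric on $\mathbb{P}^n$ is $d(\mathbb{P}x,\mathbb{P}y)=\min\left\{\left\|\frac{x}{\|x\|}-\frac{y}{\|y\|}\right\|,\left\|\frac{x}{\|x\|}+\frac{y}{\|y\|}\right\|\right\}$. With $\mathbb{P}^{n,1}=\{\mathbb{P}(x,1):x\in\mathbb{R}^n\}$, it is known that there is a unique chain control set $E_c^1$ in $\mathbb{P}^n$ with $E_c^1\cap\mathbb{P}^{n,1}\ne\varnothing$. *)

theory Defs
  imports "HOL-Analysis.Analysis"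
begin

section \<open>Norms\<close>

text \<open>The state space metric is given by an arbitrary norm, not only by the norm that the type
  class provides, so norms occur as explicit functions.\<close>

definition is_norm :: "('a::real_vector \<Rightarrow> real) \<Rightarrow> bool" where
  "is_norm N \<longleftrightarrow> (\<forall>x. N x \<ge> 0) \<and> (\<forall>x. N x = 0 \<longleftrightarrow> x = 0) \<and>
     (\<forall>c x. N (c *\<^sub>R x) = \<bar>c\<bar> * N x) \<and> (\<forall>x y. N (x + y) \<le> N x + N y)"


section \<open>Chain control sets of a general control system\<close>

text \<open>A control system has a state space \<open>M\<close>, a metric \<open>d\<close> on \<open>M\<close>, a set \<open>C\<close> of admissible
  controls and trajectories \<open>f t x u\<close>. Chains have at least one segment (\<open>k \<ge> 1\<close>): with
  \<open>k = 0\<close> every single point would be chain controllable to itself.\<close>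

definition controlled_chain ::
  "'s set \<Rightarrow> ('s \<Rightarrow> 's \<Rightarrow> real) \<Rightarrow> 'c set \<Rightarrow> (real \<Rightarrow> 's \<Rightarrow> 'c \<Rightarrow> 's) \<Rightarrow>
    real \<Rightarrow> real \<Rightarrow> 's \<Rightarrow> 's \<Rightarrow> bool" where
  "controlled_chain M d C f \<epsilon> T x y \<longleftrightarrow>
     (\<exists>(k::nat) xs us ts. k \<ge> 1 \<and> xs 0 = x \<and> xs k = y \<and>
        (\<forall>j\<le>k. xs j \<in> M) \<and>
        (\<forall>j<k. us j \<in> C \<and> ts j \<ge> T \<and> d (f (ts j) (xs j) (us j)) (xs (Suc j)) < \<epsilon>))"

definition chain_controllable ::
  "'s set \<Rightarrow> ('s \<Rightarrow> 's \<Rightarrow> real) \<Rightarrow> 'c set \<Rightarrow> (real \<Rightarrow> 's \<Rightarrow> 'c \<Rightarrow> 's) \<Rightarrow> 's set \<Rightarrow> bool" where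
  "chain_controllable M d C f S \<longleftrightarrow>
     (\<forall>x\<in>S. \<forall>y\<in>S. \<forall>\<epsilon>>0. \<forall>T>0. controlled_chain M d C f \<epsilon> T x y)"

definition chain_control_set ::
  "'s set \<Rightarrow> ('s \<Rightarrow> 's \<Rightarrow> real) \<Rightarrow> 'c set \<Rightarrow> (real \<Rightarrow> 's \<Rightarrow> 'c \<Rightarrow> 's) \<Rightarrow> 's set \<Rightarrow> bool" where
  "chain_control_set M d C f S \<longleftrightarrow>
     S \<noteq> {} \<and> S \<subseteq> M \<and> chain_controllable M d C f S \<and>
     (\<forall>S'. S \<subseteq> S' \<and> S' \<subseteq> M \<and> chain_controllable M d C f S' \<longrightarrow> S' = S)"


section \<open>The linear control system and its lift\<close>

text \<open>Elements of \<open>L\<^sup>\<infinity>\<close> are represented by Lebesgue measurable, essentially bounded functions;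
  trajectories do not depend on the representative.\<close>

definition controls :: "(real ^ 'm) set \<Rightarrow> (real \<Rightarrow> real ^ 'm) set" where
  "controls U = {u. u \<in> borel_measurable lebesgue \<and> (\<exists>K. AE t in lebesgue. norm (u t) \<le> K) \<and>
     (AE t in lebesgue. u t \<in> U)}"

text \<open>The exponential series with powers formed by \<open>**\<close>, since \<open>*\<close> and \<open>^\<close> on type \<open>vec\<close> are
  componentwise.\<close>

definition matrix_exp :: "real ^ 'n ^ 'n \<Rightarrow> real ^ 'n ^ 'n" where
  "matrix_exp A = (\<Sum>k. (1 / fact k) *\<^sub>R (((**) A ^^ k) (mat 1)))"

text \<open>Variation of constants. The interval integral is oriented, so negative times are covered.\<close>

definition forced_response ::
  "real ^ 'n ^ 'n \<Rightarrow> real ^ 'm ^ 'n \<Rightarrow> real \<Rightarrow> (real \<Rightarrow> real ^ 'm) \<Rightarrow> real ^ 'n" where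
  "forced_response A B t u = (LINT s=0..t|lebesgue. (matrix_exp ((t - s) *\<^sub>R A) *v (B *v u s)))"

definition lin_traj ::
  "real ^ 'n ^ 'n \<Rightarrow> real ^ 'm ^ 'n \<Rightarrow> real \<Rightarrow> real ^ 'n \<Rightarrow> (real \<Rightarrow> real ^ 'm) \<Rightarrow> real ^ 'n" where
  "lin_traj A B t x u = matrix_exp (t *\<^sub>R A) *v x + forced_response A B t u"

definition lifted_traj ::
  "real ^ 'n ^ 'n \<Rightarrow> real ^ 'm ^ 'n \<Rightarrow> real \<Rightarrow> (real ^ 'n) \<times> real \<Rightarrow> (real \<Rightarrow> real ^ 'm) \<Rightarrow>
    (real ^ 'n) \<times> real" where
  "lifted_traj A B t z u =
     (matrix_exp (t *\<^sub>R A) *v fst z + snd z *\<^sub>R forced_response A B t u, snd z)"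

lemma lifted_traj_one: "lifted_traj A B t (x, 1) u = (lin_traj A B t x u, 1)"
  by (simp add: lifted_traj_def lin_traj_def)

lemma linear_lifted_traj: "linear (\<lambda>z. lifted_traj A B t z u)"
  by (rule linearI)
    (simp_all add: lifted_traj_def prod_eq_iff matrix_vector_right_distrib algebra_simps
      matrix_vector_mult_scaleR)


section \<open>Projective space\<close>

text \<open>Points of projective space are the lines through the origin, as subsets of the vector
  space.\<close>

definition proj :: "'a::real_vector \<Rightarrow> 'a set" where
  "proj v = span {v}"

definition proj_space :: "'a::real_vector set set" where
  "proj_space = {proj v | v. v \<noteq> 0}"

definition proj_rep :: "'a::real_vector set \<Rightarrow> 'a" where
  "proj_rep p = (SOME v. v \<noteq> 0 \<and> proj v = p)"

text \<open>The value does not depend on the representatives, see \<open>proj_dist_proj\<close> below.\<close>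

definition proj_dist :: "('a::real_vector \<Rightarrow> real) \<Rightarrow> 'a set \<Rightarrow> 'a set \<Rightarrow> real" where
  "proj_dist N p q =
     (let x = proj_rep p; y = proj_rep q
      in min (N (x /\<^sub>R N x - y /\<^sub>R N y)) (N (x /\<^sub>R N x + y /\<^sub>R N y)))"

text \<open>A linear flow acts on lines by taking images, see \<open>proj_traj_proj\<close> below.\<close>

definition proj_traj ::
  "real ^ 'n ^ 'n \<Rightarrow> real ^ 'm ^ 'n \<Rightarrow> real \<Rightarrow> ((real ^ 'n) \<times> real) set \<Rightarrow>
    (real \<Rightarrow> real ^ 'm) \<Rightarrow> ((real ^ 'n) \<times> real) set" where
  "proj_traj A B t p u = (\<lambda>z. lifted_traj A B t z u) ` p"

lemma proj_traj_proj: "proj_traj A B t (proj z) u = proj (lifted_traj A B t z u)"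
  using linear_span_image[OF linear_lifted_traj[of A B t u], of "{z}"]
  by (simp add: proj_traj_def proj_def)

lemma proj_eq_iff:
  assumes "x \<noteq> 0" "y \<noteq> 0"
  shows "proj x = proj y \<longleftrightarrow> (\<exists>c. c \<noteq> 0 \<and> x = c *\<^sub>R y)"
proof
  assume "proj x = proj y"
  then have "x \<in> span {y}"
    unfolding proj_def using span_base[of x "{x}"] by simp
  then obtain c where "x = c *\<^sub>R y" by (auto simp: span_singleton)
  with assms show "\<exists>c. c \<noteq> 0 \<and> x = c *\<^sub>R y" by auto
next
  assume "\<exists>c. c \<noteq> 0 \<and> x = c *\<^sub>R y"
  then obtain c where c: "c \<noteq> 0" "x = c *\<^sub>R y" by blast
  then have "y = (1 / c) *\<^sub>R x" by simp
  then have "y \<in> span {x}" "x \<in> span {y}"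
    using c by (metis span_scale span_base singletonI)+
  then show "proj x = proj y"
    unfolding proj_def by (simp add: span_eq)
qed

lemma proj_rep:
  assumes "x \<noteq> 0"
  obtains c where "c \<noteq> 0" "proj_rep (proj x) = c *\<^sub>R x"
proof -
  have "proj_rep (proj x) \<noteq> 0 \<and> proj (proj_rep (proj x)) = proj x"
    unfolding proj_rep_def by (rule someI[of _ x]) (use assms in simp)
  then show thesis using that proj_eq_iff[OF _ assms] by blast
qed

lemma proj_dist_proj:
  assumes N: "is_norm N" and "x \<noteq> 0" "y \<noteq> 0"
  shows "proj_dist N (proj x) (proj y) =
    min (N (x /\<^sub>R N x - y /\<^sub>R N y)) (N (x /\<^sub>R N x + y /\<^sub>R N y))"
proof -
  have scale: "(c *\<^sub>R v) /\<^sub>R N (c *\<^sub>R v) = sgn c *\<^sub>R (v /\<^sub>R N v)" for c v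
    using N by (simp add: is_norm_def sgn_real_def abs_if)
  have minus: "N (- v) = N v" for v
    using N unfolding is_norm_def by (metis abs_minus_cancel abs_one mult_1 scaleR_minus1_left)
  obtain c where c: "c \<noteq> 0" "proj_rep (proj x) = c *\<^sub>R x" using proj_rep[OF assms(2)] .
  obtain e where e: "e \<noteq> 0" "proj_rep (proj y) = e *\<^sub>R y" using proj_rep[OF assms(3)] .
  define a b where "a = x /\<^sub>R N x" and "b = y /\<^sub>R N y"
  have s: "sgn c = 1 \<or> sgn c = -1" "sgn e = 1 \<or> sgn e = -1"
    using c(1) e(1) by (auto simp: sgn_real_def)
  have m: "N (- a - b) = N (a + b)" "N (b - a) = N (a - b)"
    using minus[of "a + b"] minus[of "a - b"] by simp_all
  show ?thesis
    unfolding proj_dist_def Let_def c(2) e(2) scale a_def[symmetric] b_def[symmetric]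
    using s m by (auto simp: min.commute)
qed

lemma Metric_space_norm:
  assumes "is_norm N"
  shows "Metric_space UNIV (\<lambda>x y. N (x - y))"
proof
  fix x y z
  show "0 \<le> N (x - y)" using assms by (simp add: is_norm_def)
  show "N (x - y) = N (y - x)"
    using assms unfolding is_norm_def
    by (metis abs_minus_cancel abs_one mult_1 scaleR_minus1_left minus_diff_eq)
  show "N (x - y) = 0 \<longleftrightarrow> x = y" using assms by (simp add: is_norm_def)
  show "N (x - z) \<le> N (x - y) + N (y - z)"
    using assms unfolding is_norm_def by (metis diff_add_cancel add_diff_eq)
qed

lemma Metric_space_proj:
  assumes N: "is_norm N"
  shows "Metric_space proj_space (proj_dist N)"
proof
  interpret V: Metric_space UNIV "\<lambda>x y. N (x - y)" by (rule Metric_space_norm[OF N])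
  fix p q r :: "'a set"
  show "0 \<le> proj_dist N p q"
    using N by (simp add: proj_dist_def Let_def is_norm_def)
  have minus: "N (- v) = N v" for v using V.commute[of v 0] by simp
  show "proj_dist N p q = proj_dist N q p"
    unfolding proj_dist_def Let_def using V.commute by (metis add.commute)
  show "proj_dist N p q = 0 \<longleftrightarrow> p = q" if "p \<in> proj_space" "q \<in> proj_space"
  proof -
    from that obtain x y where xy: "p = proj x" "q = proj y" "x \<noteq> 0" "y \<noteq> 0"
      by (auto simp: proj_space_def)
    have nz: "N x \<noteq> 0" "N y \<noteq> 0" using N xy by (auto simp: is_norm_def)
    have "proj_dist N p q = 0 \<longleftrightarrow> x /\<^sub>R N x = y /\<^sub>R N y \<or> x /\<^sub>R N x = - (y /\<^sub>R N y)"
      using N unfolding xy(1,2) proj_dist_proj[OF N xy(3,4)] is_norm_def min_def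
      by (smt (verit) eq_iff_diff_eq_0 eq_neg_iff_add_eq_0)
    also have "\<dots> \<longleftrightarrow> (\<exists>c. c \<noteq> 0 \<and> x = c *\<^sub>R y)"
    proof
      assume "x /\<^sub>R N x = y /\<^sub>R N y \<or> x /\<^sub>R N x = - (y /\<^sub>R N y)"
      moreover have "x = N x *\<^sub>R (x /\<^sub>R N x)" using nz by simp
      ultimately have "x = (N x / N y) *\<^sub>R y \<or> x = (- (N x / N y)) *\<^sub>R y"
        by (metis divide_inverse scaleR_minus_left scaleR_minus_right scaleR_scaleR)
      then show "\<exists>c. c \<noteq> 0 \<and> x = c *\<^sub>R y" using nz
        by (metis divide_eq_0_iff neg_equal_0_iff_equal)
    next
      assume "\<exists>c. c \<noteq> 0 \<and> x = c *\<^sub>R y"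
      then obtain c where "c \<noteq> 0" "x = c *\<^sub>R y" by blast
      then show "x /\<^sub>R N x = y /\<^sub>R N y \<or> x /\<^sub>R N x = - (y /\<^sub>R N y)"
        using N by (cases "c > 0") (auto simp: is_norm_def)
    qed
    finally show ?thesis using proj_eq_iff[OF xy(3,4)] xy by simp
  qed
  show "proj_dist N p r \<le> proj_dist N p q + proj_dist N q r"
  proof -
    define a b c where "a = proj_rep p /\<^sub>R N (proj_rep p)"
      and "b = proj_rep q /\<^sub>R N (proj_rep q)" and "c = proj_rep r /\<^sub>R N (proj_rep r)"
    have tri: "N (u + v) \<le> N u + N v" for u v using N by (simp add: is_norm_def)
    have "N (a - c) \<le> N (a - b) + N (b - c)" "N (a + c) \<le> N (a - b) + N (b + c)"
      "N (a + c) \<le> N (a + b) + N (b - c)" "N (a - c) \<le> N (a + b) + N (b + c)"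
      using tri[of "a - b" "b - c"] tri[of "a - b" "b + c"] tri[of "a + b" "- (b - c)"]
        tri[of "a + b" "- (b + c)"] minus[of "b - c"] minus[of "b + c"]
      by simp_all
    then show ?thesis
      unfolding proj_dist_def Let_def a_def[symmetric] b_def[symmetric] c_def[symmetric]
      by linarith
  qed
qed

end

theory Submission
  imports Defs "HOL-Computational_Algebra.Fundamental_Theorem_Algebra"
begin

text \<open>The flow of \<open>A\<close> splits the state space into an unstable part, on which it expands exponentially,
  and a centre-stable part, on which it grows more slowly than every exponential. Let \<open>P\<close> be the
  projection onto the unstable part along the centre-stable one, and let \<open>Z\<close> be the set of states
  that can be steered to the origin. The set of all \<open>x\<close> with \<open>P x\<close> in the closure of \<open>P Z\<close> is
  called \<open>null_strip A B U\<close>. The proof identifies the chain control set: \<open>E\<close> is the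
  intersection \<open>F\<close> of \<open>null_strip A B U\<close> with the strip \<open>null_strip (- A) (- B) U\<close> of the
  time-reversed system. It is bounded in the hyperbolic directions and contains the whole
  centre space \<open>V\<close>, the intersection of the two centre-stable spaces.

  \<^emph>\<open>Nothing else recurs.\<close> For the lifted system put \<open>\<beta> (x, r) = dist (P x, r P Z)\<close> and
  \<open>\<alpha> (x, r) = norm (x - P x) + \<bar>r\<bar>\<close>. A state that is steered into \<open>Z\<close> lies in \<open>Z\<close>, so \<open>\<beta>\<close> expands
  exponentially, at a rate that \<open>\<alpha>\<close> cannot keep up with; after a long time the ratio \<open>\<beta> / \<alpha>\<close> has
  doubled (\<open>excess_ratio_doubles\<close>). Since \<open>\<alpha>\<close> and \<open>\<beta>\<close> are homogeneous, \<open>\<beta> / (\<alpha> + \<beta>)\<close> is a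
  uniformly continuous function on projective space which every long segment increases wherever it
  is not 0 or 1, and small jumps cannot undo the gain. A chain controllable set therefore lies in its zero
  set or in its one set (\<open>proj_chain_controllable_dichotomy\<close>), and as soon as the set contains a
  point \<open>(x, 1)\<close>, where \<open>\<alpha>\<close> is positive, \<open>\<beta>\<close> vanishes on it. Reversing time gives the same for
  the system \<open>(- A, - B)\<close>. Hence the chain control set \<open>Ec\<close> consists of points \<open>(x, 1)\<close> with \<open>x\<close> in
  \<open>F\<close> and points \<open>(v, 0)\<close> with \<open>v\<close> in \<open>V\<close>; the latter are limits of \<open>(v / e, 1)\<close> for small \<open>e\<close>. The same
  argument for the image of \<open>E\<close> in projective space shows that \<open>E\<close> is contained in \<open>F\<close>.

  \<^emph>\<open>Everything in \<open>F\<close> recurs.\<close> Let \<open>x\<close> be in \<open>null_strip A B U\<close> and let \<open>k\<close> in \<open>Z\<close> have almost the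
  same unstable part. Under the control that steers \<open>k\<close> to 0, run for a fixed time \<open>T\<close>, the unstable
  error stays so small that one jump removes it; the rest of the control then steers the state
  into the centre-stable space. There small jumps suffice to reach 0, although the flow may grow
  polynomially (\<open>center_stable_chain_to_zero\<close>). Reversing time produces chains from 0 to the other
  strip, so \<open>F\<close> is chain controllable and by maximality \<open>E = F\<close>. Because the first segment has the
  prescribed length \<open>T\<close>, chains may also start at limit points, which makes the closure of the
  image of \<open>F\<close> in projective space chain controllable (\<open>proj_closure_chain_controllable\<close>); it
  meets \<open>Ec\<close>, hence is contained in it.\<close>

section \<open>The matrix exponential\<close>

lemma bounded_bilinear_matrix_matrix_mult:
  "bounded_bilinear ((**) :: real^'n^'m \<Rightarrow> real^'p^'n \<Rightarrow> real^'p^'m)"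
  unfolding bilinear_conv_bounded_bilinear[symmetric] bilinear_def
  by (intro conjI allI linearI)
     (simp_all add: matrix_matrix_mult_def vec_eq_iff sum.distrib sum_distrib_left algebra_simps)
lemma bounded_bilinear_matrix_vector_mult:
  "bounded_bilinear ((*v) :: real^'n^'m \<Rightarrow> real^'n \<Rightarrow> real^'m)"
  unfolding bilinear_conv_bounded_bilinear[symmetric] bilinear_def
  by (intro conjI allI linearI)
     (simp_all add: matrix_vector_mult_def vec_eq_iff sum.distrib sum_distrib_left algebra_simps)
definition matrix_exp_coeff :: "real^'n^'n \<Rightarrow> nat \<Rightarrow> real^'n^'n" where
  "matrix_exp_coeff A k = (1 / fact k) *\<^sub>R (((**) A ^^ k) (mat 1))"

lemma matrix_power_scaleR:
  fixes A :: "real^'n^'n"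
  shows "((**) (t *\<^sub>R A) ^^ k) (mat 1) = t ^ k *\<^sub>R ((**) (A::real^'n^'n) ^^ k) (mat 1)"
proof (induction k)
  case (Suc k)
  interpret bounded_bilinear "(**) :: real^'n^'n \<Rightarrow> real^'n^'n \<Rightarrow> real^'n^'n"
    by (rule bounded_bilinear_matrix_matrix_mult)
  have "((**) (t *\<^sub>R A) ^^ Suc k) (mat 1) = (t *\<^sub>R A) ** ((**) (t *\<^sub>R A) ^^ k) (mat 1)"
    by simp
  also have "\<dots> = t ^ Suc k *\<^sub>R ((**) A ^^ Suc k) (mat 1)"
    unfolding Suc by (simp add: scaleR_left scaleR_right mult.commute)
  finally show ?case .
qed simp

lemma matrix_exp_eq:
  fixes A :: "real^'n^'n"
  shows "matrix_exp (t *\<^sub>R A) = (\<Sum>k. t ^ k *\<^sub>R matrix_exp_coeff A k)"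
  by (simp add: matrix_exp_def matrix_exp_coeff_def matrix_power_scaleR mult.commute)

lemma matrix_exp_coeff_Suc:
  fixes A :: "real^'n^'n"
  shows "real (Suc k) *\<^sub>R matrix_exp_coeff A (Suc k) = A ** matrix_exp_coeff A k"
proof -
  interpret bounded_bilinear "(**) :: real^'n^'n \<Rightarrow> real^'n^'n \<Rightarrow> real^'n^'n"
    by (rule bounded_bilinear_matrix_matrix_mult)
  show ?thesis by (simp add: matrix_exp_coeff_def scaleR_right field_simps del: of_nat_Suc)
qed

lemma matrix_exp_coeff_commute:
  fixes A :: "real^'n^'n"
  shows "A ** matrix_exp_coeff A k = matrix_exp_coeff A k ** A"
proof -
  interpret bounded_bilinear "(**) :: real^'n^'n \<Rightarrow> real^'n^'n \<Rightarrow> real^'n^'n"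
    by (rule bounded_bilinear_matrix_matrix_mult)
  have "A ** ((**) A ^^ k) (mat 1) = ((**) A ^^ k) (mat 1) ** A"
  proof (induction k)
    case (Suc k)
    have "A ** (A ** ((**) A ^^ k) (mat 1)) = A ** (((**) A ^^ k) (mat 1) ** A)"
      by (simp only: Suc)
    then show ?case by (simp add: matrix_mul_assoc)
  qed simp
  then show ?thesis by (simp add: matrix_exp_coeff_def scaleR_right scaleR_left)
qed

lemma summable_matrix_exp_coeff:
  fixes A :: "real^'n^'n"
  shows "summable (\<lambda>k. norm (t ^ k *\<^sub>R matrix_exp_coeff A k))"
proof -
  interpret bounded_bilinear "(**) :: real^'n^'n \<Rightarrow> real^'n^'n \<Rightarrow> real^'n^'n"
    by (rule bounded_bilinear_matrix_matrix_mult)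
  obtain K where K: "K > 0" "\<And>(a::real^'n^'n) (b::real^'n^'n). norm (a ** b) \<le> norm a * norm b * K"
    using pos_bounded by blast
  let ?c = "norm (mat 1 :: real^'n^'n)"
  have pow: "norm (((**) A ^^ k) (mat 1)) \<le> (norm A * K) ^ k * ?c" for k
  proof (induction k)
    case (Suc k)
    have "norm (((**) A ^^ Suc k) (mat 1)) \<le> norm A * norm (((**) A ^^ k) (mat 1)) * K"
      using K(2) by simp
    also have "\<dots> \<le> norm A * ((norm A * K) ^ k * ?c) * K"
      using Suc K(1) by (intro mult_right_mono mult_left_mono) auto
    finally show ?case by (simp add: ac_simps)
  qed simp
  show ?thesis
  proof (rule summable_comparison_test')
    show "summable (\<lambda>k. ?c * (inverse (fact k) * (\<bar>t\<bar> * (norm A * K)) ^ k))"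
      by (intro summable_mult summable_exp)
    fix k
    have "norm (norm (t ^ k *\<^sub>R matrix_exp_coeff A k)) = \<bar>t\<bar> ^ k / fact k * norm (((**) A ^^ k) (mat 1))"
      by (simp add: matrix_exp_coeff_def power_abs)
    also have "\<dots> \<le> \<bar>t\<bar> ^ k / fact k * ((norm A * K) ^ k * ?c)"
      by (intro mult_left_mono pow) simp
    finally show "norm (norm (t ^ k *\<^sub>R matrix_exp_coeff A k)) \<le>
      ?c * (inverse (fact k) * (\<bar>t\<bar> * (norm A * K)) ^ k)"
      by (simp add: power_mult_distrib field_simps)
  qed
qed

text \<open>Every matrix entry of the exponential series is a scalar power series, so the series may be
  differentiated entrywise.\<close>

lemma matrix_exp_has_vector_derivative:
  fixes A :: "real^'n^'n"
  shows "((\<lambda>t. matrix_exp (t *\<^sub>R A)) has_vector_derivative A ** matrix_exp (t *\<^sub>R A)) (at t)"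
proof -
  interpret bounded_bilinear "(**) :: real^'n^'n \<Rightarrow> real^'n^'n \<Rightarrow> real^'n^'n"
    by (rule bounded_bilinear_matrix_matrix_mult)
  have inner: "matrix_exp (s *\<^sub>R A) \<bullet> b = (\<Sum>k. (matrix_exp_coeff A k \<bullet> b) * s ^ k)" 
    and summ: "summable (\<lambda>k. (matrix_exp_coeff A k \<bullet> b) * s ^ k)" for s b
  proof -
    have "(\<lambda>k. s ^ k *\<^sub>R matrix_exp_coeff A k) sums matrix_exp (s *\<^sub>R A)"
      unfolding matrix_exp_eq
      by (rule summable_sums, rule summable_norm_cancel, rule summable_matrix_exp_coeff)
    then have "(\<lambda>k. (s ^ k *\<^sub>R matrix_exp_coeff A k) \<bullet> b) sums (matrix_exp (s *\<^sub>R A) \<bullet> b)"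
      by (rule bounded_linear.sums[OF bounded_linear_inner_left])
    then show "matrix_exp (s *\<^sub>R A) \<bullet> b = (\<Sum>k. (matrix_exp_coeff A k \<bullet> b) * s ^ k)"
      "summable (\<lambda>k. (matrix_exp_coeff A k \<bullet> b) * s ^ k)"
      by (simp_all add: sums_iff mult.commute)
  qed
  have prod: "(A ** matrix_exp (t *\<^sub>R A)) \<bullet> b = (\<Sum>k. diffs (\<lambda>k. matrix_exp_coeff A k \<bullet> b) k * t ^ k)" for b
  proof -
    have "(\<lambda>k. t ^ k *\<^sub>R matrix_exp_coeff A k) sums matrix_exp (t *\<^sub>R A)"
      unfolding matrix_exp_eq
      by (rule summable_sums, rule summable_norm_cancel, rule summable_matrix_exp_coeff)
    then have "(\<lambda>k. A ** (t ^ k *\<^sub>R matrix_exp_coeff A k)) sums (A ** matrix_exp (t *\<^sub>R A))"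
      by (rule bounded_linear.sums[OF bounded_linear_right])
    then have "(\<lambda>k. (A ** (t ^ k *\<^sub>R matrix_exp_coeff A k)) \<bullet> b) sums ((A ** matrix_exp (t *\<^sub>R A)) \<bullet> b)"
      by (rule bounded_linear.sums[OF bounded_linear_inner_left])
    moreover have "(A ** (t ^ k *\<^sub>R matrix_exp_coeff A k)) \<bullet> b =
        diffs (\<lambda>k. matrix_exp_coeff A k \<bullet> b) k * t ^ k" for k
      by (simp add: diffs_def scaleR_right matrix_exp_coeff_Suc[symmetric] del: of_nat_Suc)
    ultimately show ?thesis by (simp add: sums_iff)
  qed
  have "((\<lambda>t. matrix_exp (t *\<^sub>R A) \<bullet> b) has_derivative (\<lambda>h. (h *\<^sub>R (A ** matrix_exp (t *\<^sub>R A))) \<bullet> b)) (at t)" for b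
  proof -
    have "((\<lambda>t. matrix_exp (t *\<^sub>R A) \<bullet> b) has_field_derivative
       (A ** matrix_exp (t *\<^sub>R A)) \<bullet> b) (at t)"
      unfolding inner prod by (rule termdiffs_strong_converges_everywhere) (rule summ)
    then show ?thesis by (simp add: has_field_derivative_def mult.commute[of _ "_ \<bullet> _"])
  qed
  then show ?thesis
    unfolding has_vector_derivative_def by (subst has_derivative_componentwise_within) simp
qed

lemma matrix_exp_0 [simp]: "matrix_exp (0::real^'n^'n) = mat 1"
proof -
  have "matrix_exp (0 *\<^sub>R (0::real^'n^'n)) = (\<Sum>k. 0 ^ k *\<^sub>R matrix_exp_coeff 0 k)"
    by (rule matrix_exp_eq)
  also have "\<dots> = (\<Sum>k\<in>{0}. 0 ^ k *\<^sub>R matrix_exp_coeff 0 k)"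
    by (rule suminf_finite) (auto simp: power_0_left)
  finally show ?thesis by (simp add: matrix_exp_coeff_def)
qed

lemma matrix_exp_commute:
  fixes A :: "real^'n^'n"
  shows "A ** matrix_exp (t *\<^sub>R A) = matrix_exp (t *\<^sub>R A) ** A"
proof -
  interpret bounded_bilinear "(**) :: real^'n^'n \<Rightarrow> real^'n^'n \<Rightarrow> real^'n^'n"
    by (rule bounded_bilinear_matrix_matrix_mult)
  have s: "(\<lambda>k. t ^ k *\<^sub>R matrix_exp_coeff A k) sums matrix_exp (t *\<^sub>R A)"
    unfolding matrix_exp_eq
    by (rule summable_sums, rule summable_norm_cancel, rule summable_matrix_exp_coeff)
  show ?thesis
    using bounded_linear.sums[OF bounded_linear_right s, of A]
      bounded_linear.sums[OF bounded_linear_left s, of A]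
    by (simp add: scaleR_left scaleR_right matrix_exp_coeff_commute sums_unique2)
qed

text \<open>The product \<open>matrix_exp (r *\<^sub>R A) ** matrix_exp ((s + t - r) *\<^sub>R A)\<close> has derivative 0 in \<open>r\<close>;
  the claim compares its values at \<open>r = s\<close> and \<open>r = s + t\<close>.\<close>

lemma matrix_exp_add:
  fixes A :: "real^'n^'n"
  shows "matrix_exp ((s + t) *\<^sub>R A) = matrix_exp (s *\<^sub>R A) ** matrix_exp (t *\<^sub>R A)"
proof -
  interpret bounded_bilinear "(**) :: real^'n^'n \<Rightarrow> real^'n^'n \<Rightarrow> real^'n^'n"
    by (rule bounded_bilinear_matrix_matrix_mult)
  let ?X = "\<lambda>t. matrix_exp (t *\<^sub>R A)"
  have D: "((\<lambda>r. ?X r ** ?X (s + t - r)) has_vector_derivative 0) (at r)" for r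
  proof -
    have "((\<lambda>r. ?X (s + t - r)) has_vector_derivative (-1) *\<^sub>R (A ** ?X (s + t - r))) (at r)"
      by (rule vector_diff_chain_at[OF _ matrix_exp_has_vector_derivative, unfolded o_def])
        (auto intro!: derivative_eq_intros)
    from has_vector_derivative[OF matrix_exp_has_vector_derivative[of A] this]
    moreover have "?X r ** (A ** ?X (s + t - r)) = (A ** ?X r) ** ?X (s + t - r)"
      by (simp only: matrix_exp_commute[of A r] matrix_mul_assoc)
    ultimately show ?thesis by (simp add: minus_right)
  qed
  obtain c where "\<And>r. ?X r ** ?X (s + t - r) = c"
    using has_vector_derivative_zero_constant[of UNIV "\<lambda>r. ?X r ** ?X (s + t - r)"] D by auto
  from this[of s] this[of "s + t"] show ?thesis by simp
qed

lemma matrix_exp_inverse [simp]: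
  "matrix_exp (t *\<^sub>R A) ** matrix_exp (- (t *\<^sub>R A)) = mat 1"
  "matrix_exp (- (t *\<^sub>R A)) ** matrix_exp (t *\<^sub>R A) = mat 1"
  using matrix_exp_add[of t "-t" A] matrix_exp_add[of "-t" t A] by simp_all

lemma continuous_on_matrix_exp:
  fixes A :: "real^'n^'n"
  shows "continuous_on S (\<lambda>t. matrix_exp (t *\<^sub>R A))"
  by (intro continuous_at_imp_continuous_on ballI
      has_vector_derivative_continuous[OF matrix_exp_has_vector_derivative])

section \<open>Exponential and subexponential orbits of a complex matrix\<close>

text \<open>The endomorphism that \<open>M\<close> induces on the quotient by \<open>S\<close> has an eigenvector: among the nonzero
  polynomials \<open>p\<close> with \<open>p(M) v\<close> in \<open>S\<close> take one of least degree and split off a linear factor;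
  by minimality the cofactor still maps \<open>v\<close> outside \<open>S\<close>.\<close>

lemma quotient_eigenvector:
  fixes M :: "complex^'n^'n" and S :: "(complex^'n) set"
  assumes S: "vec.subspace S" and inv: "\<And>x. x \<in> S \<Longrightarrow> M *v x \<in> S" and "S \<noteq> UNIV"
  obtains v \<mu> where "v \<notin> S" "M *v v - \<mu> *s v \<in> S"
proof -
  obtain v where v: "v \<notin> S" using assms(3) by blast
  define w where "w i = ((*v) M ^^ i) v" for i
  have w_Suc: "M *v w i = w (Suc i)" for i by (simp add: w_def)
  define act where "act n p = (\<Sum>i\<le>n. coeff p i *s w i)" for n and p :: "complex poly"
  \<comment> \<open>either two iterates of \<open>v\<close> coincide, or there are too many of them to be independent\<close>
  have "\<exists>p. p \<noteq> 0 \<and> degree p \<le> CARD('n) \<and> act (CARD('n)) p = 0"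
  proof (cases "inj_on w {..CARD('n)}")
    case True
    have "vec.dim (w ` {..CARD('n)}) \<le> CARD('n)"
      by (metis vec.dim_subset_UNIV card_cart_basis vec.dimension_def)
    then have "vec.dependent (w ` {..CARD('n)})"
      by (intro vec.dependent_biggerset_general) (simp add: card_image[OF True])
    then obtain u where u: "\<exists>x\<in>w ` {..CARD('n)}. u x \<noteq> 0" "(\<Sum>x\<in>w ` {..CARD('n)}. u x *s x) = 0"
      by (subst (asm) vec.dependent_finite) auto
    define p where "p = (\<Sum>i\<le>CARD('n). monom (u (w i)) i)"
    have c: "coeff p i = (if i \<le> CARD('n) then u (w i) else 0)" for i
      by (simp add: p_def coeff_sum)
    have "act (CARD('n)) p = (\<Sum>i\<le>CARD('n). u (w i) *s w i)"
      by (simp add: act_def c)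
    also have "\<dots> = 0" using u(2) by (simp add: sum.reindex[OF True])
    finally have "act (CARD('n)) p = 0" .
    moreover have "p \<noteq> 0" using u(1) c by (metis atMost_iff coeff_0 imageE)
    moreover have "degree p \<le> CARD('n)" by (rule degree_le) (simp add: c)
    ultimately show ?thesis by blast
  next
    case False
    then obtain i j where ij: "i \<le> CARD('n)" "j \<le> CARD('n)" "i \<noteq> j" "w i = w j"
      by (auto simp: inj_on_def)
    define p where "p = monom 1 i - (monom 1 j :: complex poly)"
    have c: "coeff p k = (if k = i then 1 else 0) - (if k = j then 1 else 0)" for k
      by (simp add: p_def)
    have "act (CARD('n)) p = (\<Sum>k\<le>CARD('n). (if k = i then w k else 0) - (if k = j then w k else 0))"
      unfolding act_def by (rule sum.cong) (auto simp: c)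
    also have "\<dots> = 0" using ij by (simp add: sum_subtractf)
    finally have "act (CARD('n)) p = 0" .
    moreover have "p \<noteq> 0" using c[of i] ij(3) by auto
    moreover have "degree p \<le> CARD('n)" by (rule degree_le) (use ij c in auto)
    ultimately show ?thesis by blast
  qed
  moreover have act_degree: "act n p = act (degree p) p" if "degree p \<le> n" for n p
    unfolding act_def by (rule sum.mono_neutral_right) (use that in \<open>auto simp: coeff_eq_0\<close>)
  ultimately have ex: "\<exists>p. p \<noteq> 0 \<and> act (degree p) p \<in> S"
    using vec.subspace_0[OF S] by metis
  define p where "p = arg_min degree (\<lambda>p. p \<noteq> 0 \<and> act (degree p) p \<in> S)"
  have p: "p \<noteq> 0" "act (degree p) p \<in> S"
    using ex unfolding p_def by (metis (mono_tags, lifting) arg_min_natI)+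
  have pmin: "degree p \<le> degree q" if "q \<noteq> 0" "act (degree q) q \<in> S" for q
    unfolding p_def using arg_min_nat_le[of "\<lambda>p. p \<noteq> 0 \<and> act (degree p) p \<in> S" q degree] that by auto
  have deg: "degree p \<noteq> 0"
  proof
    assume 0: "degree p = 0"
    then have "coeff p 0 *s v \<in> S" using p(2) by (simp add: act_def w_def)
    moreover have "coeff p 0 \<noteq> 0" using p(1) 0 by (metis leading_coeff_0_iff)
    ultimately show False using v vec.subspace_scale[OF S, of "coeff p 0 *s v" "1 / coeff p 0"]
      by (simp add: vector_smult_assoc)
  qed
  then obtain \<mu> where "poly p \<mu> = 0"
    using fundamental_theorem_of_algebra[of p] by (auto simp: constant_degree)
  then obtain q where q: "p = [:-\<mu>, 1:] * q" by (metis dvdE poly_eq_0_iff_dvd)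
  have q0: "q \<noteq> 0" using p(1) q by auto
  have degq: "degree p = Suc (degree q)"
    unfolding q by (subst degree_mult_eq) (use q0 in auto)
  let ?n = "degree q"
  have cp: "coeff p 0 = - \<mu> * coeff q 0" "coeff p (Suc i) = coeff q i - \<mu> * coeff q (Suc i)" for i
    by (simp_all add: q)
  have "act (Suc ?n) p = (\<Sum>i\<le>?n. coeff q i *s w (Suc i)) - \<mu> *s act (Suc ?n) q"
    unfolding act_def sum.atMost_Suc_shift[of _ ?n] cp
    by (simp add: algebra_simps sum_subtractf vec.scale_sum_right vec.scale_left_diff_distrib vec.scale_scale
        vec.scale_right_distrib sum.distrib)
  also have "(\<Sum>i\<le>?n. coeff q i *s w (Suc i)) = M *v act ?n q"
    by (simp add: act_def w_Suc[symmetric] vec.linear_sum[OF matrix_vector_mul_linear_gen] vector_scalar_commute)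
  also have "act (Suc ?n) q = act ?n q" by (rule act_degree) simp
  finally have "M *v act ?n q - \<mu> *s act ?n q \<in> S" using p(2) degq by simp
  moreover have "act ?n q \<notin> S" using pmin[OF q0] degq by auto
  ultimately show thesis using that by blast
qed

definition decaying_orbit :: "('a \<Rightarrow> 'a) \<Rightarrow> 'a::real_normed_vector \<Rightarrow> bool" where
  "decaying_orbit g v \<longleftrightarrow> (\<exists>C \<gamma>. 0 < \<gamma> \<and> \<gamma> < 1 \<and> (\<forall>j. norm ((g ^^ j) v) \<le> C * \<gamma> ^ j))"

definition subexponential_orbit :: "('a \<Rightarrow> 'a) \<Rightarrow> 'a::real_normed_vector \<Rightarrow> bool" where
  "subexponential_orbit g v \<longleftrightarrow> (\<forall>\<gamma>>1. \<exists>C. \<forall>j. norm ((g ^^ j) v) \<le> C * \<gamma> ^ j)"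

text \<open>Requiring the pseudo-orbit to stay at 0 lets pseudo-orbits of different lengths be added.\<close>

definition chain_to_zero :: "('a \<Rightarrow> 'a) \<Rightarrow> 'a::real_normed_vector \<Rightarrow> bool" where
  "chain_to_zero g v \<longleftrightarrow> (\<forall>\<epsilon>>0. \<exists>xs N. xs 0 = v \<and> (\<forall>j\<ge>N. xs j = 0) \<and>
     (\<forall>j. norm (g (xs j) - xs (Suc j)) < \<epsilon>))"

text \<open>One transfer principle covers scalar multiples, images under the map itself, and the passage from
  complex vectors to their real parts.\<close>

lemma
  assumes comm: "\<And>x. h (g x) = g' (h x)" and bd: "\<And>x. norm (h x) \<le> K * norm x"
  shows decaying_orbit_map: "decaying_orbit g v \<Longrightarrow> decaying_orbit g' (h v)"
    and subexponential_orbit_map: "subexponential_orbit g v \<Longrightarrow> subexponential_orbit g' (h v)"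
    and chain_to_zero_map: "(\<And>x y. h (x - y) = h x - h y) \<Longrightarrow> chain_to_zero g v \<Longrightarrow> chain_to_zero g' (h v)"
proof -
  have iter: "h ((g ^^ j) v) = (g' ^^ j) (h v)" for j
    by (induction j) (simp_all add: comm)
  have K: "norm (h x) \<le> \<bar>K\<bar> * norm x" for x
    by (rule order_trans[OF bd]) (simp add: mult_right_mono)
  have C: "norm ((g' ^^ j) (h v)) \<le> (\<bar>K\<bar> * C) * \<gamma> ^ j" if "norm ((g ^^ j) v) \<le> C * \<gamma> ^ j" for C \<gamma> j
    using K[of "(g ^^ j) v"] mult_left_mono[OF that abs_ge_zero[of K]] by (simp add: iter)
  show "decaying_orbit g v \<Longrightarrow> decaying_orbit g' (h v)"
    unfolding decaying_orbit_def using C by blast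
  show "subexponential_orbit g v \<Longrightarrow> subexponential_orbit g' (h v)"
    unfolding subexponential_orbit_def using C by meson
  assume diff: "\<And>x y. h (x - y) = h x - h y"
  then have h0: "h 0 = 0" by (metis diff_self)
  assume st: "chain_to_zero g v"
  show "chain_to_zero g' (h v)"
    unfolding chain_to_zero_def
  proof (intro allI impI)
    fix \<epsilon> :: real assume "\<epsilon> > 0"
    then have "\<epsilon> / (\<bar>K\<bar> + 1) > 0" by simp
    with st obtain xs N where xs: "xs 0 = v" "\<And>j. j \<ge> N \<Longrightarrow> xs j = 0"
      "\<And>j. norm (g (xs j) - xs (Suc j)) < \<epsilon> / (\<bar>K\<bar> + 1)"
      unfolding chain_to_zero_def by metis
    have "norm (g' (h (xs j)) - h (xs (Suc j))) < \<epsilon>" for j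
    proof -
      have "norm (g' (h (xs j)) - h (xs (Suc j))) \<le> \<bar>K\<bar> * norm (g (xs j) - xs (Suc j))"
        using K[of "g (xs j) - xs (Suc j)"] by (simp add: diff comm)
      also have "\<dots> \<le> (\<bar>K\<bar> + 1) * norm (g (xs j) - xs (Suc j))"
        by (simp add: mult_right_mono)
      also have "\<dots> < \<epsilon>"
        using xs(3)[of j] by (simp add: field_simps)
      finally show ?thesis .
    qed
    then show "\<exists>xs N. xs 0 = h v \<and> (\<forall>j\<ge>N. xs j = 0) \<and> (\<forall>j. norm (g' (xs j) - xs (Suc j)) < \<epsilon>)"
      using xs(1,2) h0 by (intro exI[of _ "\<lambda>j. h (xs j)"] exI[of _ N]) auto
  qed
qed

lemma
  assumes add: "\<And>x y. g (x + y) = g x + g y"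
  shows decaying_orbit_add: "decaying_orbit g v \<Longrightarrow> decaying_orbit g w \<Longrightarrow> decaying_orbit g (v + w)"
    and subexponential_orbit_add:
      "subexponential_orbit g v \<Longrightarrow> subexponential_orbit g w \<Longrightarrow> subexponential_orbit g (v + w)"
    and chain_to_zero_add: "chain_to_zero g v \<Longrightarrow> chain_to_zero g w \<Longrightarrow> chain_to_zero g (v + w)"
proof -
  have iter: "(g ^^ j) (v + w) = (g ^^ j) v + (g ^^ j) w" for j
    by (induction j) (simp_all add: add)
  show "decaying_orbit g (v + w)" if vw: "decaying_orbit g v" "decaying_orbit g w"
  proof -
    obtain C \<gamma> where v: "0 < \<gamma>" "\<gamma> < 1" "\<And>j. norm ((g ^^ j) v) \<le> C * \<gamma> ^ j"
      using vw(1) unfolding decaying_orbit_def by blast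
    obtain C' \<gamma>' where w: "0 < \<gamma>'" "\<gamma>' < 1" "\<And>j. norm ((g ^^ j) w) \<le> C' * \<gamma>' ^ j"
      using vw(2) unfolding decaying_orbit_def by blast
    have C: "0 \<le> C" "0 \<le> C'" 
      using order_trans[OF norm_ge_zero v(3)[of 0]] order_trans[OF norm_ge_zero w(3)[of 0]] by auto
    let ?\<gamma> = "max \<gamma> \<gamma>'"
    have "norm ((g ^^ j) (v + w)) \<le> (C + C') * ?\<gamma> ^ j" for j
    proof -
      have "norm ((g ^^ j) (v + w)) \<le> C * \<gamma> ^ j + C' * \<gamma>' ^ j"
        unfolding iter using v(3)[of j] w(3)[of j] by (meson add_mono norm_triangle_le)
      also have "\<dots> \<le> C * ?\<gamma> ^ j + C' * ?\<gamma> ^ j"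
        using v w C by (intro add_mono mult_left_mono power_mono) auto
      finally show ?thesis by (simp add: algebra_simps)
    qed
    then show ?thesis unfolding decaying_orbit_def using v w by (intro exI[of _ "C + C'"] exI[of _ ?\<gamma>]) auto
  qed
  show "subexponential_orbit g (v + w)" if vw: "subexponential_orbit g v" "subexponential_orbit g w"
    unfolding subexponential_orbit_def
  proof (intro allI impI)
    fix \<gamma> :: real assume "\<gamma> > 1"
    then obtain C C' where "\<And>j. norm ((g ^^ j) v) \<le> C * \<gamma> ^ j" "\<And>j. norm ((g ^^ j) w) \<le> C' * \<gamma> ^ j"
      using vw unfolding subexponential_orbit_def by metis
    then have "norm ((g ^^ j) (v + w)) \<le> (C + C') * \<gamma> ^ j" for j
      unfolding iter distrib_right by (meson add_mono norm_triangle_le)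
    then show "\<exists>C. \<forall>j. norm ((g ^^ j) (v + w)) \<le> C * \<gamma> ^ j" by blast
  qed
  show "chain_to_zero g (v + w)" if vw: "chain_to_zero g v" "chain_to_zero g w"
    unfolding chain_to_zero_def
  proof (intro allI impI)
    fix \<epsilon> :: real assume "\<epsilon> > 0"
    then have e2: "\<epsilon> / 2 > 0" by simp
    obtain xs N where xs: "xs 0 = v" "\<And>j. j \<ge> N \<Longrightarrow> xs j = 0"
      "\<And>j. norm (g (xs j) - xs (Suc j)) < \<epsilon> / 2"
      using vw(1) e2 unfolding chain_to_zero_def by metis
    obtain ys N' where ys: "ys 0 = w" "\<And>j. j \<ge> N' \<Longrightarrow> ys j = 0"
      "\<And>j. norm (g (ys j) - ys (Suc j)) < \<epsilon> / 2"
      using vw(2) e2 unfolding chain_to_zero_def by metis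
    have "norm (g (xs j + ys j) - (xs (Suc j) + ys (Suc j))) < \<epsilon>" for j
      using norm_triangle_lt[of "g (xs j) - xs (Suc j)" "g (ys j) - ys (Suc j)" \<epsilon>] xs(3)[of j] ys(3)[of j]
      by (simp add: add algebra_simps)
    then show "\<exists>xs N. xs 0 = v + w \<and> (\<forall>j\<ge>N. xs j = 0) \<and> (\<forall>j. norm (g (xs j) - xs (Suc j)) < \<epsilon>)"
      using xs(1,2) ys(1,2) by (intro exI[of _ "\<lambda>j. xs j + ys j"] exI[of _ "max N N'"]) auto
  qed
qed

lemma decaying_orbit_0: "g 0 = 0 \<Longrightarrow> decaying_orbit g 0"
  and subexponential_orbit_0: "g 0 = 0 \<Longrightarrow> subexponential_orbit g 0"
  and chain_to_zero_0: "g 0 = 0 \<Longrightarrow> chain_to_zero g 0"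
proof -
  assume g: "g 0 = 0"
  have iter: "(g ^^ j) 0 = 0" for j by (induction j) (simp_all add: g)
  show "decaying_orbit g 0" unfolding decaying_orbit_def 
    by (intro exI[of _ 0] exI[of _ "1/2"]) (simp add: iter)
  show "subexponential_orbit g 0" unfolding subexponential_orbit_def
    by (intro allI impI exI[of _ 0]) (simp add: iter)
  show "chain_to_zero g 0" unfolding chain_to_zero_def
    by (intro allI impI exI[of _ "\<lambda>_. 0"] exI[of _ 0]) (simp add: g)
qed

lemma norm_vector_scalar_mult: "norm (c *s x) = norm c * norm (x :: 'a::real_normed_field ^ 'n)"
  by (simp add: norm_vec_def norm_mult L2_set_right_distrib)

lemma linear_complex_matrix: "linear ((*v) (M :: complex^'n^'m))"
  by (rule linearI, rule matrix_vector_right_distrib)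
    (simp add: matrix_vector_mult_def vec_eq_iff scaleR_sum_right)

lemma subspace_shift_surj:
  fixes M :: "complex^'n^'n" and S :: "(complex^'n) set"
  assumes S: "vec.subspace S" and inv: "\<And>x. x \<in> S \<Longrightarrow> M *v x \<in> S"
    and inj: "\<And>x. x \<in> S \<Longrightarrow> M *v x = \<mu> *s x \<Longrightarrow> x = 0" and "y \<in> S"
  obtains x where "x \<in> S" "M *v x - \<mu> *s x = y"
proof -
  have mat: "(M - mat \<mu>) *v x = M *v x - \<mu> *s x" for x
    by (simp add: matrix_vector_mult_diff_rdistrib)
       (simp add: matrix_vector_mult_def mat_def vec_eq_iff if_distrib[of "\<lambda>a. a * _"] cong: if_cong)
  let ?f = "(*v) (M - mat \<mu>)"
  have lin: "Vector_Spaces.linear (*s) (*s) ?f" by simp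
  have sub: "?f ` S \<subseteq> S"
    using inv S by (auto simp: mat intro: vec.subspace_diff vec.subspace_scale)
  have "inj_on ?f (vec.span S)"
    unfolding vec.linear_inj_on_iff_eq_0[OF lin vec.subspace_span]
    using S inj by (simp add: mat vec.span_eq_iff[THEN iffD2])
  then have "vec.dim (?f ` S) = vec.dim S" by (rule vec.dim_image_eq[OF lin])
  then have "?f ` S = S"
    using S sub by (intro vec.subspace_dim_equal vec.linear_subspace_image[OF lin]) auto
  then show thesis using that \<open>y \<in> S\<close> mat by (metis imageE)
qed

text \<open>The sum \<open>S\<close> of the two invariant subspaces is everything, because the quotient by it has no
  eigenvector. Suppose \<open>M v - \<mu> v = p + q\<close> with \<open>p\<close> in the first space and \<open>q\<close> in the second. If
  \<open>norm \<mu> \<le> 1\<close>, then \<open>M - \<mu>\<close> is injective, hence bijective, on the first space, so \<open>p\<close> can be removed by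
  changing \<open>v\<close> within \<open>S\<close>, and what remains belongs to the second space; if \<open>norm \<mu> > 1\<close>, the roles
  are exchanged. Slow growth and reachability of 0 by small jumps can be treated together, since both
  pass from \<open>q\<close> to \<open>v\<close> when \<open>norm \<mu> \<le> 1\<close>; no Jordan basis is needed.\<close>

lemma complex_splitting:
  fixes M Mi :: "complex^'n^'n"
  assumes inverse: "M ** Mi = mat 1" "Mi ** M = mat 1"
  obtains y z where "x = y + z" "decaying_orbit ((*v) Mi) y"
    "subexponential_orbit ((*v) M) z" "chain_to_zero ((*v) M) z"
proof -
  define P where "P = {y. decaying_orbit ((*v) Mi) y}"
  define Q where "Q = {z. subexponential_orbit ((*v) M) z \<and> chain_to_zero ((*v) M) z}"
  have cancel: "M *v (Mi *v x) = x" "Mi *v (M *v x) = x" for x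
    by (simp_all add: matrix_vector_mul_assoc inverse)
  obtain K where K: "\<And>x. norm (M *v x) \<le> K * norm x"
    using linear_bounded[OF linear_complex_matrix[of M]] by blast
  have diff: "c *s (x - y) = c *s x - c *s y" for c and x y :: "complex^'n"
    by (simp add: vec.scale_right_diff_distrib)
  have smult: "\<mu> *s x \<in> P" if "x \<in> P" for \<mu> x
    using that unfolding P_def mem_Collect_eq
    by (intro decaying_orbit_map[of "(*s) \<mu>" "(*v) Mi" _ "norm \<mu>"])
       (simp_all add: norm_vector_scalar_mult vector_scalar_commute)
  have smultQ: "\<mu> *s x \<in> Q" if "x \<in> Q" for \<mu> x
    using that unfolding Q_def mem_Collect_eq
    by (auto intro!: subexponential_orbit_map[of "(*s) \<mu>" "(*v) M" _ "norm \<mu>"]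
        chain_to_zero_map[of "(*s) \<mu>" "(*v) M" _ "norm \<mu>"]
        simp: norm_vector_scalar_mult vector_scalar_commute diff)
  have subP: "vec.subspace P"
    by (rule vec.subspaceI)
      (auto simp: P_def decaying_orbit_0 decaying_orbit_add matrix_vector_right_distrib
        intro: smult[unfolded P_def, simplified])
  have subQ: "vec.subspace Q"
    by (rule vec.subspaceI)
      (auto simp: Q_def subexponential_orbit_0 subexponential_orbit_add chain_to_zero_0 chain_to_zero_add
        matrix_vector_right_distrib smultQ[unfolded Q_def, simplified])
  have invP: "M *v x \<in> P" if "x \<in> P" for x
    using that unfolding P_def mem_Collect_eq
    by (intro decaying_orbit_map[of "(*v) M" "(*v) Mi" _ K]) (simp_all add: cancel K)
  have invQ: "M *v x \<in> Q" if "x \<in> Q" for x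
    using that unfolding Q_def mem_Collect_eq
    by (auto intro!: subexponential_orbit_map[of "(*v) M" "(*v) M" _ K]
        chain_to_zero_map[of "(*v) M" "(*v) M" _ K] simp: K matrix_vector_mult_diff_distrib)
  have P_shift: "v \<in> P" if v: "M *v v - \<mu> *s v = w" "w \<in> P" "norm \<mu> > 1" for v w \<mu>
  proof -
    obtain C \<gamma> where C: "0 < \<gamma>" "\<gamma> < 1" "\<And>j. norm (((*v) Mi ^^ j) w) \<le> C * \<gamma> ^ j"
      using v(2) by (auto simp: P_def decaying_orbit_def)
    have C0: "C \<ge> 0" using order_trans[OF norm_ge_zero C(3)[of 0]] by simp
    define \<theta> where "\<theta> = max \<gamma> (1 / norm \<mu>)"
    have "1 / norm \<mu> < 1" using v(3) by (simp add: divide_less_eq)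
    then have \<theta>: "0 < \<theta>" "\<theta> < 1" "\<gamma> \<le> \<theta>" "1 / norm \<mu> \<le> \<theta>"
      using C(1,2) by (auto simp: \<theta>_def)
    then have \<theta>\<mu>: "1 \<le> \<theta> * norm \<mu>" using v(3) by (simp add: divide_le_eq split: if_splits)
    \<comment> \<open>a rate strictly above \<open>\<theta>\<close> absorbs the inhomogeneous term, with \<open>C'\<close> large enough\<close>
    define \<theta>' where "\<theta>' = (1 + \<theta>) / 2"
    have \<theta>': "\<theta> < \<theta>'" "\<theta>' < 1" using \<theta> by (auto simp: \<theta>'_def)
    define C' where "C' = max (norm v) (\<theta> * C / (\<theta>' - \<theta>))"
    have C': "\<theta> * C' + \<theta> * C \<le> C' * \<theta>'" "norm v \<le> C'"
    proof -
      have "\<theta> * C / (\<theta>' - \<theta>) \<le> C'" by (simp add: C'_def)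
      then show "\<theta> * C' + \<theta> * C \<le> C' * \<theta>'" using \<theta>' by (simp add: pos_divide_le_eq algebra_simps)
    qed (simp add: C'_def)
    have "norm (((*v) Mi ^^ j) v) \<le> C' * \<theta>' ^ j" for j
    proof (induction j)
      case (Suc j)
      let ?a = "((*v) Mi ^^ Suc j) v" and ?b = "((*v) Mi ^^ Suc j) w"
      have iter: "((*v) Mi ^^ i) (\<mu> *s v + w) = \<mu> *s ((*v) Mi ^^ i) v + ((*v) Mi ^^ i) w" for i
        by (induction i) (simp_all add: matrix_vector_right_distrib vector_scalar_commute)
      have "((*v) Mi ^^ j) v = ((*v) Mi ^^ Suc j) (M *v v)"
        unfolding funpow_Suc_right by (simp add: cancel)
      also have "M *v v = \<mu> *s v + w" using v(1) by (simp add: algebra_simps)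
      finally have "\<mu> *s ?a = ((*v) Mi ^^ j) v - ?b"
        unfolding iter by (simp only: eq_diff_eq)
      then have "norm (\<mu> *s ?a) \<le> norm (((*v) Mi ^^ j) v) + norm ?b"
        by (simp only: norm_triangle_ineq4)
      then have "norm \<mu> * norm ?a \<le> norm (((*v) Mi ^^ j) v) + norm ?b"
        by (simp only: norm_vector_scalar_mult)
      also have "\<dots> \<le> C' * \<theta>' ^ j + C * \<theta>' ^ j"
      proof (rule add_mono[OF Suc])
        have "\<gamma> ^ Suc j \<le> \<gamma> ^ j" using C(1,2) by (simp add: mult_le_cancel_right1)
        also have "\<dots> \<le> \<theta>' ^ j" using C(1) \<theta>(3) \<theta>'(1) by (intro power_mono) auto
        finally show "norm ?b \<le> C * \<theta>' ^ j"
          by (rule order_trans[OF C(3)[of "Suc j"] mult_left_mono[OF _ C0]])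
      qed
      finally have le: "norm \<mu> * norm ?a \<le> (C' + C) * \<theta>' ^ j" by (simp add: algebra_simps)
      have "norm ?a \<le> (\<theta> * norm \<mu>) * norm ?a"
        using mult_right_mono[OF \<theta>\<mu>, of "norm ?a"] by simp
      also have "\<dots> \<le> \<theta> * ((C' + C) * \<theta>' ^ j)"
        using mult_left_mono[OF le, of \<theta>] \<theta>(1) by (simp add: mult.assoc)
      also have "\<dots> \<le> (C' * \<theta>') * \<theta>' ^ j"
        using mult_right_mono[OF C'(1), of "\<theta>' ^ j"] \<theta>(1) \<theta>'(1) by (simp add: algebra_simps)
      finally show ?case by (simp add: mult.assoc)
    qed (use C'(2) in simp)
    moreover have "0 < \<theta>'" using \<theta>(1) \<theta>'(1) by linarith
    ultimately show ?thesis
      unfolding P_def decaying_orbit_def using \<theta>'(2) by blast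
  qed
  have Q_shift: "v \<in> Q" if v: "M *v v - \<mu> *s v = w" "w \<in> Q" "norm \<mu> \<le> 1" for v w \<mu>
  proof -
    have Mv: "M *v v = \<mu> *s v + w" using v(1) by (simp add: algebra_simps)
    have "subexponential_orbit ((*v) M) v"
      unfolding subexponential_orbit_def
    proof (intro allI impI)
      fix \<gamma> :: real assume \<gamma>: "\<gamma> > 1"
      then obtain C where C: "\<And>j. norm (((*v) M ^^ j) w) \<le> C * \<gamma> ^ j"
        using v(2) by (auto simp: Q_def subexponential_orbit_def)
      define C' where "C' = max (norm v) (C / (\<gamma> - 1))"
      have C': "C' + C \<le> C' * \<gamma>" "norm v \<le> C'"
      proof -
        have "C / (\<gamma> - 1) \<le> C'" by (simp add: C'_def)
        then show "C' + C \<le> C' * \<gamma>" using \<gamma> by (simp add: pos_divide_le_eq algebra_simps)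
      qed (simp add: C'_def)
      have step: "((*v) M ^^ Suc j) v = \<mu> *s ((*v) M ^^ j) v + ((*v) M ^^ j) w" for j
        by (induction j) (simp_all add: Mv matrix_vector_right_distrib vector_scalar_commute)
      have "norm (((*v) M ^^ j) v) \<le> C' * \<gamma> ^ j" for j
      proof (induction j)
        case (Suc j)
        have "norm (((*v) M ^^ Suc j) v) \<le> norm \<mu> * norm (((*v) M ^^ j) v) + norm (((*v) M ^^ j) w)"
          unfolding step by (metis norm_triangle_ineq norm_vector_scalar_mult)
        also have "\<dots> \<le> 1 * norm (((*v) M ^^ j) v) + norm (((*v) M ^^ j) w)"
          using v(3) by (intro add_mono mult_right_mono) auto
        also have "\<dots> \<le> (C' + C) * \<gamma> ^ j" using Suc C[of j] by (simp add: algebra_simps)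
        also have "\<dots> \<le> C' * \<gamma> * \<gamma> ^ j" using C'(1) \<gamma> by (intro mult_right_mono) auto
        finally show ?case by (simp add: mult.assoc)
      qed (use C'(2) in simp)
      then show "\<exists>C. \<forall>j. norm (((*v) M ^^ j) v) \<le> C * \<gamma> ^ j" by blast
    qed
    moreover have "chain_to_zero ((*v) M) v"
      unfolding chain_to_zero_def
    proof (intro allI impI)
      fix \<epsilon> :: real assume \<epsilon>: "\<epsilon> > 0"
      obtain N :: nat where N: "N > norm v / \<epsilon>" using reals_Archimedean2 by blast
      have N0: "real N > 0" using N \<epsilon> by (meson divide_nonneg_pos norm_ge_zero order_le_less_trans)
      \<comment> \<open>The coefficient of \<open>v\<close> is faded out linearly in \<open>N\<close> steps, at the price of jumps of size
        \<open>norm v / N\<close>; the inhomogeneous terms collect in \<open>z\<close>, which never leaves \<open>Q\<close>.\<close>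
      define z where "z = rec_nat (0::complex^'n) (\<lambda>j z. M *v z + (of_real (1 - real j / real N) * \<mu> ^ j) *s w)"
      have z: "z 0 = 0" "z (Suc j) = M *v z j + (of_real (1 - real j / real N) * \<mu> ^ j) *s w" for j
        by (simp_all add: z_def)
      have zQ: "z j \<in> Q" for j
        by (induction j) (use z invQ v(2) subQ in \<open>auto simp: vec.subspace_0 vec.subspace_add vec.subspace_scale\<close>)
      define x where "x j = (of_real (1 - real j / real N) * \<mu> ^ j) *s v + z j" for j
      have x0: "x 0 = v" by (simp add: x_def z)
      have xN: "x N = z N" using N0 by (simp add: x_def)
      have jump: "norm (M *v x j - x (Suc j)) < \<epsilon>" for j
      proof -
        have c: "of_real (1 - real j / real N) * \<mu> ^ j * \<mu> - of_real (1 - real (Suc j) / real N) * \<mu> ^ Suc j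
            = of_real (1 / real N) * \<mu> ^ Suc j"
        proof -
          have "1 - real (Suc j) / real N = (1 - real j / real N) - 1 / real N"
            by (simp add: add_divide_distrib)
          then show ?thesis by (simp only: of_real_diff) (simp add: algebra_simps)
        qed
        have "M *v x j = (of_real (1 - real j / real N) * \<mu> ^ j) *s (\<mu> *s v + w) + M *v z j"
          by (simp add: x_def matrix_vector_right_distrib vector_scalar_commute Mv)
        then have "M *v x j - x (Suc j) = (of_real (1 - real j / real N) * \<mu> ^ j * \<mu>) *s v -
            (of_real (1 - real (Suc j) / real N) * \<mu> ^ Suc j) *s v"
          by (simp add: x_def z vec.scale_right_distrib vec.scale_scale)
        also have "\<dots> = (of_real (1 / real N) * \<mu> ^ Suc j) *s v"
          unfolding vec.scale_left_diff_distrib[symmetric] c ..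
        finally have "M *v x j - x (Suc j) = (of_real (1 / real N) * \<mu> ^ Suc j) *s v" .
        then have "norm (M *v x j - x (Suc j)) = norm v / N * norm \<mu> ^ Suc j"
          by (simp add: norm_vector_scalar_mult norm_mult norm_power norm_divide)
        also have "\<dots> \<le> norm v / N * 1"
          using v(3) by (intro mult_left_mono power_le_one) auto
        also have "\<dots> < \<epsilon>" using N N0 \<epsilon> by (simp add: field_simps)
        finally show ?thesis .
      qed
      obtain ys N' where ys: "ys 0 = z N" "\<And>j. j \<ge> N' \<Longrightarrow> ys j = 0"
        "\<And>j. norm (M *v ys j - ys (Suc j)) < \<epsilon>"
        using zQ[of N] \<epsilon> unfolding Q_def chain_to_zero_def mem_Collect_eq by metis
      let ?xs = "\<lambda>j. if j < N then x j else ys (j - N)"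
      have "norm (M *v ?xs j - ?xs (Suc j)) < \<epsilon>" for j
      proof (cases "Suc j = N")
        case True
        then show ?thesis using jump[of j] xN ys(1) by simp
      next
        case False
        then show ?thesis using jump[of j] ys(3)[of "j - N"] by (auto simp: Suc_diff_le)
      qed
      then show "\<exists>xs N. xs 0 = v \<and> (\<forall>j\<ge>N. xs j = 0) \<and> (\<forall>j. norm (M *v xs j - xs (Suc j)) < \<epsilon>)"
        using x0 N0 ys(2) by (intro exI[of _ ?xs] exI[of _ "N + N'"]) auto
    qed
    ultimately show ?thesis by (simp add: Q_def)
  qed
  have P_inj: "u = 0" if u: "u \<in> P" "M *v u = \<mu> *s u" "norm \<mu> \<le> 1" for u \<mu>
  proof -
    obtain C \<gamma> where C: "0 < \<gamma>" "\<gamma> < 1" "\<And>j. norm (((*v) Mi ^^ j) u) \<le> C * \<gamma> ^ j"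
      using u(1) by (auto simp: P_def decaying_orbit_def)
    have pow: "u = \<mu> ^ j *s ((*v) Mi ^^ j) u" for j
    proof (induction j)
      case (Suc j)
      have "u = Mi *v (\<mu> *s u)" using u(2) cancel(2)[of u] by simp
      also have "\<dots> = Mi *v (\<mu> *s (\<mu> ^ j *s ((*v) Mi ^^ j) u))" using Suc by simp
      finally show ?case by (simp add: vector_scalar_commute vec.scale_scale)
    qed simp
    have "norm u \<le> C * \<gamma> ^ j" for j
    proof -
      have "norm u = norm \<mu> ^ j * norm (((*v) Mi ^^ j) u)"
        by (metis pow norm_power norm_vector_scalar_mult)
      also have "\<dots> \<le> 1 * norm (((*v) Mi ^^ j) u)"
        using u(3) by (intro mult_right_mono power_le_one) auto
      finally show ?thesis using C(3)[of j] by simp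
    qed
    moreover have "(\<lambda>j. C * \<gamma> ^ j) \<longlonglongrightarrow> C * 0"
      using C by (intro tendsto_intros LIMSEQ_power_zero) simp
    ultimately have "norm u \<le> C * 0" by (intro LIMSEQ_le_const) auto
    then show ?thesis by simp
  qed
  have Q_inj: "u = 0" if u: "u \<in> Q" "M *v u = \<mu> *s u" "norm \<mu> > 1" for u \<mu>
  proof -
    \<comment> \<open>any rate strictly between 1 and \<open>norm \<mu>\<close> contradicts \<open>M\<^sup>j u = \<mu>\<^sup>j u\<close>\<close>
    define \<gamma> where "\<gamma> = (1 + norm \<mu>) / 2"
    have \<gamma>: "\<gamma> > 1" "\<gamma> < norm \<mu>" using u(3) by (auto simp: \<gamma>_def)
    obtain C where C: "\<And>j. norm (((*v) M ^^ j) u) \<le> C * \<gamma> ^ j"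
      using u(1) \<gamma>(1) by (auto simp: Q_def subexponential_orbit_def)
    have pow: "((*v) M ^^ j) u = \<mu> ^ j *s u" for j
      by (induction j) (simp_all add: vector_scalar_commute u(2) vec.scale_scale mult.commute)
    have "norm u \<le> C * (\<gamma> / norm \<mu>) ^ j" for j
    proof -
      have "norm \<mu> ^ j * norm u \<le> C * \<gamma> ^ j"
        using C[of j] by (simp add: pow norm_vector_scalar_mult norm_power)
      moreover have "norm \<mu> ^ j > 0" using u(3) by (intro zero_less_power) linarith
      ultimately show ?thesis by (simp add: power_divide pos_le_divide_eq mult.commute)
    qed
    moreover have "(\<lambda>j. C * (\<gamma> / norm \<mu>) ^ j) \<longlonglongrightarrow> C * 0"
      using \<gamma> by (intro tendsto_intros LIMSEQ_power_zero) (simp add: divide_less_eq)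
    ultimately have "norm u \<le> C * 0" by (intro LIMSEQ_le_const) auto
    then show ?thesis by simp
  qed
  define S where "S = {y + z | y z. y \<in> P \<and> z \<in> Q}"
  have subS: "vec.subspace S" unfolding S_def by (rule vec.subspace_sums[OF subP subQ])
  have invS: "M *v x \<in> S" if "x \<in> S" for x
    using that invP invQ unfolding S_def by (force simp: matrix_vector_right_distrib)
  have PS: "P \<subseteq> S" and QS: "Q \<subseteq> S"
    using vec.subspace_0[OF subP] vec.subspace_0[OF subQ] by (force simp: S_def)+
  have "S = UNIV"
  proof (rule ccontr)
    assume "S \<noteq> UNIV"
    then obtain v \<mu> where v: "v \<notin> S" "M *v v - \<mu> *s v \<in> S"
      using quotient_eigenvector[OF subS invS] by blast
    then obtain p q where pq: "p \<in> P" "q \<in> Q" "M *v v - \<mu> *s v = p + q" by (auto simp: S_def)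
    show False
    proof (cases "norm \<mu> \<le> 1")
      case True
      obtain u where u: "u \<in> P" "M *v u - \<mu> *s u = p"
        using subspace_shift_surj[OF subP invP _ pq(1)] P_inj True by metis
      have "M *v (v - u) - \<mu> *s (v - u) = q"
        using pq(3) u(2) by (simp add: matrix_vector_mult_diff_distrib diff algebra_simps)
      then have "v - u \<in> Q" using Q_shift pq(2) True by blast
      then have "u + (v - u) \<in> S" using u(1) unfolding S_def by blast
      then show False using v(1) by simp
    next
      case False
      obtain u where u: "u \<in> Q" "M *v u - \<mu> *s u = q"
        using subspace_shift_surj[OF subQ invQ _ pq(2)] Q_inj False by (metis not_le)
      have "M *v (v - u) - \<mu> *s (v - u) = p"
        using pq(3) u(2) by (simp add: matrix_vector_mult_diff_distrib diff algebra_simps)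
      then have "v - u \<in> P" using P_shift pq(1) False by (meson not_le)
      then have "(v - u) + u \<in> S" using u(1) unfolding S_def by blast
      then show False using v(1) by simp
    qed
  qed
  then have "x \<in> S" by simp
  then show thesis using that by (auto simp: S_def P_def Q_def)
qed

section \<open>Unstable and centre-stable spaces of a linear flow\<close>

definition flow :: "real^'n^'n \<Rightarrow> real \<Rightarrow> real^'n \<Rightarrow> real^'n" where
  "flow A t x = matrix_exp (t *\<^sub>R A) *v x"

lemma linear_flow [simp]: "linear (flow A t)"
  unfolding flow_def by simp

lemmas flow_plus = linear_add[OF linear_flow]
  and flow_diff = linear_diff[OF linear_flow]
  and flow_scaleR = linear_scale[OF linear_flow]
  and flow_zero [simp] = linear_0[OF linear_flow]

lemma flow_time_0 [simp]: "flow A 0 x = x"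
  by (simp add: flow_def)

lemma flow_uminus: "flow (- A) t x = flow A (- t) x"
  by (simp add: flow_def)

lemma flow_add: "flow A (s + t) x = flow A s (flow A t x)"
  by (simp add: flow_def matrix_exp_add matrix_vector_mul_assoc)

lemma flow_inverse: "flow A t (flow A (- t) x) = x" "flow A (- t) (flow A t x) = x"
  using flow_add[of A t "-t" x] flow_add[of A "-t" t x] by simp_all

lemma flow_funpow: "(flow A T ^^ j) x = flow A (real j * T) x"
proof (induction j)
  case (Suc j)
  have "real (Suc j) * T = T + real j * T" by (simp add: algebra_simps)
  then show ?case unfolding \<open>real (Suc j) * T = _\<close> flow_add using Suc by simp
qed simp

lemma flow_bounded:
  fixes A :: "real^'n^'n"
  obtains K where "K > 0" "\<And>t x. a \<le> t \<Longrightarrow> t \<le> b \<Longrightarrow> norm (flow A t x) \<le> K * norm x"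
proof -
  obtain L where L: "\<And>t. t \<in> {a..b} \<Longrightarrow> norm (matrix_exp (t *\<^sub>R A)) \<le> L"
    using compact_imp_bounded[OF compact_continuous_image[OF continuous_on_matrix_exp compact_Icc]]
    unfolding bounded_iff by (metis imageI)
  obtain K where K: "K > 0" "\<And>(a::real^'n^'n) x. norm (a *v x) \<le> norm a * norm x * K"
    using bounded_bilinear.pos_bounded[OF bounded_bilinear_matrix_vector_mult] by blast
  show thesis
  proof (rule that)
    show "\<bar>L\<bar> * K + 1 > 0" using K(1) by (simp add: add_nonneg_pos)
    fix t x assume t: "a \<le> t" "t \<le> b"
    have "norm (flow A t x) \<le> norm (matrix_exp (t *\<^sub>R A)) * norm x * K"
      unfolding flow_def by (rule K(2))
    also have "\<dots> \<le> \<bar>L\<bar> * norm x * K"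
      using L[of t] t K(1) by (intro mult_right_mono) auto
    also have "\<dots> = \<bar>L\<bar> * K * norm x" by simp
    also have "\<dots> \<le> (\<bar>L\<bar> * K + 1) * norm x" by (intro mult_right_mono) auto
    finally show "norm (flow A t x) \<le> (\<bar>L\<bar> * K + 1) * norm x" .
  qed
qed

definition unstable_space :: "real^'n^'n \<Rightarrow> (real^'n) set" where
  "unstable_space A = {x. \<exists>\<gamma>>0. \<exists>C. \<forall>t\<ge>0. norm (flow A (- t) x) \<le> C * exp (- \<gamma> * t)}"

definition center_stable_space :: "real^'n^'n \<Rightarrow> (real^'n) set" where
  "center_stable_space A = {x. \<forall>\<delta>>0. \<exists>C. \<forall>t\<ge>0. norm (flow A t x) \<le> C * exp (\<delta> * t)}"

text \<open>A sampled orbit determines the rate of the continuous one: between two samples the flow changes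
  norms by a bounded factor only.\<close>

lemma unstable_spaceI:
  assumes T: "T > 0" and y: "decaying_orbit (flow A (- T)) y"
  shows "y \<in> unstable_space A"
proof -
  obtain C \<gamma> where C: "0 < \<gamma>" "\<gamma> < 1" "\<And>j. norm ((flow A (- T) ^^ j) y) \<le> C * \<gamma> ^ j"
    using y by (auto simp: decaying_orbit_def)
  have C0: "C \<ge> 0" using order_trans[OF norm_ge_zero C(3)[of 0]] by simp
  obtain K where K: "K > 0" "\<And>s x. - T \<le> s \<Longrightarrow> s \<le> 0 \<Longrightarrow> norm (flow A s x) \<le> K * norm x"
    using flow_bounded by blast
  define \<kappa> where "\<kappa> = - ln \<gamma> / T"
  have \<kappa>: "\<kappa> > 0" "\<gamma> = exp (- \<kappa> * T)" using C T by (simp_all add: \<kappa>_def divide_neg_pos)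
  have "norm (flow A (- t) y) \<le> (K * C * exp (\<kappa> * T)) * exp (- \<kappa> * t)" if t: "t \<ge> 0" for t
  proof -
    define j where "j = nat \<lfloor>t / T\<rfloor>"
    have "real j \<le> t / T" "t / T < real j + 1" using t T unfolding j_def by simp_all
    then have j: "real j * T \<le> t" "t - T \<le> real j * T"
      using T by (simp_all add: field_simps)
    have "flow A (- t) y = flow A (- (t - real j * T)) ((flow A (- T) ^^ j) y)"
      unfolding flow_funpow flow_add[symmetric] by simp
    also have "norm \<dots> \<le> K * norm ((flow A (- T) ^^ j) y)"
      using j by (intro K(2)) auto
    also have "\<dots> \<le> K * (C * \<gamma> ^ j)" using C(3)[of j] K(1) by simp
    also have "\<gamma> ^ j = exp (- \<kappa> * (real j * T))" by (simp add: \<kappa>(2) exp_of_nat_mult[symmetric] mult_ac)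
    also have "K * (C * \<dots>) \<le> K * (C * exp (\<kappa> * T + - \<kappa> * t))"
    proof -
      have "- \<kappa> * (real j * T) \<le> \<kappa> * T + - \<kappa> * t"
        using mult_left_mono[OF j(2), of \<kappa>] \<kappa>(1) by (simp add: algebra_simps)
      then show ?thesis using K(1) C0 by (simp add: mult_left_mono)
    qed
    finally show ?thesis by (simp only: exp_add mult.assoc)
  qed
  then show ?thesis unfolding unstable_space_def using \<kappa>(1) by blast
qed

lemma center_stable_spaceI:
  assumes T: "T > 0" and z: "subexponential_orbit (flow A T) z"
  shows "z \<in> center_stable_space A"
  unfolding center_stable_space_def mem_Collect_eq
proof (intro allI impI)
  fix \<delta> :: real assume \<delta>: "\<delta> > 0"
  then have "exp (\<delta> * T) > 1" using T by simp
  then obtain C where C: "\<And>j. norm ((flow A T ^^ j) z) \<le> C * exp (\<delta> * T) ^ j"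
    using z unfolding subexponential_orbit_def by blast
  have C0: "C \<ge> 0" using order_trans[OF norm_ge_zero C[of 0]] by simp
  obtain K where K: "K > 0" "\<And>s x. 0 \<le> s \<Longrightarrow> s \<le> T \<Longrightarrow> norm (flow A s x) \<le> K * norm x"
    using flow_bounded by blast
  have "norm (flow A t z) \<le> (K * C) * exp (\<delta> * t)" if t: "t \<ge> 0" for t
  proof -
    define j where "j = nat \<lfloor>t / T\<rfloor>"
    have "real j \<le> t / T" "t / T < real j + 1" using t T unfolding j_def by simp_all
    then have j: "real j * T \<le> t" "t - T \<le> real j * T"
      using T by (simp_all add: field_simps)
    have "flow A t z = flow A (t - real j * T) ((flow A T ^^ j) z)"
      unfolding flow_funpow flow_add[symmetric] by simp
    also have "norm \<dots> \<le> K * norm ((flow A T ^^ j) z)"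
      using j by (intro K(2)) auto
    also have "\<dots> \<le> K * (C * exp (\<delta> * T) ^ j)" using C[of j] K(1) by simp
    also have "exp (\<delta> * T) ^ j = exp (\<delta> * (real j * T))" by (simp add: exp_of_nat_mult[symmetric] mult_ac)
    also have "K * (C * \<dots>) \<le> K * (C * exp (\<delta> * t))"
      using j(1) \<delta> K(1) C0 by (simp add: mult_left_mono)
    finally show ?thesis by (simp only: mult.assoc)
  qed
  then show "\<exists>C. \<forall>t\<ge>0. norm (flow A t z) \<le> C * exp (\<delta> * t)" by blast
qed

text \<open>The sampling time \<open>T\<close> is arbitrary, while the two spaces do not depend on it; this is what later
  gives small-jump chains with segments of any prescribed length.\<close>

lemma real_splitting:
  fixes A :: "real^'n^'n"
  assumes T: "T > 0"
  obtains y z where "x = y + z" "y \<in> unstable_space A" "z \<in> center_stable_space A"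
    "chain_to_zero (flow A T) z"
proof -
  define c where "c M = (\<chi> i j. complex_of_real (M $ i $ j))" for M :: "real^'n^'n"
  define h where "h w = (\<chi> i. Re (w $ i))" for w :: "complex^'n"
  have h: "h (c M *v w) = M *v h w" for M w
    by (simp add: h_def c_def matrix_vector_mult_def vec_eq_iff)
  have c_mult: "c M ** c M' = c (M ** M')" for M M'
    by (simp add: c_def matrix_matrix_mult_def vec_eq_iff)
  have c_1: "c (mat 1) = mat 1" by (simp add: c_def mat_def vec_eq_iff)
  have h_norm: "norm (h w) \<le> 1 * norm w" for w
    by (auto simp: norm_vec_def h_def abs_Re_le_cmod intro!: L2_set_mono)
  obtain y z where yz: "(\<chi> i. complex_of_real (x $ i)) = y + z"
      "decaying_orbit ((*v) (c (matrix_exp (- (T *\<^sub>R A))))) y"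
      "subexponential_orbit ((*v) (c (matrix_exp (T *\<^sub>R A)))) z"
      "chain_to_zero ((*v) (c (matrix_exp (T *\<^sub>R A)))) z"
    by (rule complex_splitting[of "c (matrix_exp (T *\<^sub>R A))" "c (matrix_exp (- (T *\<^sub>R A)))"])
       (auto simp: c_mult c_1)
  show thesis
  proof (rule that[of "h y" "h z"])
    have "h (y + z) = h y + h z" by (simp add: h_def vec_eq_iff)
    then show "x = h y + h z" unfolding yz(1)[symmetric] by (simp add: h_def vec_eq_iff)
    show "h y \<in> unstable_space A"
      using decaying_orbit_map[OF h h_norm yz(2)]
      by (intro unstable_spaceI[OF T]) (simp add: flow_def[abs_def])
    show "h z \<in> center_stable_space A"
      using subexponential_orbit_map[OF h h_norm yz(3)]
      by (intro center_stable_spaceI[OF T]) (simp add: flow_def[abs_def])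
    show "chain_to_zero (flow A T) (h z)"
      using chain_to_zero_map[OF h h_norm _ yz(4)] by (simp add: h_def vec_eq_iff flow_def[abs_def])
  qed
qed

text \<open>For negative \<open>\<gamma>\<close> the bound permits exponential growth instead of forcing decay; applied to \<open>- A\<close>,
  that case gives the conditions that define the centre-stable space of \<open>A\<close>.\<close>

lemma subspace_unstable_rate:
  "subspace {x. \<exists>C. \<forall>t\<ge>0. norm (flow A (- t) x) \<le> C * exp (- \<gamma> * t)}"
proof (rule subspaceI; unfold mem_Collect_eq)
  show "\<exists>C. \<forall>t\<ge>0. norm (flow A (- t) 0) \<le> C * exp (- \<gamma> * t)" by (rule exI[of _ 0]) simp
next
  fix x y
  assume "\<exists>C. \<forall>t\<ge>0. norm (flow A (- t) x) \<le> C * exp (- \<gamma> * t)"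
    "\<exists>C. \<forall>t\<ge>0. norm (flow A (- t) y) \<le> C * exp (- \<gamma> * t)"
  then obtain C C' where "\<forall>t\<ge>0. norm (flow A (- t) x) \<le> C * exp (- \<gamma> * t)"
    "\<forall>t\<ge>0. norm (flow A (- t) y) \<le> C' * exp (- \<gamma> * t)" by blast
  then have "\<forall>t\<ge>0. norm (flow A (- t) (x + y)) \<le> (C + C') * exp (- \<gamma> * t)"
    unfolding flow_plus distrib_right by (meson add_mono norm_triangle_le)
  then show "\<exists>C. \<forall>t\<ge>0. norm (flow A (- t) (x + y)) \<le> C * exp (- \<gamma> * t)" ..
next
  fix c x
  assume "\<exists>C. \<forall>t\<ge>0. norm (flow A (- t) x) \<le> C * exp (- \<gamma> * t)"
  then obtain C where C: "\<forall>t\<ge>0. norm (flow A (- t) x) \<le> C * exp (- \<gamma> * t)" by blast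
  then have "\<forall>t\<ge>0. norm (flow A (- t) (c *\<^sub>R x)) \<le> (\<bar>c\<bar> * C) * exp (- \<gamma> * t)"
    unfolding flow_scaleR norm_scaleR mult.assoc by (simp add: mult_left_mono)
  then show "\<exists>C. \<forall>t\<ge>0. norm (flow A (- t) (c *\<^sub>R x)) \<le> C * exp (- \<gamma> * t)" ..
qed

lemma unstable_rate_mono:
  fixes A :: "real^'n^'n"
  assumes "a \<le> b"
  shows "{x. \<exists>C. \<forall>t\<ge>0. norm (flow A (- t) x) \<le> C * exp (- b * t)} \<subseteq>
    {x. \<exists>C. \<forall>t\<ge>0. norm (flow A (- t) x) \<le> C * exp (- a * t)}"
proof clarify
  fix x C assume C: "\<forall>t\<ge>0. norm (flow A (- t) x) \<le> C * exp (- b * t)"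
  have "0 \<le> C * exp (- b * 0)" using C order_trans[OF norm_ge_zero] by blast
  then have "C \<ge> 0" by simp
  moreover have "exp (- b * t) \<le> exp (- a * t)" if "t \<ge> 0" for t
    using assms that by (simp add: mult_right_mono)
  ultimately have "norm (flow A (- t) x) \<le> C * exp (- a * t)" if "t \<ge> 0" for t
    using C that order_trans[OF _ mult_left_mono] by metis
  then show "\<exists>C. \<forall>t\<ge>0. norm (flow A (- t) x) \<le> C * exp (- a * t)" by blast
qed

lemma subspace_unstable_space: "subspace (unstable_space A)"
proof (rule subspaceI)
  have "\<forall>t\<ge>0. norm (flow A (- t) 0) \<le> 0 * exp (- 1 * t)" by simp
  then show "0 \<in> unstable_space A" unfolding unstable_space_def using zero_less_one by blast
  fix x y assume xy: "x \<in> unstable_space A" "y \<in> unstable_space A"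
  let ?V = "\<lambda>\<gamma>. {x. \<exists>C. \<forall>t\<ge>0. norm (flow A (- t) x) \<le> C * exp (- \<gamma> * t)}"
  obtain \<gamma> \<gamma>' where g: "\<gamma> > 0" "x \<in> ?V \<gamma>" "\<gamma>' > 0" "y \<in> ?V \<gamma>'"
    using xy by (auto simp: unstable_space_def)
  have "x \<in> ?V (min \<gamma> \<gamma>')" "y \<in> ?V (min \<gamma> \<gamma>')" using g unstable_rate_mono[of "min \<gamma> \<gamma>'" \<gamma> A] unstable_rate_mono[of "min \<gamma> \<gamma>'" \<gamma>' A] by (meson min.cobounded1 min.cobounded2 subsetD)+
  then have "x + y \<in> ?V (min \<gamma> \<gamma>')" by (rule subspace_add[OF subspace_unstable_rate])
  then show "x + y \<in> unstable_space A" using g unfolding unstable_space_def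
    using min_less_iff_conj[of 0 \<gamma> \<gamma>'] by blast
next
  fix c x assume "x \<in> unstable_space A"
  then obtain \<gamma> where "\<gamma> > 0" "x \<in> {x. \<exists>C. \<forall>t\<ge>0. norm (flow A (- t) x) \<le> C * exp (- \<gamma> * t)}"
    by (auto simp: unstable_space_def)
  then show "c *\<^sub>R x \<in> unstable_space A"
    using subspace_scale[OF subspace_unstable_rate[of A \<gamma>]] unfolding unstable_space_def by blast
qed

lemma subspace_center_stable_space: "subspace (center_stable_space A)"
proof -
  have "center_stable_space A = \<Inter> ((\<lambda>\<delta>. {x. \<exists>C. \<forall>t\<ge>0. norm (flow (- A) (- t) x) \<le> C * exp (- (- \<delta>) * t)}) ` {0<..})"
    by (auto simp: center_stable_space_def flow_uminus)
  also have "subspace \<dots>"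
    by (rule subspace_Inter) (use subspace_unstable_rate in blast)
  finally show ?thesis .
qed

text \<open>Constants that depend on the vector can be made uniform in finite dimension: expand in an
  orthonormal basis.\<close>

lemma uniform_orbit_bound:
  fixes V :: "'a::euclidean_space set" and L :: "real \<Rightarrow> 'a \<Rightarrow> 'b::real_normed_vector"
  assumes V: "subspace V" and lin: "\<And>t. linear (L t)" and g: "\<And>t. g t \<ge> 0"
    and bd: "\<And>x. x \<in> V \<Longrightarrow> \<exists>C. \<forall>t\<ge>0. norm (L t x) \<le> C * g t"
  obtains C where "C > 0" "\<And>x t. x \<in> V \<Longrightarrow> t \<ge> 0 \<Longrightarrow> norm (L t x) \<le> C * g t * norm x"
proof -
  obtain B where B: "B \<subseteq> V" "pairwise orthogonal B" "\<And>x. x \<in> B \<Longrightarrow> norm x = 1" "independent B" "span B = V"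
    using orthonormal_basis_subspace[OF V] by metis
  have fin: "finite B" using B(4) by (rule independent_imp_finite)
  have "\<forall>b\<in>B. \<exists>C. \<forall>t\<ge>0. norm (L t b) \<le> C * g t" using bd B(1) by blast
  then obtain c where c: "\<And>b t. b \<in> B \<Longrightarrow> t \<ge> 0 \<Longrightarrow> norm (L t b) \<le> c b * g t"
    unfolding bchoice_iff by blast
  show thesis
  proof (rule that)
    show "(\<Sum>b\<in>B. \<bar>c b\<bar>) + 1 > 0" by (simp add: add_nonneg_pos sum_nonneg)
    fix x and t :: real assume x: "x \<in> V" and t: "t \<ge> 0"
    have "x = (\<Sum>b\<in>B. (x \<bullet> b) *\<^sub>R b)"
      using x B(5) by (intro orthonormal_basis_expand[symmetric] B(2,3) fin) auto
    then have "L t x = L t (\<Sum>b\<in>B. (x \<bullet> b) *\<^sub>R b)" by simp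
    also have "\<dots> = (\<Sum>b\<in>B. (x \<bullet> b) *\<^sub>R L t b)"
      by (simp only: linear_sum[OF lin] linear_scale[OF lin])
    also have "norm \<dots> \<le> (\<Sum>b\<in>B. norm x * (\<bar>c b\<bar> * g t))"
    proof (rule sum_norm_le)
      fix b assume b: "b \<in> B"
      have "\<bar>x \<bullet> b\<bar> \<le> norm x" using Cauchy_Schwarz_ineq2[of x b] B(3)[OF b] by simp
      moreover have "norm (L t b) \<le> \<bar>c b\<bar> * g t"
        using c[OF b t] g[of t] by (meson abs_ge_self mult_right_mono order_trans)
      ultimately show "norm ((x \<bullet> b) *\<^sub>R L t b) \<le> norm x * (\<bar>c b\<bar> * g t)"
        by (simp add: mult_mono)
    qed
    also have "\<dots> = (\<Sum>b\<in>B. \<bar>c b\<bar>) * g t * norm x"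
      by (simp add: sum_distrib_left sum_distrib_right mult_ac)
    also have "\<dots> \<le> ((\<Sum>b\<in>B. \<bar>c b\<bar>) + 1) * g t * norm x"
      using g[of t] by (intro mult_right_mono) auto
    finally show "norm (L t x) \<le> ((\<Sum>b\<in>B. \<bar>c b\<bar>) + 1) * g t * norm x" .
  qed
qed

lemma unstable_space_flow:
  fixes A :: "real^'n^'n"
  assumes "x \<in> unstable_space A" shows "flow A s x \<in> unstable_space A"
proof -
  obtain \<gamma> C where C: "\<gamma> > 0" "\<And>t. t \<ge> 0 \<Longrightarrow> norm (flow A (- t) x) \<le> C * exp (- \<gamma> * t)"
    using assms unfolding unstable_space_def by blast
  obtain K where K: "K > 0" "\<And>t x. s \<le> t \<Longrightarrow> t \<le> s \<Longrightarrow> norm (flow A t x) \<le> K * norm x"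
    using flow_bounded by blast
  have "norm (flow A (- t) (flow A s x)) \<le> (K * C) * exp (- \<gamma> * t)" if "t \<ge> 0" for t
  proof -
    have "flow A (- t) (flow A s x) = flow A s (flow A (- t) x)"
      unfolding flow_add[symmetric] by (simp only: add.commute)
    also have "norm \<dots> \<le> K * norm (flow A (- t) x)" by (rule K(2)) auto
    also have "\<dots> \<le> K * (C * exp (- \<gamma> * t))" using C(2)[OF that] K(1) by (intro mult_left_mono) auto
    finally show ?thesis by (simp only: mult.assoc)
  qed
  then show ?thesis using C(1) unfolding unstable_space_def by blast
qed

lemma center_stable_space_flow:
  fixes A :: "real^'n^'n"
  assumes "x \<in> center_stable_space A" shows "flow A s x \<in> center_stable_space A"
  unfolding center_stable_space_def mem_Collect_eq
proof (intro allI impI)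
  fix \<delta> :: real assume "\<delta> > 0"
  then obtain C where C: "\<And>t. t \<ge> 0 \<Longrightarrow> norm (flow A t x) \<le> C * exp (\<delta> * t)"
    using assms unfolding center_stable_space_def by blast
  obtain K where K: "K > 0" "\<And>t x. s \<le> t \<Longrightarrow> t \<le> s \<Longrightarrow> norm (flow A t x) \<le> K * norm x"
    using flow_bounded by blast
  have "norm (flow A t (flow A s x)) \<le> (K * C) * exp (\<delta> * t)" if "t \<ge> 0" for t
  proof -
    have "flow A t (flow A s x) = flow A s (flow A t x)"
      unfolding flow_add[symmetric] by (simp only: add.commute)
    also have "norm \<dots> \<le> K * norm (flow A t x)" by (rule K(2)) auto
    also have "\<dots> \<le> K * (C * exp (\<delta> * t))" using C[OF that] K(1) by (intro mult_left_mono) auto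
    finally show ?thesis by (simp only: mult.assoc)
  qed
  then show "\<exists>C. \<forall>t\<ge>0. norm (flow A t (flow A s x)) \<le> C * exp (\<delta> * t)" by blast
qed

lemma center_stable_bound:
  fixes A :: "real^'n^'n"
  assumes "\<delta> > 0"
  obtains C where "C > 0"
    "\<And>x t. x \<in> center_stable_space A \<Longrightarrow> t \<ge> 0 \<Longrightarrow> norm (flow A t x) \<le> C * exp (\<delta> * t) * norm x"
proof -
  show thesis
  proof (rule uniform_orbit_bound[OF subspace_center_stable_space, of "flow A" "\<lambda>t. exp (\<delta> * t)"])
    show "\<exists>C. \<forall>t\<ge>0. norm (flow A t x) \<le> C * exp (\<delta> * t)" if "x \<in> center_stable_space A" for x
      using that assms unfolding center_stable_space_def by blast
  qed (auto intro: that)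
qed

text \<open>The decay rate in the definition of the unstable space depends on the vector as well; on a basis
  the smallest rate works.\<close>

lemma unstable_bound:
  fixes A :: "real^'n^'n"
  obtains C \<gamma> where "C > 0" "\<gamma> > 0"
    "\<And>x t. x \<in> unstable_space A \<Longrightarrow> t \<ge> 0 \<Longrightarrow> norm (flow A (- t) x) \<le> C * exp (- \<gamma> * t) * norm x"
proof -
  let ?V = "\<lambda>\<gamma>. {x. \<exists>C. \<forall>t\<ge>0. norm (flow A (- t) x) \<le> C * exp (- \<gamma> * t)}"
  have mono: "?V b \<subseteq> ?V a" if "a \<le> b" for a b
    using unstable_rate_mono[OF that] .
  obtain B where B: "B \<subseteq> unstable_space A" "independent B" "unstable_space A \<subseteq> span B"
    using basis_exists[of "unstable_space A"] by metis
  have "finite B" using B(2) by (rule independent_imp_finite)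
  then have "\<exists>\<gamma>>0. B \<subseteq> ?V \<gamma>" using B(1)
  proof (induction B rule: finite_induct)
    case empty
    show ?case using zero_less_one by blast
  next
    case (insert b B)
    then obtain \<gamma> \<gamma>' where g: "\<gamma> > 0" "B \<subseteq> ?V \<gamma>" "\<gamma>' > 0" "b \<in> ?V \<gamma>'"
      unfolding unstable_space_def by auto
    have "insert b B \<subseteq> ?V (min \<gamma> \<gamma>')"
      using g mono[of "min \<gamma> \<gamma>'"] by (meson insert_subset min.cobounded1 min.cobounded2 subset_trans subsetD)
    then show ?case using g min_less_iff_conj[of 0 \<gamma> \<gamma>'] by blast
  qed
  then obtain \<gamma> where g: "\<gamma> > 0" "B \<subseteq> ?V \<gamma>" by blast
  have "unstable_space A \<subseteq> ?V \<gamma>"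
    using B(3) span_minimal[OF g(2) subspace_unstable_rate] by blast
  then have bd: "\<exists>C. \<forall>t\<ge>0. norm (flow A (- t) x) \<le> C * exp (- \<gamma> * t)" if "x \<in> unstable_space A" for x
    using that by blast
  show thesis
    by (rule uniform_orbit_bound[OF subspace_unstable_space, of "\<lambda>t. flow A (- t)" "\<lambda>t. exp (- \<gamma> * t)"])
      (use bd in \<open>auto intro: that[OF _ g(1)]\<close>)
qed

text \<open>Writing \<open>x\<close> as \<open>flow A n (flow A (- n) x)\<close>, decay backward at rate \<open>\<gamma>\<close> beats growth forward at
  rate \<open>\<gamma> / 2\<close>. This needs a growth constant that is uniform on the centre-stable space.\<close>

lemma unstable_center_stable_disjoint:
  fixes A :: "real^'n^'n"
  assumes "x \<in> unstable_space A" "x \<in> center_stable_space A"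
  shows "x = 0"
proof -
  obtain \<gamma> C where C: "\<gamma> > 0" "\<And>t. t \<ge> 0 \<Longrightarrow> norm (flow A (- t) x) \<le> C * exp (- \<gamma> * t)"
    using assms(1) unfolding unstable_space_def by blast
  have "\<gamma> / 2 > 0" using C(1) by simp
  then obtain K where K: "K > 0"
    "\<And>x t. x \<in> center_stable_space A \<Longrightarrow> t \<ge> 0 \<Longrightarrow> norm (flow A t x) \<le> K * exp (\<gamma> / 2 * t) * norm x"
    using center_stable_bound[of "\<gamma> / 2" A] by blast
  have "norm x \<le> (K * C) * exp (- (\<gamma> / 2) * real n)" for n
  proof -
    have "norm x = norm (flow A (real n) (flow A (- real n) x))" by (simp only: flow_inverse)
    also have "\<dots> \<le> K * exp (\<gamma> / 2 * real n) * norm (flow A (- real n) x)"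
      by (rule K(2)[OF center_stable_space_flow[OF assms(2)]]) simp
    also have "\<dots> \<le> K * exp (\<gamma> / 2 * real n) * (C * exp (- \<gamma> * real n))"
      using K(1) C(2)[of "real n"] by (intro mult_left_mono) auto
    also have "\<dots> = (K * C) * (exp (\<gamma> / 2 * real n) * exp (- \<gamma> * real n))" by simp
    also have "exp (\<gamma> / 2 * real n) * exp (- \<gamma> * real n) = exp (- (\<gamma> / 2) * real n)"
      unfolding exp_add[symmetric] by (simp add: field_simps)
    finally show ?thesis .
  qed
  moreover have "(\<lambda>n. (K * C) * exp (- (\<gamma> / 2) * real n)) \<longlonglongrightarrow> (K * C) * 0"
  proof (intro tendsto_mult tendsto_const)
    have "filterlim (\<lambda>n. - (\<gamma> / 2) * real n) at_bot sequentially"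
      using C(1) by (intro filterlim_tendsto_neg_mult_at_bot[OF tendsto_const _ filterlim_real_sequentially]) simp
    then show "(\<lambda>n. exp (- (\<gamma> / 2) * real n)) \<longlonglongrightarrow> 0"
      by (rule filterlim_compose[OF exp_at_bot])
  qed
  ultimately have "norm x \<le> (K * C) * 0" by (intro LIMSEQ_le_const) auto
  then show ?thesis by simp
qed

definition unstable_proj :: "real^'n^'n \<Rightarrow> real^'n \<Rightarrow> real^'n" where
  "unstable_proj A x = (SOME y. y \<in> unstable_space A \<and> x - y \<in> center_stable_space A)"

lemma unstable_proj:
  fixes A :: "real^'n^'n"
  shows "unstable_proj A x \<in> unstable_space A" "x - unstable_proj A x \<in> center_stable_space A"
proof -
  obtain y z where "x = y + z" "y \<in> unstable_space A" "z \<in> center_stable_space A"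
    using real_splitting[OF zero_less_one] by metis
  then have "\<exists>y. y \<in> unstable_space A \<and> x - y \<in> center_stable_space A" by auto
  then show "unstable_proj A x \<in> unstable_space A" "x - unstable_proj A x \<in> center_stable_space A"
    unfolding unstable_proj_def by (metis (mono_tags, lifting) someI_ex)+
qed

lemma unstable_proj_unique:
  fixes A :: "real^'n^'n"
  assumes "y \<in> unstable_space A" "x - y \<in> center_stable_space A"
  shows "unstable_proj A x = y"
proof -
  have "unstable_proj A x - y \<in> unstable_space A"
    by (intro subspace_diff[OF subspace_unstable_space] unstable_proj assms)
  moreover have "(x - y) - (x - unstable_proj A x) \<in> center_stable_space A"
    by (intro subspace_diff[OF subspace_center_stable_space] unstable_proj assms)
  ultimately show ?thesis using unstable_center_stable_disjoint[of "unstable_proj A x - y" A] by simp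
qed

lemma linear_unstable_proj: "linear (unstable_proj A)"
proof (rule linearI)
  fix x y and c :: real
  show "unstable_proj A (x + y) = unstable_proj A x + unstable_proj A y"
  proof (rule unstable_proj_unique)
    show "unstable_proj A x + unstable_proj A y \<in> unstable_space A"
      by (intro subspace_add[OF subspace_unstable_space] unstable_proj)
    have "(x - unstable_proj A x) + (y - unstable_proj A y) \<in> center_stable_space A"
      by (intro subspace_add[OF subspace_center_stable_space] unstable_proj)
    then show "x + y - (unstable_proj A x + unstable_proj A y) \<in> center_stable_space A"
      by (simp add: algebra_simps)
  qed
  show "unstable_proj A (c *\<^sub>R x) = c *\<^sub>R unstable_proj A x"
  proof (rule unstable_proj_unique)
    show "c *\<^sub>R unstable_proj A x \<in> unstable_space A"
      by (intro subspace_scale[OF subspace_unstable_space] unstable_proj)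
    have "c *\<^sub>R (x - unstable_proj A x) \<in> center_stable_space A"
      by (intro subspace_scale[OF subspace_center_stable_space] unstable_proj)
    then show "c *\<^sub>R x - c *\<^sub>R unstable_proj A x \<in> center_stable_space A"
      by (simp add: algebra_simps)
  qed
qed

lemma unstable_proj_flow: "unstable_proj A (flow A t x) = flow A t (unstable_proj A x)"
proof (rule unstable_proj_unique)
  show "flow A t (unstable_proj A x) \<in> unstable_space A"
    by (intro unstable_space_flow unstable_proj)
  have "flow A t (x - unstable_proj A x) \<in> center_stable_space A"
    by (intro center_stable_space_flow unstable_proj)
  then show "flow A t x - flow A t (unstable_proj A x) \<in> center_stable_space A"
    by (simp add: flow_diff)
qed

text \<open>A centre-stable vector is its own centre-stable component, and \<open>real_splitting\<close> supplies one that
  small jumps can steer to 0.\<close>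

lemma center_stable_chain_to_zero:
  fixes A :: "real^'n^'n"
  assumes x: "x \<in> center_stable_space A" and T: "T > 0"
  shows "chain_to_zero (flow A T) x"
proof -
  obtain y z where yz: "x = y + z" "y \<in> unstable_space A" "z \<in> center_stable_space A"
    "chain_to_zero (flow A T) z"
    using real_splitting[OF T] by metis
  then have "y \<in> center_stable_space A"
    using subspace_diff[OF subspace_center_stable_space x yz(3)] by simp
  then show ?thesis using unstable_center_stable_disjoint[OF yz(2)] yz(1,4) by simp
qed

section \<open>Trajectories of the control system\<close>

lemma AE_lebesgue_iff_negligible: "(AE x in lebesgue. P x) \<longleftrightarrow> negligible {x. \<not> P x}"
proof
  assume "AE x in lebesgue. P x"
  then obtain N where "N \<in> null_sets lebesgue" "{x. \<not> P x} \<subseteq> N"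
    by (auto simp: eventually_ae_filter)
  then show "negligible {x. \<not> P x}"
    using negligible_iff_null_sets negligible_subset by blast
next
  assume "negligible {x. \<not> P x}"
  then show "AE x in lebesgue. P x"
    by (auto simp: eventually_ae_filter negligible_iff_null_sets intro!: bexI[of _ "{x. \<not> P x}"])
qed

text \<open>The forced response transported back to time 0. The solution at time \<open>t\<close> is then
  \<open>flow A t (x + pullback_input A B t u)\<close>, and the state that \<open>u\<close> steers to the origin in time \<open>t\<close> is
  \<open>- pullback_input A B t u\<close>.\<close>

definition pullback_input ::
  "real^'n^'n \<Rightarrow> real^'m^'n \<Rightarrow> real \<Rightarrow> (real \<Rightarrow> real^'m) \<Rightarrow> real^'n" where
  "pullback_input A B t u = integral {0..t} (\<lambda>s. flow A (- s) (B *v u s))"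

lemma pullback_input_cong:
  assumes "negligible N" "\<And>s. 0 \<le> s \<Longrightarrow> s \<le> t \<Longrightarrow> s \<notin> N \<Longrightarrow> u s = v s"
  shows "pullback_input A B t u = pullback_input A B t v"
  unfolding pullback_input_def by (rule integral_spike[OF assms(1)]) (use assms(2) in auto)

lemma pullback_input_zero [simp]: "pullback_input A B 0 u = 0" "pullback_input A B t (\<lambda>_. 0) = 0"
  by (simp_all add: pullback_input_def)

context
  fixes U :: "(real^'m) set"
  assumes U: "compact U" "0 \<in> U"
begin

lemma controls_iff: "u \<in> controls U \<longleftrightarrow> u \<in> borel_measurable lebesgue \<and> negligible {s. u s \<notin> U}"
proof -
  obtain R where R: "\<And>x. x \<in> U \<Longrightarrow> norm x \<le> R"
    using compact_imp_bounded[OF U(1)] unfolding bounded_iff by blast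
  have "negligible {s. \<not> norm (u s) \<le> R}" if "negligible {s. u s \<notin> U}"
    using that by (rule negligible_subset) (use R in auto)
  then show ?thesis unfolding controls_def by (auto simp: AE_lebesgue_iff_negligible)
qed

lemma controls_zero: "(\<lambda>_. 0) \<in> controls U"
  by (simp add: controls_iff U)

lemma controls_affine:
  assumes u: "u \<in> controls U" and c: "c \<noteq> 0"
  shows "(\<lambda>s. u (c * s + d)) \<in> controls U"
  unfolding controls_iff
proof
  have "(\<lambda>s. d + (\<Sum>j\<in>Basis. (c * (s \<bullet> j)) *\<^sub>R j)) \<in> lebesgue \<rightarrow>\<^sub>M (lebesgue :: real measure)"
    by (rule lebesgue_affine_measurable) (use c in auto)
  then have "(\<lambda>s. c * s + d) \<in> lebesgue \<rightarrow>\<^sub>M (lebesgue :: real measure)"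
    by (simp add: add.commute)
  then show "(\<lambda>s. u (c * s + d)) \<in> borel_measurable lebesgue"
    using u by (auto simp: controls_iff intro: measurable_compose)
  have "negligible ((\<lambda>t. (t - d) / c) ` {s. u s \<notin> U})"
    using u c by (intro negligible_differentiable_image_negligible)
      (auto simp: controls_iff intro!: derivative_intros differentiable_at_imp_differentiable_on)
  moreover have "{s. u (c * s + d) \<notin> U} \<subseteq> (\<lambda>t. (t - d) / c) ` {s. u s \<notin> U}"
  proof
    fix s assume s: "s \<in> {s. u (c * s + d) \<notin> U}"
    have "s = ((c * s + d) - d) / c" using c by simp
    then show "s \<in> (\<lambda>t. (t - d) / c) ` {s. u s \<notin> U}" using s by blast
  qed
  ultimately show "negligible {s. u (c * s + d) \<notin> U}" by (rule negligible_subset)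
qed

lemma controls_shift: "u \<in> controls U \<Longrightarrow> (\<lambda>s. u (\<tau> + s)) \<in> controls U"
  using controls_affine[of u 1 \<tau>] by (simp add: add.commute)

lemma controls_reverse: "u \<in> controls U \<Longrightarrow> (\<lambda>s. u (\<tau> - s)) \<in> controls U"
  using controls_affine[of u "-1" \<tau>] by simp

lemma controls_concat:
  assumes u: "u \<in> controls U" and v: "v \<in> controls U"
  shows "(\<lambda>s. if s < \<tau> then u s else v (s - \<tau>)) \<in> controls U"
proof -
  have v': "(\<lambda>s. v (s - \<tau>)) \<in> controls U" using controls_affine[OF v, of 1 "- \<tau>"] by simp
  show ?thesis
    unfolding controls_iff
  proof
    show "(\<lambda>s. if s < \<tau> then u s else v (s - \<tau>)) \<in> borel_measurable lebesgue"
    proof (rule measurable_If)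
      show "{s \<in> space lebesgue. s < \<tau>} \<in> sets (lebesgue :: real measure)"
        using lmeasurable_iff_has_integral by (simp add: lessThan_def[symmetric])
    qed (use u v' in \<open>auto simp: controls_iff\<close>)
    have "negligible ({s. u s \<notin> U} \<union> {s. v (s - \<tau>) \<notin> U})"
      using u v' by (intro negligible_Un) (auto simp: controls_iff)
    then show "negligible {s. (if s < \<tau> then u s else v (s - \<tau>)) \<notin> U}"
      by (rule negligible_subset) auto
  qed
qed

text \<open>Controls take values in \<open>U\<close> only almost everywhere; estimates of integrals are simpler for a
  representative that does so everywhere.\<close>

lemma controls_pointwise:
  assumes u: "u \<in> controls U"
  obtains v where "v \<in> controls U" "\<And>s. v s \<in> U" "negligible {s. u s \<noteq> v s}"
proof
  let ?v = "\<lambda>s. if u s \<in> U then u s else 0"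
  show "?v \<in> controls U"
    unfolding controls_iff
  proof
    have "u -` U \<inter> space lebesgue \<in> sets lebesgue"
      using u compact_imp_closed[OF U(1)] by (intro measurable_sets[of u lebesgue borel]) (auto simp: controls_iff)
    then show "?v \<in> borel_measurable lebesgue"
      using u by (intro measurable_If) (auto simp: controls_iff vimage_def)
  qed (simp add: U)
  show "?v s \<in> U" for s using U by simp
  show "negligible {s. u s \<noteq> ?v s}"
    using u by (auto simp: controls_iff intro: negligible_subset)
qed

lemma input_bound:
  fixes B :: "real^'m^'n"
  obtains M where "M > 0" "\<And>x. x \<in> U \<Longrightarrow> norm (B *v x) \<le> M"
proof -
  obtain R where R: "\<And>x. x \<in> (\<lambda>x. B *v x) ` U \<Longrightarrow> norm x \<le> R"
    using bounded_linear_image[OF compact_imp_bounded[OF U(1)], of "(*v) B"]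
    unfolding bounded_iff by (auto simp: linear_conv_bounded_linear[symmetric])
  show thesis by (rule that[of "\<bar>R\<bar> + 1"]) (use R in force)+
qed

lemma pullback_integrable:
  fixes A :: "real^'n^'n" and B :: "real^'m^'n"
  assumes u: "u \<in> controls U"
  shows "(\<lambda>s. flow A (- s) (B *v u s)) absolutely_integrable_on {a..b}"
proof -
  obtain v where v: "v \<in> controls U" "\<And>s. v s \<in> U" "negligible {s. u s \<noteq> v s}"
    using controls_pointwise[OF u] by blast
  obtain M where M: "M > 0" "\<And>x. x \<in> U \<Longrightarrow> norm (B *v x) \<le> M" using input_bound[of B] by blast
  obtain K where K: "K > 0" "\<And>t x. - b \<le> t \<Longrightarrow> t \<le> - a \<Longrightarrow> norm (flow A t x) \<le> K * norm x"
    using flow_bounded by blast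
  have "(\<lambda>s. flow A (- s) (B *v v s)) absolutely_integrable_on {a..b}"
  proof (rule measurable_bounded_by_integrable_imp_absolutely_integrable)
    have "(\<lambda>s. matrix_exp (s *\<^sub>R (- A))) \<in> borel_measurable borel"
      by (intro borel_measurable_continuous_onI continuous_on_matrix_exp)
    then have X: "(\<lambda>s. matrix_exp (s *\<^sub>R (- A))) \<in> borel_measurable lebesgue"
      by (simp add: measurable_completion)
    have Bv: "(\<lambda>s. B *v v s) \<in> borel_measurable lebesgue"
      using v(1) by (intro borel_measurable_continuous_on[of "(*v) B"])
        (auto simp: controls_iff intro!: linear_continuous_on simp: linear_conv_bounded_linear[symmetric])
    have "continuous_on UNIV (\<lambda>p. (fst p :: real^'n^'n) *v snd p)"
      by (intro bounded_bilinear.continuous_on[OF bounded_bilinear_matrix_vector_mult] continuous_intros)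
    then have "(\<lambda>s. matrix_exp (s *\<^sub>R (- A)) *v (B *v v s)) \<in> borel_measurable lebesgue"
      by (rule borel_measurable_continuous_Pair[OF X Bv])
    then show "(\<lambda>s. flow A (- s) (B *v v s)) \<in> borel_measurable (lebesgue_on {a..b})"
      by (intro measurable_restrict_space1) (simp add: flow_def)
    show "norm (flow A (- s) (B *v v s)) \<le> K * M" if "s \<in> {a..b}" for s
    proof -
      have "norm (flow A (- s) (B *v v s)) \<le> K * norm (B *v v s)" using that by (intro K(2)) auto
      also have "\<dots> \<le> K * M" using M(2)[OF v(2)[of s]] K(1) by simp
      finally show ?thesis .
    qed
  qed auto
  then show ?thesis
    by (rule absolutely_integrable_spike[OF _ v(3)]) auto
qed

lemma forced_response_pullback:
  fixes A :: "real^'n^'n" and B :: "real^'m^'n"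
  assumes u: "u \<in> controls U" and t: "t \<ge> 0"
  shows "forced_response A B t u = flow A t (pullback_input A B t u)"
proof -
  have eq: "matrix_exp ((t - s) *\<^sub>R A) *v (B *v u s) = flow A t (flow A (- s) (B *v u s))" for s
    by (simp only: flow_def[symmetric] flow_add[symmetric]) simp
  have ai: "(\<lambda>s. flow A t (flow A (- s) (B *v u s))) absolutely_integrable_on {0..t}"
    using absolutely_integrable_linear[OF pullback_integrable[OF u], of "flow A t"]
    by (simp add: o_def linear_conv_bounded_linear[symmetric])
  have "forced_response A B t u = (LINT s:{0<..<t}|lebesgue. flow A t (flow A (- s) (B *v u s)))"
    using t by (simp add: forced_response_def interval_lebesgue_integral_def eq zero_ereal_def)
  also have "\<dots> = integral {0<..<t} (\<lambda>s. flow A t (flow A (- s) (B *v u s)))"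
    by (intro set_lebesgue_integral_eq_integral set_integrable_subset[OF ai]) auto
  also have "\<dots> = integral {0..t} (\<lambda>s. flow A t (flow A (- s) (B *v u s)))"
    by (simp only: integral_open_interval_real)
  also have "\<dots> = flow A t (pullback_input A B t u)"
    using integral_linear[OF set_lebesgue_integral_eq_integral(1)[OF pullback_integrable[OF u]], of "flow A t"]
    by (simp add: o_def linear_conv_bounded_linear[symmetric] pullback_input_def)
  finally show ?thesis .
qed

lemma pullback_input_add:
  fixes A :: "real^'n^'n" and B :: "real^'m^'n"
  assumes u: "u \<in> controls U" and st: "s \<ge> 0" "t \<ge> 0"
  shows "pullback_input A B (s + t) u =
    pullback_input A B s u + flow A (- s) (pullback_input A B t (\<lambda>r. u (s + r)))"
proof -
  let ?f = "\<lambda>r. flow A (- r) (B *v u r)"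
  have int: "?f integrable_on {a..b}" for a b
    by (rule set_lebesgue_integral_eq_integral(1)[OF pullback_integrable[OF u]])
  have "pullback_input A B (s + t) u = integral {0..s} ?f + integral {s..s + t} ?f"
    unfolding pullback_input_def using st by (intro Henstock_Kurzweil_Integration.integral_combine[symmetric] int) auto
  also have "integral {s..s + t} ?f = integral {0..t} (\<lambda>r. ?f (s + r))"
    using integral_shift_Icc_real[of 0 t ?f s] by (simp add: o_def add.commute)
  also have "\<dots> = integral {0..t} (\<lambda>r. flow A (- s) (flow A (- r) (B *v u (s + r))))"
    by (simp add: flow_add[symmetric])
  also have "\<dots> = flow A (- s) (pullback_input A B t (\<lambda>r. u (s + r)))"
    using integral_linear[OF set_lebesgue_integral_eq_integral(1)[OF pullback_integrable[OF controls_shift[OF u]]], of "flow A (- s)"]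
    by (simp add: o_def linear_conv_bounded_linear[symmetric] pullback_input_def)
  finally show ?thesis by (simp add: pullback_input_def)
qed

lemma pullback_input_reverse:
  fixes A :: "real^'n^'n" and B :: "real^'m^'n"
  assumes u: "u \<in> controls U" and t: "t \<ge> 0"
  shows "pullback_input (- A) (- B) t (\<lambda>s. u (t - s)) = - flow A t (pullback_input A B t u)"
proof -
  let ?f = "\<lambda>r. flow A (- r) (B *v u r)"
  have "(?f has_integral pullback_input A B t u) {0..t}"
    using set_lebesgue_integral_eq_integral(1)[OF pullback_integrable[OF u]]
    unfolding pullback_input_def by (rule integrable_integral)
  then have "((\<lambda>r. ?f (- r)) has_integral pullback_input A B t u) {- t..0}"
    using Henstock_Kurzweil_Integration.has_integral_reflect_real[of ?f _ t 0] by simp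
  then have "((\<lambda>r. ?f (- (r + - t))) has_integral pullback_input A B t u) {0..t}"
    using has_integral_shift_real_ivl[of "\<lambda>r. ?f (- r)" _ "- t" 0 "- t"] by simp
  moreover have "bounded_linear (\<lambda>x. - flow A t x)"
    by (simp add: linear_conv_bounded_linear[symmetric] linear_compose_neg)
  ultimately have "((\<lambda>x. - flow A t x) \<circ> (\<lambda>r. ?f (- (r + - t))) has_integral
      - flow A t (pullback_input A B t u)) {0..t}"
    by (rule has_integral_linear)
  moreover have "(\<lambda>x. - flow A t x) \<circ> (\<lambda>r. ?f (- (r + - t))) =
      (\<lambda>r. flow (- A) (- r) (- B *v u (t - r)))"
  proof
    fix r
    have "flow A t (flow A (- (- (r + - t))) x) = flow (- A) (- r) x" for x
      unfolding flow_uminus flow_add[symmetric] by simp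
    moreover have "- B *v x = - (B *v x)" for x
      by (simp add: matrix_vector_mult_def vec_eq_iff sum_negf)
    ultimately show "((\<lambda>x. - flow A t x) \<circ> (\<lambda>r. ?f (- (r + - t)))) r = flow (- A) (- r) (- B *v u (t - r))"
      by (simp add: linear_neg[OF linear_flow])
  qed
  ultimately show ?thesis
    unfolding pullback_input_def[of "- A"] by (simp only: integral_unique)
qed

text \<open>The antiderivative \<open>h\<close> of the bounding rate is a parameter, so that the exponential bounds used later need
  no integral to be computed.\<close>

lemma pullback_input_bound:
  fixes A :: "real^'n^'n" and B :: "real^'m^'n" and Q :: "real^'n \<Rightarrow> real^'p"
  assumes u: "u \<in> controls U" and M: "\<And>x. x \<in> U \<Longrightarrow> norm (B *v x) \<le> M"
    and Q: "linear Q" and t: "t \<ge> 0"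
    and bd: "\<And>s x. 0 \<le> s \<Longrightarrow> s \<le> t \<Longrightarrow> norm (Q (flow A (- s) x)) \<le> h' s * norm x"
    and h: "\<And>s. (h has_real_derivative h' s) (at s)"
  shows "norm (Q (pullback_input A B t u)) \<le> (h t - h 0) * M"
proof -
  obtain v where v: "v \<in> controls U" "\<And>s. v s \<in> U" "negligible {s. u s \<noteq> v s}"
    using controls_pointwise[OF u] by blast
  have uv: "pullback_input A B t u = pullback_input A B t v"
    by (rule pullback_input_cong[OF v(3)]) simp
  have int: "(\<lambda>s. flow A (- s) (B *v v s)) integrable_on {0..t}"
    by (rule set_lebesgue_integral_eq_integral(1)[OF pullback_integrable[OF v(1)]])
  have Q': "bounded_linear Q" using Q by (simp add: linear_conv_bounded_linear)
  have hi: "((\<lambda>s. h' s * M) has_integral (h t - h 0) * M) {0..t}"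
    by (intro has_integral_mult_left fundamental_theorem_of_calculus t)
      (use h in \<open>auto simp: has_real_derivative_iff_has_vector_derivative[symmetric] intro: has_field_derivative_at_within\<close>)
  have "norm (integral {0..t} (Q \<circ> (\<lambda>s. flow A (- s) (B *v v s)))) \<le> integral {0..t} (\<lambda>s. h' s * M)"
  proof (rule integral_norm_bound_integral)
    show "Q \<circ> (\<lambda>s. flow A (- s) (B *v v s)) integrable_on {0..t}"
      by (rule integrable_linear[OF int Q'])
    show "(\<lambda>s. h' s * M) integrable_on {0..t}" using hi by blast
    fix s assume s: "s \<in> {0..t}"
    have h'0: "h' s \<ge> 0"
    proof -
      have "0 \<le> h' s * norm (SOME i. i \<in> Basis :: real^'n)"
        using bd[of s "SOME i. i \<in> Basis"] s order_trans[OF norm_ge_zero] by auto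
      then show ?thesis by (simp add: SOME_Basis)
    qed
    have "norm (Q (flow A (- s) (B *v v s))) \<le> h' s * norm (B *v v s)" using bd s by auto
    also have "\<dots> \<le> h' s * M" using M[OF v(2)[of s]] h'0 by (intro mult_left_mono)
    finally show "norm ((Q \<circ> (\<lambda>s. flow A (- s) (B *v v s))) s) \<le> h' s * M" by simp
  qed
  then show ?thesis
    unfolding integral_linear[OF int Q'] integral_unique[OF hi] uv
    by (simp only: pullback_input_def)
qed

end

section \<open>Chains and Lyapunov functions\<close>

definition chain_step ::
  "'s set \<Rightarrow> ('s \<Rightarrow> 's \<Rightarrow> real) \<Rightarrow> 'c set \<Rightarrow> (real \<Rightarrow> 's \<Rightarrow> 'c \<Rightarrow> 's) \<Rightarrow>
    real \<Rightarrow> real \<Rightarrow> 's \<Rightarrow> 's \<Rightarrow> bool" where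
  "chain_step M d C f \<epsilon> T x y \<longleftrightarrow> x \<in> M \<and> y \<in> M \<and> (\<exists>u\<in>C. \<exists>t\<ge>T. d (f t x u) y < \<epsilon>)"

lemma controlled_chain_iff_tranclp:
  "controlled_chain M d C f \<epsilon> T x y \<longleftrightarrow> (chain_step M d C f \<epsilon> T)\<^sup>+\<^sup>+ x y"
proof
  assume "controlled_chain M d C f \<epsilon> T x y"
  then obtain k :: nat and xs us ts where c: "k \<ge> 1" "xs 0 = x" "xs k = y" "\<forall>j\<le>k. xs j \<in> M"
    "\<forall>j<k. us j \<in> C \<and> ts j \<ge> T \<and> d (f (ts j) (xs j) (us j)) (xs (Suc j)) < \<epsilon>"
    unfolding controlled_chain_def by blast
  have "\<forall>i<k. chain_step M d C f \<epsilon> T (xs i) (xs (Suc i))"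
    unfolding chain_step_def using c by (meson Suc_leI less_imp_le_nat)
  then have "(chain_step M d C f \<epsilon> T ^^ k) x y"
    unfolding relpowp_fun_conv using c by blast
  then show "(chain_step M d C f \<epsilon> T)\<^sup>+\<^sup>+ x y"
    unfolding tranclp_power using c(1) by (intro exI[of _ k]) auto
next
  assume "(chain_step M d C f \<epsilon> T)\<^sup>+\<^sup>+ x y"
  then obtain n xs where n: "n > 0" "xs 0 = x" "xs n = y"
    and step: "\<And>i. i < n \<Longrightarrow> chain_step M d C f \<epsilon> T (xs i) (xs (Suc i))"
    unfolding tranclp_power relpowp_fun_conv by blast
  have "xs j \<in> M" if "j \<le> n" for j
  proof (cases "j < n")
    case True
    then show ?thesis using step[of j] by (simp add: chain_step_def)
  next
    case False
    then have "j = Suc (n - 1)" using that n(1) by simp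
    then show ?thesis using step[of "n - 1"] n(1) by (simp add: chain_step_def)
  qed
  moreover have "\<forall>i\<in>{..<n}. \<exists>p. fst p \<in> C \<and> snd p \<ge> T \<and> d (f (snd p) (xs i) (fst p)) (xs (Suc i)) < \<epsilon>"
    using step unfolding chain_step_def by force
  then obtain p where "\<And>i. i < n \<Longrightarrow> fst (p i) \<in> C \<and> snd (p i) \<ge> T \<and> d (f (snd (p i)) (xs i) (fst (p i))) (xs (Suc i)) < \<epsilon>"
    unfolding bchoice_iff by auto
  ultimately show "controlled_chain M d C f \<epsilon> T x y"
    unfolding controlled_chain_def using n
    by (intro exI[of _ n] exI[of _ xs] exI[of _ "\<lambda>i. fst (p i)"] exI[of _ "\<lambda>i. snd (p i)"]) auto
qed

lemma chain_controllable_iff: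
  "chain_controllable M d C f S \<longleftrightarrow>
    (\<forall>x\<in>S. \<forall>y\<in>S. \<forall>\<epsilon>>0. \<forall>T>0. (chain_step M d C f \<epsilon> T)\<^sup>+\<^sup>+ x y)"
  by (simp add: chain_controllable_def controlled_chain_iff_tranclp)

text \<open>Chains through a common point connect the two sets.\<close>

lemma chain_control_set_absorbs:
  assumes E: "chain_control_set M d C f E" and S: "chain_controllable M d C f S" "S \<subseteq> M" "S \<inter> E \<noteq> {}"
  shows "S \<subseteq> E"
proof -
  obtain z where z: "z \<in> S" "z \<in> E" using S(3) by blast
  have E': "chain_controllable M d C f E" using E by (simp add: chain_control_set_def)
  have "chain_controllable M d C f (E \<union> S)"
    unfolding chain_controllable_iff
  proof (intro ballI allI impI)
    fix x y and \<epsilon> T :: real assume xy: "x \<in> E \<union> S" "y \<in> E \<union> S" and eT: "\<epsilon> > 0" "T > 0"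
    have "(chain_step M d C f \<epsilon> T)\<^sup>+\<^sup>+ x z" "(chain_step M d C f \<epsilon> T)\<^sup>+\<^sup>+ z y"
      using xy z eT E' S(1) unfolding chain_controllable_iff by blast+
    then show "(chain_step M d C f \<epsilon> T)\<^sup>+\<^sup>+ x y" by (rule tranclp_trans)
  qed
  moreover have "E \<union> S \<subseteq> M" using E S(2) by (auto simp: chain_control_set_def)
  ultimately have "E \<union> S = E" using E unfolding chain_control_set_def by blast
  then show ?thesis by blast
qed

text \<open>The gain condition says that \<open>\<sigma> / (1 - \<sigma>)\<close> at least doubles along segments of length \<open>T\<close> or more.
  So a level \<open>m\<close> strictly between 0 and 1 is raised to at least \<open>2 * m / (1 + m) > m\<close>, and jumps
  that change \<open>\<sigma>\<close> by less than the difference never bring a chain back to it.\<close>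

lemma chain_controllable_lyapunov:
  fixes \<sigma> :: "'s \<Rightarrow> real"
  assumes S: "chain_controllable M d C f S"
    and range: "\<And>p. p \<in> M \<Longrightarrow> 0 \<le> \<sigma> p \<and> \<sigma> p \<le> 1"
    and unif: "\<And>\<eta>. \<eta> > 0 \<Longrightarrow> \<exists>\<epsilon>>0. \<forall>p\<in>M. \<forall>q\<in>M. d p q < \<epsilon> \<longrightarrow> \<bar>\<sigma> p - \<sigma> q\<bar> < \<eta>"
    and gain: "\<And>t u p. t \<ge> T \<Longrightarrow> u \<in> C \<Longrightarrow> p \<in> M \<Longrightarrow>
      f t p u \<in> M \<and> 2 * \<sigma> p \<le> \<sigma> (f t p u) * (1 + \<sigma> p)" and T: "T > 0"
    and p: "p \<in> S" "p \<in> M" and q: "q \<in> S" "q \<in> M"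
  shows "\<sigma> p = \<sigma> q \<and> (\<sigma> p = 0 \<or> \<sigma> p = 1)"
proof -
  have trap: "m < \<sigma> y" if x: "x \<in> S" "x \<in> M" "y \<in> S" and m: "0 < m" "m < 1" "m \<le> \<sigma> x" for x y m
  proof -
    define g where "g = 2 * m / (1 + m)"
    have g: "m < g" using m by (simp add: g_def pos_less_divide_eq algebra_simps)
    then obtain \<epsilon> where e: "\<epsilon> > 0" "\<And>p q. p \<in> M \<Longrightarrow> q \<in> M \<Longrightarrow> d p q < \<epsilon> \<Longrightarrow> \<bar>\<sigma> p - \<sigma> q\<bar> < g - m"
      using unif[of "g - m"] by auto
    have step: "m < \<sigma> b" if "chain_step M d C f \<epsilon> T a b" "m \<le> \<sigma> a" for a b
    proof -
      obtain u t where ut: "a \<in> M" "b \<in> M" "u \<in> C" "t \<ge> T" "d (f t a u) b < \<epsilon>"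
        using \<open>chain_step M d C f \<epsilon> T a b\<close> unfolding chain_step_def by blast
      have fM: "f t a u \<in> M" and ga: "2 * \<sigma> a \<le> \<sigma> (f t a u) * (1 + \<sigma> a)"
        using gain ut by blast+
      have sa: "0 \<le> \<sigma> a" "0 < 1 + \<sigma> a" using range[OF ut(1)] by auto
      have "g \<le> 2 * \<sigma> a / (1 + \<sigma> a)"
        using m(1) that(2) sa by (simp add: g_def field_simps)
      also have "\<dots> \<le> \<sigma> (f t a u)" using ga sa by (simp add: pos_divide_le_eq)
      finally have "g \<le> \<sigma> (f t a u)" .
      then show ?thesis using e(2)[OF fM ut(2,5)] by linarith
    qed
    have "(chain_step M d C f \<epsilon> T)\<^sup>+\<^sup>+ x y"
      using S x e(1) T unfolding chain_controllable_iff by blast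
    then show ?thesis
      by (induction rule: tranclp_induct) (use step m(3) in \<open>auto intro: less_imp_le\<close>)
  qed
  have zero_one: "\<sigma> x = 0 \<or> \<sigma> x = 1" if "x \<in> S" "x \<in> M" for x
    using trap[OF that that(1), of "\<sigma> x"] range[OF that(2)] by force
  have "\<sigma> p = \<sigma> q"
    using zero_one[OF p] zero_one[OF q] trap[OF p q(1), of "1/2"] trap[OF q p(1), of "1/2"] by auto
  then show ?thesis using zero_one[OF p] by simp
qed

section \<open>Norms and projective space\<close>

lemma is_norm_minus: "is_norm N \<Longrightarrow> N (- v) = N v"
  unfolding is_norm_def by (metis abs_minus_cancel abs_one mult_1 scaleR_minus1_left)

lemma is_norm_triangle: "is_norm N \<Longrightarrow> N (x + y) \<le> N x + N y"
  and is_norm_scale: "is_norm N \<Longrightarrow> N (c *\<^sub>R x) = \<bar>c\<bar> * N x"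
  and is_norm_zero: "is_norm N \<Longrightarrow> N x = 0 \<longleftrightarrow> x = 0"
  and is_norm_0: "is_norm N \<Longrightarrow> N 0 = 0"
  and is_norm_nonneg: "is_norm N \<Longrightarrow> N x \<ge> 0"
  by (simp_all add: is_norm_def)

lemma is_norm_upper_bound:
  fixes N :: "'a::euclidean_space \<Rightarrow> real"
  assumes N: "is_norm N"
  obtains C where "C > 0" "\<And>v. N v \<le> C * norm v"
proof -
  define C where "C = (\<Sum>b\<in>Basis. N b) + 1"
  have C: "C > 0" by (simp add: C_def is_norm_nonneg[OF N] sum_nonneg add_nonneg_pos)
  have sum: "N (\<Sum>b\<in>F. g b) \<le> (\<Sum>b\<in>F. N (g b))" if "finite F" for F and g :: "'a \<Rightarrow> 'a"
    using that
  proof induction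
    case (insert x F)
    then show ?case using is_norm_triangle[OF N, of "g x" "\<Sum>b\<in>F. g b"] by simp
  qed (simp add: is_norm_0[OF N])
  have up: "N v \<le> C * norm v" for v
  proof -
    have "N v = N (\<Sum>b\<in>Basis. (v \<bullet> b) *\<^sub>R b)" by (simp add: euclidean_representation)
    also have "\<dots> \<le> (\<Sum>b\<in>Basis. N ((v \<bullet> b) *\<^sub>R b))" by (rule sum) simp
    also have "\<dots> \<le> (\<Sum>b\<in>Basis. norm v * N b)"
      by (intro sum_mono) (simp add: is_norm_scale[OF N] Basis_le_norm is_norm_nonneg[OF N] mult_right_mono)
    also have "\<dots> = (C - 1) * norm v" by (simp add: C_def sum_distrib_left sum_distrib_right mult.commute)
    also have "\<dots> \<le> C * norm v" by (intro mult_right_mono) auto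
    finally show ?thesis .
  qed
  show thesis using that C up by blast
qed

lemma is_norm_continuous:
  fixes N :: "'a::euclidean_space \<Rightarrow> real"
  assumes N: "is_norm N" shows "continuous_on S N"
proof -
  obtain c C where C: "C > 0" "\<And>v. N v \<le> C * norm v" using is_norm_upper_bound[OF N] by blast
  have "\<bar>N x - N y\<bar> \<le> C * dist x y" for x y
    using is_norm_triangle[OF N, of "x - y" y] is_norm_triangle[OF N, of "y - x" x]
      C(2)[of "x - y"] C(2)[of "y - x"] by (auto simp: dist_norm norm_minus_commute)
  then have "C-lipschitz_on UNIV N"
    using C by (intro lipschitz_onI) (auto simp: dist_real_def)
  then show ?thesis
    by (meson continuous_on_subset lipschitz_on_continuous_on top_greatest)
qed

lemma is_norm_equivalent:
  fixes N :: "'a::euclidean_space \<Rightarrow> real"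
  assumes N: "is_norm N"
  obtains c C where "c > 0" "C > 0" "\<And>v. c * norm v \<le> N v" "\<And>v. N v \<le> C * norm v"
proof -
  obtain C where C: "C > 0" and up: "\<And>v. N v \<le> C * norm v"
    using is_norm_upper_bound[OF N] by blast
  show thesis
  proof (cases "(sphere 0 1 :: 'a set) = {}")
    case True
    have zero: "v = 0" for v :: 'a
    proof (rule ccontr)
      assume "v \<noteq> 0"
      then have "v /\<^sub>R norm v \<in> sphere 0 1" by simp
      then show False using True by blast
    qed
    have "1 * norm v \<le> N v" for v by (subst (1 2) zero) (simp add: is_norm_0[OF N])
    then show thesis using that[of 1 C] C up by simp
  next
    case False
    then obtain v where v: "v \<in> sphere 0 1" "\<And>w. w \<in> sphere 0 1 \<Longrightarrow> N v \<le> N w"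
      using continuous_attains_inf[OF compact_sphere _ is_norm_continuous[OF N]] by blast
    have pos: "N v > 0" using v(1) is_norm_zero[OF N, of v] is_norm_nonneg[OF N, of v] by auto
    have "N v * norm w \<le> N w" for w
    proof (cases "w = 0")
      case False
      then have "N v \<le> N (w /\<^sub>R norm w)" by (intro v(2)) simp
      then show ?thesis using False by (simp add: is_norm_scale[OF N] field_simps)
    qed (simp add: is_norm_0[OF N])
    then show thesis using that pos C up by blast
  qed
qed

text \<open>Normalization is Lipschitz away from the origin.\<close>

lemma proj_dist_le:
  assumes N: "is_norm N" and x: "x \<noteq> 0" and y: "y \<noteq> 0"
  shows "proj_dist N (proj x) (proj y) \<le> 2 * N (x - y) / N x"
proof -
  have pos: "N x > 0" "N y > 0"
    using is_norm_zero[OF N] is_norm_nonneg[OF N] x y by (metis less_eq_real_def)+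
  let ?u = "(1 / N x) *\<^sub>R (x - y)" and ?w = "(1 / N x - 1 / N y) *\<^sub>R y"
  have "x /\<^sub>R N x - y /\<^sub>R N y = ?u + ?w"
    by (simp add: algebra_simps divide_inverse)
  then have "N (x /\<^sub>R N x - y /\<^sub>R N y) \<le> N ?u + N ?w"
    using is_norm_triangle[OF N] by simp
  also have "N ?u = N (x - y) / N x" using pos by (simp add: is_norm_scale[OF N])
  also have "N ?w = \<bar>1 / N x - 1 / N y\<bar> * N y" by (simp add: is_norm_scale[OF N])
  also have "1 / N x - 1 / N y = (N y - N x) / (N x * N y)" using pos by (simp add: field_simps)
  also have "\<bar>(N y - N x) / (N x * N y)\<bar> * N y = \<bar>N y - N x\<bar> / N x"
    using pos by (simp add: abs_mult)
  finally have "N (x /\<^sub>R N x - y /\<^sub>R N y) \<le> N (x - y) / N x + \<bar>N y - N x\<bar> / N x" .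
  moreover have "\<bar>N y - N x\<bar> \<le> N (x - y)"
    using is_norm_triangle[OF N, of "x - y" y] is_norm_triangle[OF N, of "y - x" x] is_norm_minus[OF N, of "x - y"]
    by auto
  then have "N (x - y) / N x + \<bar>N y - N x\<bar> / N x \<le> 2 * N (x - y) / N x"
    using pos by (simp add: add_divide_distrib[symmetric] divide_right_mono)
  ultimately have "N (x /\<^sub>R N x - y /\<^sub>R N y) \<le> 2 * N (x - y) / N x" by linarith
  then show ?thesis unfolding proj_dist_proj[OF N x y] by simp
qed

lemma proj_dist_commute:
  assumes "is_norm N" shows "proj_dist N p q = proj_dist N q p"
  by (rule Metric_space.commute[OF Metric_space_proj[OF assms]])

lemma proj_in_proj_space: "z \<noteq> 0 \<Longrightarrow> proj z \<in> proj_space"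
  by (auto simp: proj_space_def)

text \<open>The minimum in the definition of the distance disappears once the sign of one representative has
  been chosen; continuity arguments can then be carried out on the unit sphere.\<close>

lemma proj_dist_representatives:
  assumes N: "is_norm N" and p: "p \<in> proj_space" and q: "q \<in> proj_space" and d: "proj_dist N p q < \<epsilon>"
  obtains a b where "p = proj a" "q = proj b" "N a = 1" "N b = 1" "N (a - b) < \<epsilon>"
proof -
  obtain x y where xy: "x \<noteq> 0" "y \<noteq> 0" "p = proj x" "q = proj y"
    using p q by (auto simp: proj_space_def)
  have pos: "N x > 0" "N y > 0"
    using is_norm_zero[OF N] is_norm_nonneg[OF N] xy by (metis less_eq_real_def)+
  have unit: "N (v /\<^sub>R N v) = 1" "proj (v /\<^sub>R N v) = proj v" if "N v > 0" "v \<noteq> 0" for v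
    using that by (auto simp: is_norm_scale[OF N] proj_eq_iff)
  let ?a = "x /\<^sub>R N x" and ?b = "y /\<^sub>R N y"
  consider "N (?a - ?b) < \<epsilon>" | "N (?a + ?b) < \<epsilon>"
    using d unfolding xy(3,4) proj_dist_proj[OF N xy(1,2)] by linarith
  then show thesis
  proof cases
    case 1
    then show thesis using that[of ?a ?b] unit[OF pos(1) xy(1)] unit[OF pos(2) xy(2)] xy(3,4) by simp
  next
    case 2
    have "proj (- ?b) = proj ?b"
      by (rule proj_eq_iff[THEN iffD2]) (use xy(2) pos in \<open>auto intro!: exI[of _ "-1"]\<close>)
    then show thesis using that[of ?a "- ?b"] 2 unit[OF pos(1) xy(1)] unit[OF pos(2) xy(2)] xy(3,4)
      by (simp add: is_norm_minus[OF N])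
  qed
qed

text \<open>The Lyapunov function is \<open>\<beta> / (\<alpha> + \<beta>)\<close>. Homogeneity makes it well defined on lines, and
  compactness of the unit sphere makes it uniformly continuous there.\<close>

lemma proj_chain_controllable_dichotomy:
  fixes \<alpha> \<beta> :: "'a::euclidean_space \<Rightarrow> real" and N :: "'a \<Rightarrow> real"
    and f :: "real \<Rightarrow> 'a set \<Rightarrow> 'c \<Rightarrow> 'a set" and F :: "real \<Rightarrow> 'a \<Rightarrow> 'c \<Rightarrow> 'a"
  assumes N: "is_norm N"
    and nonneg: "\<And>z. \<alpha> z \<ge> 0" "\<And>z. \<beta> z \<ge> 0"
    and homogeneous: "\<And>c z. c \<noteq> 0 \<Longrightarrow> \<alpha> (c *\<^sub>R z) = \<bar>c\<bar> * \<alpha> z" "\<And>c z. c \<noteq> 0 \<Longrightarrow> \<beta> (c *\<^sub>R z) = \<bar>c\<bar> * \<beta> z"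
    and cont: "continuous_on UNIV \<alpha>" "continuous_on UNIV \<beta>"
    and pos: "\<And>z. z \<noteq> 0 \<Longrightarrow> \<alpha> z + \<beta> z > 0"
    and traj: "\<And>t z u. f t (proj z) u = proj (F t z u)" and nonzero: "\<And>t z u. z \<noteq> 0 \<Longrightarrow> F t z u \<noteq> 0"
    and T: "T > 0" and ratio: "\<And>t u z. t \<ge> T \<Longrightarrow> u \<in> C \<Longrightarrow> 2 * \<alpha> (F t z u) * \<beta> z \<le> \<alpha> z * \<beta> (F t z u)"
    and S: "chain_controllable proj_space (proj_dist N) C f S"
    and z: "z \<noteq> 0" "proj z \<in> S" and w: "w \<noteq> 0" "proj w \<in> S"
  shows "(\<alpha> z = 0 \<and> \<alpha> w = 0) \<or> (\<beta> z = 0 \<and> \<beta> w = 0)"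
proof -
  define s where "s v = \<beta> v / (\<alpha> v + \<beta> v)" for v
  define \<sigma> where "\<sigma> p = s (proj_rep p)" for p
  have s_scale: "s (c *\<^sub>R v) = s v" if "c \<noteq> 0" for c v
    using that by (simp add: s_def homogeneous distrib_left[symmetric])
  have \<sigma>: "\<sigma> (proj v) = s v" if v: "v \<noteq> 0" for v
  proof -
    obtain c where "c \<noteq> 0" "proj_rep (proj v) = c *\<^sub>R v" using proj_rep[OF v] .
    then show ?thesis by (simp add: \<sigma>_def s_scale)
  qed
  obtain c where c: "c > 0" "\<And>v. c * norm v \<le> N v" using is_norm_equivalent[OF N] by metis
  have "compact {v. N v = 1}"
    unfolding compact_eq_bounded_closed
  proof
    have "norm v \<le> 1 / c" if "N v = 1" for v using c(2)[of v] c(1) that by (simp add: field_simps)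
    then show "bounded {v. N v = 1}" unfolding bounded_iff by blast
    show "closed {v. N v = 1}"
      using is_norm_continuous[OF N, of UNIV] by (intro closed_Collect_eq) auto
  qed
  moreover have unit: "v \<noteq> 0" if "N v = 1" for v using that is_norm_0[OF N] by auto
  have "\<alpha> v + \<beta> v \<noteq> 0" if "N v = 1" for v using pos[OF unit[OF that]] by simp
  then have "continuous_on {v. N v = 1} s"
    unfolding s_def by (intro continuous_intros continuous_on_subset[OF cont(1)] continuous_on_subset[OF cont(2)]) auto
  ultimately have uc: "uniformly_continuous_on {v. N v = 1} s"
    by (rule compact_uniformly_continuous[rotated])
  have "\<sigma> (proj z) = \<sigma> (proj w) \<and> (\<sigma> (proj z) = 0 \<or> \<sigma> (proj z) = 1)"
  proof (rule chain_controllable_lyapunov[OF S])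
    fix p :: "'a set" assume "p \<in> proj_space"
    then obtain v where v: "p = proj v" "v \<noteq> 0" by (auto simp: proj_space_def)
    show "0 \<le> \<sigma> p \<and> \<sigma> p \<le> 1"
      using nonneg[of v] pos[OF v(2)] by (simp add: v \<sigma> s_def)
  next
    fix \<eta> :: real assume "\<eta> > 0"
    from uc[unfolded uniformly_continuous_on_def, rule_format, OF this]
    obtain \<delta> where "\<delta> > 0"
      "\<forall>a\<in>{v. N v = 1}. \<forall>b\<in>{v. N v = 1}. dist b a < \<delta> \<longrightarrow> dist (s b) (s a) < \<eta>"
      by (elim exE conjE) (rule that)
    then have \<delta>: "\<delta> > 0" "\<And>a b. N a = 1 \<Longrightarrow> N b = 1 \<Longrightarrow> dist b a < \<delta> \<Longrightarrow> dist (s b) (s a) < \<eta>"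
      by simp_all
    have "\<bar>\<sigma> p - \<sigma> q\<bar> < \<eta>" if pq: "p \<in> proj_space" "q \<in> proj_space" "proj_dist N p q < c * \<delta>" for p q
    proof -
      obtain a b where ab: "p = proj a" "q = proj b" "N a = 1" "N b = 1" "N (a - b) < c * \<delta>"
        using proj_dist_representatives[OF N pq] .
      have "c * norm (a - b) < c * \<delta>" using c(2)[of "a - b"] ab(5) by linarith
      then have "dist b a < \<delta>" using c(1) by (simp add: dist_norm norm_minus_commute)
      then show ?thesis using \<delta>(2)[OF ab(3,4)] ab(1,2) \<sigma>[OF unit[OF ab(3)]] \<sigma>[OF unit[OF ab(4)]]
        by (simp add: dist_real_def abs_minus_commute)
    qed
    then show "\<exists>\<epsilon>>0. \<forall>p\<in>proj_space. \<forall>q\<in>proj_space. proj_dist N p q < \<epsilon> \<longrightarrow> \<bar>\<sigma> p - \<sigma> q\<bar> < \<eta>"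
      using \<delta>(1) c(1) by (intro exI[of _ "c * \<delta>"]) auto
  next
    fix t u and p :: "'a set" assume tu: "t \<ge> T" "u \<in> C" "p \<in> proj_space"
    then obtain v where v: "p = proj v" "v \<noteq> 0" by (auto simp: proj_space_def)
    let ?v = "F t v u"
    have v': "?v \<noteq> 0" using nonzero v(2) .
    have "2 * \<sigma> p \<le> \<sigma> (f t p u) * (1 + \<sigma> p)"
    proof -
      have p1: "\<alpha> v + \<beta> v > 0" "\<alpha> ?v + \<beta> ?v > 0" using pos v(2) v' by auto
      have "2 * \<beta> v * (\<alpha> ?v + \<beta> ?v) \<le> \<beta> ?v * (\<alpha> v + 2 * \<beta> v)"
        using ratio[OF tu(1,2), of v] by (simp add: algebra_simps)
      then have "2 * (\<beta> v / (\<alpha> v + \<beta> v)) \<le> \<beta> ?v / (\<alpha> ?v + \<beta> ?v) * ((\<alpha> v + 2 * \<beta> v) / (\<alpha> v + \<beta> v))"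
        using p1 by (simp add: divide_simps mult_ac)
      moreover have "(\<alpha> v + 2 * \<beta> v) / (\<alpha> v + \<beta> v) = 1 + \<beta> v / (\<alpha> v + \<beta> v)"
        using p1 by (simp add: field_simps)
      ultimately show ?thesis by (simp add: v traj \<sigma> v' s_def)
    qed
    then show "f t p u \<in> proj_space \<and> 2 * \<sigma> p \<le> \<sigma> (f t p u) * (1 + \<sigma> p)"
      by (simp add: v traj proj_in_proj_space v')
  qed (use T z w in \<open>auto simp: proj_in_proj_space\<close>)
  then have "s z = s w \<and> (s z = 0 \<or> s z = 1)" unfolding \<sigma>[OF z(1)] \<sigma>[OF w(1)] .
  moreover have "s v = 0 \<longleftrightarrow> \<beta> v = 0" "s v = 1 \<longleftrightarrow> \<alpha> v = 0" if "v \<noteq> 0" for v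
    using pos[OF that] by (auto simp: s_def divide_eq_1_iff)
  ultimately show ?thesis using z(1) w(1) by metis
qed

section \<open>Expansion of the unstable excess\<close>

definition null_controllable ::
  "real^'n^'n \<Rightarrow> real^'m^'n \<Rightarrow> (real^'m) set \<Rightarrow> (real^'n) set" where
  "null_controllable A B U = {k. \<exists>t\<ge>0. \<exists>u\<in>controls U. lin_traj A B t k u = 0}"

definition center_stable_size :: "real^'n^'n \<Rightarrow> (real^'n) \<times> real \<Rightarrow> real" where
  "center_stable_size A z = norm (fst z - unstable_proj A (fst z)) + \<bar>snd z\<bar>"

text \<open>The excess is measured only in the unstable directions and scaled with the last coordinate, so that it
  is homogeneous and lives on projective space. At the points at infinity (last coordinate 0) it is the
  norm of the unstable component.\<close>

definition unstable_excess ::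
  "real^'n^'n \<Rightarrow> real^'m^'n \<Rightarrow> (real^'m) set \<Rightarrow> (real^'n) \<times> real \<Rightarrow> real" where
  "unstable_excess A B U z =
    infdist (unstable_proj A (fst z)) ((\<lambda>k. snd z *\<^sub>R unstable_proj A k) ` null_controllable A B U)"

lemma lin_traj_plus: "lin_traj A B t (x + y) u = lin_traj A B t x u + flow A t y"
  by (simp add: lin_traj_def flow_def matrix_vector_right_distrib)

lemma unstable_proj_bounded:
  obtains K where "K > 0" "\<And>x. norm (unstable_proj A x) \<le> K * norm x"
  using linear_bounded_pos[OF linear_unstable_proj] by blast

lemma center_stable_part_bounded:
  obtains K where "K > 0" "\<And>x. norm (x - unstable_proj A x) \<le> K * norm x"
  using linear_bounded_pos[OF linear_compose_sub[OF linear_ident linear_unstable_proj]] by blast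

context
  fixes U :: "(real^'m) set" and A :: "real^'n^'n" and B :: "real^'m^'n"
  assumes U: "compact U" "0 \<in> U"
begin

lemma lin_traj_eq:
  assumes "u \<in> controls U" "t \<ge> 0"
  shows "lin_traj A B t x u = flow A t (x + pullback_input A B t u)"
  unfolding lin_traj_def forced_response_pullback[OF U assms] by (simp add: flow_plus flow_def[symmetric])

lemma lifted_traj_eq:
  assumes "u \<in> controls U" "t \<ge> 0"
  shows "lifted_traj A B t (x, r) u = (flow A t (x + r *\<^sub>R pullback_input A B t u), r)"
  unfolding lifted_traj_def forced_response_pullback[OF U assms]
  by (simp add: flow_plus flow_scaleR flow_def[symmetric])

lemma lin_traj_zero_control: "t \<ge> 0 \<Longrightarrow> lin_traj A B t x (\<lambda>_. 0) = flow A t x"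
  by (simp add: lin_traj_eq[OF controls_zero[OF U]])

lemma lin_traj_add:
  assumes u: "u \<in> controls U" and st: "s \<ge> 0" "t \<ge> 0"
  shows "lin_traj A B (s + t) x u = lin_traj A B t (lin_traj A B s x u) (\<lambda>r. u (s + r))"
proof -
  have "lin_traj A B (s + t) x u = flow A t (flow A s (x + pullback_input A B (s + t) u))"
    using st by (simp add: lin_traj_eq[OF u] flow_add[symmetric] add.commute)
  also have "flow A s (x + pullback_input A B (s + t) u) =
      flow A s (x + pullback_input A B s u) + pullback_input A B t (\<lambda>r. u (s + r))"
    unfolding pullback_input_add[OF U u st] by (simp only: flow_plus flow_inverse add.assoc)
  finally show ?thesis
    using st by (simp add: lin_traj_eq[OF u] lin_traj_eq[OF controls_shift[OF U u]])
qed

lemma lin_traj_concat: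
  assumes u: "u \<in> controls U" and v: "v \<in> controls U" and st: "s \<ge> 0" "t \<ge> 0"
  shows "lin_traj A B (s + t) x (\<lambda>r. if r < s then u r else v (r - s)) =
    lin_traj A B t (lin_traj A B s x u) v"
proof -
  let ?w = "\<lambda>r. if r < s then u r else v (r - s)"
  have w: "?w \<in> controls U" by (rule controls_concat[OF U u v])
  have 1: "pullback_input A B s ?w = pullback_input A B s u"
    by (rule pullback_input_cong[of "{s}"]) auto
  have 2: "pullback_input A B t (\<lambda>r. ?w (s + r)) = pullback_input A B t v"
    by (rule pullback_input_cong[of "{}"]) auto
  show ?thesis
    unfolding lin_traj_add[OF w st] lin_traj_eq[OF w st(1)] 1 lin_traj_eq[OF controls_shift[OF U w] st(2)] 2
      lin_traj_eq[OF u st(1)] lin_traj_eq[OF v st(2)] ..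
qed

lemma zero_null_controllable: "0 \<in> null_controllable A B U"
proof -
  have "lin_traj A B 0 0 (\<lambda>_. 0) = 0" by (simp add: lin_traj_zero_control)
  then show ?thesis unfolding null_controllable_def using controls_zero[OF U] by blast
qed

lemma null_controllable_backward:
  assumes u: "u \<in> controls U" and t: "t \<ge> 0" and k: "lin_traj A B t k u \<in> null_controllable A B U"
  shows "k \<in> null_controllable A B U"
proof -
  obtain s v where v: "s \<ge> 0" "v \<in> controls U" "lin_traj A B s (lin_traj A B t k u) v = 0"
    using k unfolding null_controllable_def by blast
  have "lin_traj A B (t + s) k (\<lambda>r. if r < t then u r else v (r - t)) = 0"
    using lin_traj_concat[OF u v(2) t v(1)] v(3) by simp
  then show ?thesis unfolding null_controllable_def
    using controls_concat[OF U u v(2), of t] add_nonneg_nonneg[OF t v(1)] by blast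
qed

text \<open>The origin is an equilibrium for the control 0, so there is no harm in arriving early.\<close>

lemma null_controllable_after:
  assumes k: "k \<in> null_controllable A B U"
  obtains t u where "t \<ge> T" "u \<in> controls U" "lin_traj A B t k u = 0"
proof -
  obtain s v where v: "s \<ge> 0" "v \<in> controls U" "lin_traj A B s k v = 0"
    using k unfolding null_controllable_def by blast
  show thesis
  proof (rule that)
    show "T \<le> s + \<bar>T\<bar>" using v(1) by linarith
    show "(\<lambda>r. if r < s then v r else (\<lambda>_. 0) (r - s)) \<in> controls U"
      by (rule controls_concat[OF U v(2) controls_zero[OF U]])
    have "lin_traj A B (s + \<bar>T\<bar>) k (\<lambda>r. if r < s then v r else (\<lambda>_. 0) (r - s)) =
        lin_traj A B \<bar>T\<bar> 0 (\<lambda>_. 0)"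
      using lin_traj_concat[OF v(2) controls_zero[OF U] v(1) abs_ge_zero, of T k] unfolding v(3) .
    also have "\<dots> = 0" using lin_traj_zero_control[of "\<bar>T\<bar>" 0] by simp
    finally show "lin_traj A B (s + \<bar>T\<bar>) k (\<lambda>r. if r < s then v r else (\<lambda>_. 0) (r - s)) = 0" .
  qed
qed

text \<open>The backward flow contracts the unstable space exponentially, so the pulled-back input has an
  integrable unstable component.\<close>

lemma unstable_proj_pullback_bounded:
  obtains R where "R > 0" "\<And>t u. t \<ge> 0 \<Longrightarrow> u \<in> controls U \<Longrightarrow> norm (unstable_proj A (pullback_input A B t u)) \<le> R"
proof -
  obtain K where K: "K > 0" "\<And>x. norm (unstable_proj A x) \<le> K * norm x"
    using unstable_proj_bounded[of A] by blast
  obtain M where M: "M > 0" "\<And>x. x \<in> U \<Longrightarrow> norm (B *v x) \<le> M" using input_bound[OF U, of B] by blast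
  obtain C \<gamma> where C: "C > 0" "\<gamma> > 0"
    "\<And>x t. x \<in> unstable_space A \<Longrightarrow> t \<ge> 0 \<Longrightarrow> norm (flow A (- t) x) \<le> C * exp (- \<gamma> * t) * norm x"
    using unstable_bound[of A] by blast
  have "norm (unstable_proj A (pullback_input A B t u)) \<le> C * K / \<gamma> * M" if t: "t \<ge> 0" and u: "u \<in> controls U" for t u
  proof -
    let ?h = "\<lambda>s. - (C * K / \<gamma>) * exp (- \<gamma> * s)"
    have "norm (unstable_proj A (pullback_input A B t u)) \<le> (?h t - ?h 0) * M"
    proof (rule pullback_input_bound[OF U u M(2) linear_unstable_proj t])
      fix s :: real and x assume s: "0 \<le> s" "s \<le> t"
      have "norm (unstable_proj A (flow A (- s) x)) \<le> C * exp (- \<gamma> * s) * norm (unstable_proj A x)"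
        unfolding unstable_proj_flow using C(3)[OF unstable_proj(1) s(1)] .
      also have "\<dots> \<le> C * exp (- \<gamma> * s) * (K * norm x)"
        using K(2)[of x] C(1) by (intro mult_left_mono) auto
      finally show "norm (unstable_proj A (flow A (- s) x)) \<le> C * K * exp (- \<gamma> * s) * norm x"
        by (simp only: mult_ac)
    next
      fix s show "(?h has_real_derivative C * K * exp (- \<gamma> * s)) (at s)"
        using C(2) by (auto intro!: derivative_eq_intros)
    qed
    also have "\<dots> = C * K / \<gamma> * M * (1 - exp (- \<gamma> * t))"
      using C(2) by (simp add: field_simps)
    also have "\<dots> \<le> C * K / \<gamma> * M * 1"
      using C K M by (intro mult_left_mono) auto
    finally show ?thesis by simp
  qed
  then show thesis using that[of "C * K / \<gamma> * M"] C K M by simp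
qed

lemma unstable_proj_null_controllable_bounded:
  obtains R where "R > 0" "\<And>k. k \<in> null_controllable A B U \<Longrightarrow> norm (unstable_proj A k) \<le> R"
proof -
  obtain R where R: "R > 0" "\<And>t u. t \<ge> 0 \<Longrightarrow> u \<in> controls U \<Longrightarrow> norm (unstable_proj A (pullback_input A B t u)) \<le> R"
    using unstable_proj_pullback_bounded by blast
  have "norm (unstable_proj A k) \<le> R" if k: "k \<in> null_controllable A B U" for k
  proof -
    obtain t u where u: "t \<ge> 0" "u \<in> controls U" "lin_traj A B t k u = 0"
      using k unfolding null_controllable_def by blast
    have "flow A (- t) (flow A t (k + pullback_input A B t u)) = flow A (- t) 0"
      using u by (simp add: lin_traj_eq)
    then have "k = - pullback_input A B t u" by (simp add: flow_inverse eq_neg_iff_add_eq_0)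
    then show ?thesis using R(2)[OF u(1,2)] by (simp add: linear_neg[OF linear_unstable_proj])
  qed
  then show thesis using that R(1) by blast
qed

text \<open>The forced response contributes as well, because the input acts with weight \<open>\<bar>r\<bar>\<close>; this is why the
  last coordinate is part of the size.\<close>

lemma center_stable_size_growth:
  assumes \<delta>: "\<delta> > 0"
  obtains C where "C > 0"
    "\<And>t u z. t \<ge> 0 \<Longrightarrow> u \<in> controls U \<Longrightarrow>
      center_stable_size A (lifted_traj A B t z u) \<le> C * exp (\<delta> * t) * center_stable_size A z"
proof -
  obtain K where K: "K > 0" "\<And>x. norm (x - unstable_proj A x) \<le> K * norm x"
    using center_stable_part_bounded[of A] by blast
  obtain M where M: "M > 0" "\<And>x. x \<in> U \<Longrightarrow> norm (B *v x) \<le> M" using input_bound[OF U, of B] by blast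
  obtain C where C: "C > 0"
    "\<And>x t. x \<in> center_stable_space A \<Longrightarrow> t \<ge> 0 \<Longrightarrow> norm (flow A t x) \<le> C * exp (\<delta> * t) * norm x"
    using center_stable_bound[OF \<delta>, of A] by blast
  let ?S = "\<lambda>x. x - unstable_proj A x"
  have S: "linear ?S" by (intro linear_compose_sub linear_unstable_proj linear_ident)
  have S_flow: "?S (flow A t x) = flow A t (?S x)" for t x by (simp add: unstable_proj_flow flow_diff)
  have resp: "norm (flow A t (?S (pullback_input A B t u))) \<le> C * K * M / \<delta> * exp (\<delta> * t)"
    if t: "t \<ge> 0" and u: "u \<in> controls U" for t u
  proof -
    let ?h = "\<lambda>s. - (C * K / \<delta>) * exp (\<delta> * (t - s))"
    have "norm (flow A t (?S (pullback_input A B t u))) \<le> (?h t - ?h 0) * M"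
    proof (rule pullback_input_bound[OF U u M(2) _ t, where Q = "\<lambda>x. flow A t (?S x)"])
      show "linear (\<lambda>x. flow A t (?S x))" using linear_compose[OF S linear_flow] by (simp add: o_def)
      fix s :: real and x assume s: "0 \<le> s" "s \<le> t"
      have "flow A t (?S (flow A (- s) x)) = flow A (t - s) (?S x)"
        unfolding S_flow flow_add[symmetric] by simp
      also have "norm \<dots> \<le> C * exp (\<delta> * (t - s)) * norm (?S x)"
        using s by (intro C(2) unstable_proj) auto
      also have "\<dots> \<le> C * exp (\<delta> * (t - s)) * (K * norm x)"
        using K(2)[of x] C(1) by (intro mult_left_mono) auto
      finally show "norm (flow A t (?S (flow A (- s) x))) \<le> C * K * exp (\<delta> * (t - s)) * norm x"
        by (simp only: mult_ac)
    next
      fix s show "(?h has_real_derivative C * K * exp (\<delta> * (t - s))) (at s)"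
        using \<delta> by (auto intro!: derivative_eq_intros)
    qed
    also have "\<dots> = C * K * M / \<delta> * (exp (\<delta> * t) - 1)"
      using \<delta> by (simp add: field_simps)
    also have "\<dots> \<le> C * K * M / \<delta> * exp (\<delta> * t)"
      using C K M \<delta> by (intro mult_left_mono) auto
    finally show ?thesis .
  qed
  define L where "L = C + C * K * M / \<delta> + 1"
  have L: "C \<le> L" "C * K * M / \<delta> + 1 \<le> L" "L > 0"
    using C(1) K(1) M(1) \<delta> by (auto simp: L_def add_pos_pos)
  have "center_stable_size A (lifted_traj A B t z u) \<le> L * exp (\<delta> * t) * center_stable_size A z"
    if t: "t \<ge> 0" and u: "u \<in> controls U" for t u z
  proof -
    obtain x r where z: "z = (x, r)" by (cases z)
    let ?g = "pullback_input A B t u" and ?e = "exp (\<delta> * t)"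
    have "?S (flow A t (x + r *\<^sub>R ?g)) = flow A t (?S x) + r *\<^sub>R flow A t (?S ?g)"
      unfolding S_flow linear_add[OF S] linear_scale[OF S] flow_plus flow_scaleR ..
    then have "center_stable_size A (lifted_traj A B t z u) \<le>
        norm (flow A t (?S x)) + \<bar>r\<bar> * norm (flow A t (?S ?g)) + \<bar>r\<bar>"
      by (simp add: z lifted_traj_eq[OF u t] center_stable_size_def) (metis norm_triangle_ineq norm_scaleR)
    also have "\<dots> \<le> L * ?e * norm (?S x) + \<bar>r\<bar> * (C * K * M / \<delta> * ?e) + \<bar>r\<bar> * ?e"
    proof (intro add_mono)
      have "norm (flow A t (?S x)) \<le> C * ?e * norm (?S x)" by (rule C(2)[OF unstable_proj(2) t])
      also have "\<dots> \<le> L * ?e * norm (?S x)" using L(1) by (intro mult_right_mono) auto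
      finally show "norm (flow A t (?S x)) \<le> L * ?e * norm (?S x)" .
      show "\<bar>r\<bar> * norm (flow A t (?S ?g)) \<le> \<bar>r\<bar> * (C * K * M / \<delta> * ?e)"
        by (intro mult_left_mono resp t u) simp
      have "1 \<le> ?e" using \<delta> t by simp
      then show "\<bar>r\<bar> \<le> \<bar>r\<bar> * ?e" by (simp add: mult_le_cancel_left1)
    qed
    also have "\<dots> = L * ?e * norm (?S x) + (C * K * M / \<delta> + 1) * (?e * \<bar>r\<bar>)" by (simp add: algebra_simps)
    also have "\<dots> \<le> L * ?e * norm (?S x) + L * (?e * \<bar>r\<bar>)"
      using L(2) by (intro add_left_mono mult_right_mono) auto
    finally show ?thesis by (simp add: z center_stable_size_def algebra_simps)
  qed
  then show thesis using that L(3) by blast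
qed

lemma unstable_excess_le:
  assumes "k \<in> null_controllable A B U"
  shows "unstable_excess A B U (x, r) \<le> norm (unstable_proj A x - r *\<^sub>R unstable_proj A k)"
  unfolding unstable_excess_def dist_norm[symmetric] using assms by (auto intro!: infdist_le)

lemma unstable_excess_greatest:
  assumes "\<And>k. k \<in> null_controllable A B U \<Longrightarrow> c \<le> norm (unstable_proj A x - r *\<^sub>R unstable_proj A k)"
  shows "c \<le> unstable_excess A B U (x, r)"
proof -
  have ne: "null_controllable A B U \<noteq> {}" using zero_null_controllable by blast
  show ?thesis
    unfolding unstable_excess_def using assms ne
    by (auto simp: infdist_def dist_norm intro!: cINF_greatest)
qed

text \<open>A target \<open>k\<close> for the final state comes from the target \<open>k'\<close> for the initial state that \<open>u\<close> steers to
  \<open>k\<close>, and the difference between state and target evolves by the linear flow alone.\<close>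

lemma unstable_excess_growth:
  obtains C \<gamma> where "C > 0" "\<gamma> > 0"
    "\<And>t u z. t \<ge> 0 \<Longrightarrow> u \<in> controls U \<Longrightarrow>
      unstable_excess A B U z \<le> C * exp (- \<gamma> * t) * unstable_excess A B U (lifted_traj A B t z u)"
proof -
  obtain C \<gamma> where C: "C > 0" "\<gamma> > 0"
    "\<And>x t. x \<in> unstable_space A \<Longrightarrow> t \<ge> 0 \<Longrightarrow> norm (flow A (- t) x) \<le> C * exp (- \<gamma> * t) * norm x"
    using unstable_bound[of A] by blast
  have "unstable_excess A B U z \<le> C * exp (- \<gamma> * t) * unstable_excess A B U (lifted_traj A B t z u)"
    if t: "t \<ge> 0" and u: "u \<in> controls U" for t u z
  proof -
    obtain x r where z: "z = (x, r)" by (cases z)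
    let ?g = "pullback_input A B t u" and ?e = "C * exp (- \<gamma> * t)"
    define X where "X = flow A t (x + r *\<^sub>R ?g)"
    have e: "?e > 0" using C(1) by simp
    have "unstable_excess A B U z / ?e \<le> unstable_excess A B U (X, r)"
    proof (rule unstable_excess_greatest)
      fix k assume k: "k \<in> null_controllable A B U"
      define k' where "k' = flow A (- t) k - ?g"
      have "lin_traj A B t k' u = k" by (simp add: lin_traj_eq[OF u t] k'_def flow_inverse)
      then have k': "k' \<in> null_controllable A B U" using null_controllable_backward[OF u t] k by simp
      have "x - r *\<^sub>R k' = flow A (- t) (X - r *\<^sub>R k)"
        by (simp add: X_def k'_def flow_diff flow_scaleR flow_inverse algebra_simps)
      then have "unstable_proj A x - r *\<^sub>R unstable_proj A k' =
          flow A (- t) (unstable_proj A X - r *\<^sub>R unstable_proj A k)"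
        by (metis linear_diff[OF linear_unstable_proj] linear_scale[OF linear_unstable_proj] unstable_proj_flow)
      also have "norm \<dots> \<le> ?e * norm (unstable_proj A X - r *\<^sub>R unstable_proj A k)"
        by (intro C(3) t subspace_diff subspace_scale subspace_unstable_space unstable_proj)
      finally have "unstable_excess A B U z \<le> ?e * norm (unstable_proj A X - r *\<^sub>R unstable_proj A k)"
        using unstable_excess_le[OF k', of x r] unfolding z by linarith
      then show "unstable_excess A B U z / ?e \<le> norm (unstable_proj A X - r *\<^sub>R unstable_proj A k)"
        using e by (simp add: pos_divide_le_eq mult.commute)
    qed
    then show ?thesis
      using e unfolding z lifted_traj_eq[OF u t] X_def[symmetric]
      by (simp only: pos_divide_le_eq mult.commute)
  qed
  then show thesis using that C(1,2) by blast
qed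

text \<open>The size is allowed to grow at half the rate at which the excess expands.\<close>

lemma excess_ratio_doubles:
  obtains T where "T > 0"
    "\<And>t u z. t \<ge> T \<Longrightarrow> u \<in> controls U \<Longrightarrow>
      2 * center_stable_size A (lifted_traj A B t z u) * unstable_excess A B U z \<le>
      center_stable_size A z * unstable_excess A B U (lifted_traj A B t z u)"
proof -
  obtain C \<gamma> where C: "C > 0" "\<gamma> > 0" "\<And>t u z. t \<ge> 0 \<Longrightarrow> u \<in> controls U \<Longrightarrow>
      unstable_excess A B U z \<le> C * exp (- \<gamma> * t) * unstable_excess A B U (lifted_traj A B t z u)"
    using unstable_excess_growth by blast
  have "\<gamma> / 2 > 0" using C(2) by simp
  then obtain D where D: "D > 0" "\<And>t u z. t \<ge> 0 \<Longrightarrow> u \<in> controls U \<Longrightarrow>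
      center_stable_size A (lifted_traj A B t z u) \<le> D * exp (\<gamma> / 2 * t) * center_stable_size A z"
    using center_stable_size_growth by blast
  \<comment> \<open>chosen such that \<open>exp (\<gamma> / 2 * T) \<ge> \<gamma> / 2 * T = 2 * C * D\<close>\<close>
  define T where "T = 2 / \<gamma> * (2 * C * D)"
  have T: "T > 0" using C D by (simp add: T_def)
  have nonneg: "center_stable_size A z \<ge> 0" "unstable_excess A B U z \<ge> 0" for z
    by (simp_all add: center_stable_size_def unstable_excess_def infdist_nonneg)
  have "2 * center_stable_size A (lifted_traj A B t z u) * unstable_excess A B U z \<le>
      center_stable_size A z * unstable_excess A B U (lifted_traj A B t z u)"
    if t: "t \<ge> T" and u: "u \<in> controls U" for t u z
  proof -
    let ?z = "lifted_traj A B t z u"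
    have t0: "t \<ge> 0" using t T by simp
    have "2 * C * D = \<gamma> / 2 * T" using C(2) by (simp add: T_def)
    also have "\<dots> \<le> \<gamma> / 2 * t" using t C(2) by simp
    also have "\<dots> \<le> exp (\<gamma> / 2 * t)" using exp_ge_add_one_self[of "\<gamma> / 2 * t"] by linarith
    finally have CD: "2 * C * D \<le> exp (\<gamma> / 2 * t)" .
    have "2 * center_stable_size A ?z * unstable_excess A B U z \<le>
        2 * (D * exp (\<gamma> / 2 * t) * center_stable_size A z) * (C * exp (- \<gamma> * t) * unstable_excess A B U ?z)"
      using C(3)[OF t0 u, of z] D(2)[OF t0 u, of z] nonneg D(1) by (intro mult_mono mult_left_mono) auto
    also have "\<dots> = (2 * C * D) * (exp (\<gamma> / 2 * t) * exp (- \<gamma> * t)) * (center_stable_size A z * unstable_excess A B U ?z)"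
      by (simp only: mult_ac)
    also have "\<dots> \<le> exp (\<gamma> / 2 * t) * (exp (\<gamma> / 2 * t) * exp (- \<gamma> * t)) * (center_stable_size A z * unstable_excess A B U ?z)"
      using CD nonneg by (intro mult_right_mono) auto
    also have "exp (\<gamma> / 2 * t) * (exp (\<gamma> / 2 * t) * exp (- \<gamma> * t)) = 1"
      unfolding exp_add[symmetric] by simp
    finally show ?thesis by simp
  qed
  then show thesis using that T by blast
qed

lemma unstable_excess_homogeneous:
  assumes c: "c \<noteq> 0"
  shows "unstable_excess A B U (c *\<^sub>R z) = \<bar>c\<bar> * unstable_excess A B U z"
proof -
  have le: "unstable_excess A B U (c *\<^sub>R z) \<le> \<bar>c\<bar> * unstable_excess A B U z" if c: "c \<noteq> 0" for c z
  proof -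
    obtain x r where z: "z = (x, r)" by (cases z)
    have "unstable_excess A B U (c *\<^sub>R z) / \<bar>c\<bar> \<le> unstable_excess A B U (x, r)"
    proof (rule unstable_excess_greatest)
      fix k assume k: "k \<in> null_controllable A B U"
      have "unstable_excess A B U (c *\<^sub>R z) \<le> norm (unstable_proj A (c *\<^sub>R x) - (c * r) *\<^sub>R unstable_proj A k)"
        using unstable_excess_le[OF k, of "c *\<^sub>R x" "c * r"] by (simp add: z)
      also have "\<dots> = norm (c *\<^sub>R (unstable_proj A x - r *\<^sub>R unstable_proj A k))"
        by (simp add: linear_scale[OF linear_unstable_proj] scaleR_diff_right)
      finally show "unstable_excess A B U (c *\<^sub>R z) / \<bar>c\<bar> \<le> norm (unstable_proj A x - r *\<^sub>R unstable_proj A k)"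
        using c by (simp add: pos_divide_le_eq mult.commute)
    qed
    then show ?thesis using c by (simp add: z pos_divide_le_eq mult.commute)
  qed
  have "unstable_excess A B U z \<le> \<bar>1 / c\<bar> * unstable_excess A B U (c *\<^sub>R z)"
    using le[of "1 / c" "c *\<^sub>R z"] c by simp
  then have "\<bar>c\<bar> * unstable_excess A B U z \<le> unstable_excess A B U (c *\<^sub>R z)"
    using c by (simp add: pos_le_divide_eq mult.commute)
  then show ?thesis using le[OF c, of z] by linarith
qed

lemma continuous_unstable_excess: "continuous_on UNIV (unstable_excess A B U)"
proof -
  obtain K where K: "K > 0" "\<And>x. norm (unstable_proj A x) \<le> K * norm x"
    using unstable_proj_bounded[of A] by blast
  obtain R where R: "R > 0" "\<And>k. k \<in> null_controllable A B U \<Longrightarrow> norm (unstable_proj A k) \<le> R"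
    using unstable_proj_null_controllable_bounded by blast
  have le: "unstable_excess A B U z - (K + R) * norm (z - z') \<le> unstable_excess A B U z'" for z z'
  proof -
    obtain x r x' r' where z: "z = (x, r)" "z' = (x', r')" by (cases z, cases z')
    show ?thesis
      unfolding z(2)
    proof (rule unstable_excess_greatest)
      fix k assume k: "k \<in> null_controllable A B U"
      have "unstable_proj A x - r *\<^sub>R unstable_proj A k =
          (unstable_proj A x' - r' *\<^sub>R unstable_proj A k) + (unstable_proj A (x - x') - (r - r') *\<^sub>R unstable_proj A k)"
        by (simp add: linear_diff[OF linear_unstable_proj] algebra_simps)
      then have "norm (unstable_proj A x - r *\<^sub>R unstable_proj A k) \<le>
          norm (unstable_proj A x' - r' *\<^sub>R unstable_proj A k) +
          (norm (unstable_proj A (x - x')) + norm ((r - r') *\<^sub>R unstable_proj A k))"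
        by (simp only: order_trans[OF norm_triangle_ineq add_left_mono[OF norm_triangle_ineq4]])
      moreover have "norm (unstable_proj A (x - x')) \<le> K * norm (z - z')"
      proof -
        have "norm (x - x') \<le> norm (z - z')" using norm_fst_le[of "x - x'" "r - r'"] by (simp add: z)
        then have "K * norm (x - x') \<le> K * norm (z - z')" using K(1) by simp
        with K(2)[of "x - x'"] show ?thesis by linarith
      qed
      moreover have "norm ((r - r') *\<^sub>R unstable_proj A k) \<le> norm (z - z') * R"
      proof -
        have "\<bar>r - r'\<bar> \<le> norm (z - z')" using norm_snd_le[of "r - r'" "x - x'"] by (simp add: z)
        then show ?thesis unfolding norm_scaleR using R(2)[OF k] by (intro mult_mono) auto
      qed
      ultimately have "norm (unstable_proj A x - r *\<^sub>R unstable_proj A k) \<le>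
          norm (unstable_proj A x' - r' *\<^sub>R unstable_proj A k) + (K + R) * norm (z - z')"
        by (simp add: algebra_simps)
      then show "unstable_excess A B U z - (K + R) * norm (z - (x', r')) \<le> norm (unstable_proj A x' - r' *\<^sub>R unstable_proj A k)"
        using unstable_excess_le[OF k, of x r] unfolding z by linarith
    qed
  qed
  have "\<bar>unstable_excess A B U z - unstable_excess A B U z'\<bar> \<le> (K + R) * dist z z'" for z z'
    using le[of z z'] le[of z' z] by (auto simp: dist_norm norm_minus_commute)
  then have "(K + R)-lipschitz_on UNIV (unstable_excess A B U)"
    using K R by (intro lipschitz_onI) (auto simp: dist_real_def)
  then show ?thesis by (rule lipschitz_on_continuous_on)
qed

end

lemma lifted_traj_reverse:
  fixes A :: "real^'n^'n" and B :: "real^'m^'n"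
  assumes U: "compact U" "0 \<in> U" and u: "u \<in> controls U" and t: "t \<ge> 0"
  shows "lifted_traj (- A) (- B) t (lifted_traj A B t z u) (\<lambda>s. u (t - s)) = z"
proof -
  obtain x r where z: "z = (x, r)" by (cases z)
  let ?g = "pullback_input A B t u"
  have "flow A t (x + r *\<^sub>R ?g) + r *\<^sub>R (- flow A t ?g) = flow A t x"
    by (simp add: flow_plus flow_scaleR)
  then show ?thesis
    unfolding z lifted_traj_eq[OF U u t] lifted_traj_eq[OF U controls_reverse[OF U u] t]
      pullback_input_reverse[OF U u t] flow_uminus
    by (simp only: flow_inverse)
qed

lemma lin_traj_reverse:
  fixes A :: "real^'n^'n" and B :: "real^'m^'n"
  assumes "compact U" "0 \<in> U" "u \<in> controls U" "t \<ge> 0"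
  shows "lin_traj (- A) (- B) t (lin_traj A B t x u) (\<lambda>s. u (t - s)) = x"
  using lifted_traj_reverse[OF assms, of A B "(x, 1)"] by (simp add: lifted_traj_one)

lemma continuous_center_stable_size: "continuous_on UNIV (center_stable_size A)"
proof -
  have "bounded_linear (unstable_proj A)"
    using linear_unstable_proj by (simp add: linear_conv_bounded_linear)
  then have P: "continuous_on UNIV (\<lambda>z. unstable_proj A (fst z))"
    by (rule bounded_linear.continuous_on[OF _ continuous_on_fst[OF continuous_on_id]])
  show ?thesis
    unfolding center_stable_size_def[abs_def]
    by (intro continuous_on_add continuous_on_norm continuous_on_diff continuous_on_rabs
        continuous_on_fst continuous_on_snd continuous_on_id P)
qed

lemma center_stable_size_homogeneous:
  "center_stable_size A (c *\<^sub>R z) = \<bar>c\<bar> * center_stable_size A z"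
proof -
  have "c *\<^sub>R fst z - unstable_proj A (c *\<^sub>R fst z) = c *\<^sub>R (fst z - unstable_proj A (fst z))"
    by (simp add: linear_scale[OF linear_unstable_proj] scaleR_diff_right)
  then show ?thesis by (simp add: center_stable_size_def abs_mult distrib_left)
qed

section \<open>Chains between the origin and the strips\<close>

definition null_strip :: "real^'n^'n \<Rightarrow> real^'m^'n \<Rightarrow> (real^'m) set \<Rightarrow> (real^'n) set" where
  "null_strip A B U = {x. unstable_excess A B U (x, 1) = 0}"

definition norm_step ::
  "(real^'n \<Rightarrow> real) \<Rightarrow> real^'n^'n \<Rightarrow> real^'m^'n \<Rightarrow> (real^'m) set \<Rightarrow> real \<Rightarrow> real \<Rightarrow>
    real^'n \<Rightarrow> real^'n \<Rightarrow> bool" where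
  "norm_step N A B U \<epsilon> T = chain_step UNIV (\<lambda>x y. N (x - y)) (controls U) (lin_traj A B) \<epsilon> T"

lemma norm_step_iff:
  "norm_step N A B U \<epsilon> T x y \<longleftrightarrow> (\<exists>u\<in>controls U. \<exists>t\<ge>T. N (lin_traj A B t x u - y) < \<epsilon>)"
  by (simp add: norm_step_def chain_step_def)

text \<open>The first segment is required to have length exactly \<open>T\<close>: its end depends on the initial point
  uniformly continuously, so that the initial point may be moved afterwards.\<close>

lemma null_strip_chain_to_zero:
  fixes A :: "real^'n^'n" and B :: "real^'m^'n" and N :: "real^'n \<Rightarrow> real"
  assumes U: "compact U" "0 \<in> U" and N: "is_norm N" and x: "x \<in> null_strip A B U"
    and \<epsilon>: "\<epsilon> > 0" and T: "T > 0"
  obtains u y where "u \<in> controls U" "N (lin_traj A B T x u - y) < \<epsilon>"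
    "(norm_step N A B U \<epsilon> T)\<^sup>*\<^sup>* y 0"
proof -
  obtain C where C: "C > 0" "\<And>v. N v \<le> C * norm v" using is_norm_equivalent[OF N] by metis
  obtain K where K: "K > 0" "\<And>t x. T \<le> t \<Longrightarrow> t \<le> T \<Longrightarrow> norm (flow A t x) \<le> K * norm x"
    using flow_bounded by blast
  let ?P = "unstable_proj A"
  \<comment> \<open>an unstable error below \<open>\<eta>\<close> is still below \<open>\<epsilon>\<close> after time \<open>T\<close>\<close>
  define \<eta> where "\<eta> = \<epsilon> / (C * K)"
  have \<eta>: "\<eta> > 0" using \<epsilon> C K by (simp add: \<eta>_def)
  have "\<exists>k\<in>null_controllable A B U. norm (?P x - 1 *\<^sub>R ?P k) < \<eta>"
  proof (rule ccontr)
    assume "\<not> ?thesis"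
    then have "\<eta> \<le> unstable_excess A B U (x, 1)"
      by (intro unstable_excess_greatest[OF U]) (meson not_le)
    then show False using x \<eta> by (simp add: null_strip_def)
  qed
  then obtain k where k: "k \<in> null_controllable A B U" "norm (?P (x - k)) < \<eta>"
    by (auto simp: linear_diff[OF linear_unstable_proj])
  obtain t u where u: "t \<ge> 2 * T" "u \<in> controls U" "lin_traj A B t k u = 0"
    using null_controllable_after[OF U k(1)] by metis
  define w where "w = (x - k) - ?P (x - k)"
  have w: "w \<in> center_stable_space A" unfolding w_def by (rule unstable_proj(2))
  \<comment> \<open>the jump to \<open>y\<close> removes the unstable part of the deviation from the trajectory of \<open>k\<close>\<close>
  define y where "y = lin_traj A B T k u + flow A T w"
  have "lin_traj A B T x u = lin_traj A B T k u + flow A T (x - k)"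
    using lin_traj_plus[of A B T k "x - k" u] by simp
  then have "lin_traj A B T x u - y = flow A T (?P (x - k))"
    by (simp add: y_def w_def flow_diff)
  then have "N (lin_traj A B T x u - y) \<le> C * norm (flow A T (?P (x - k)))" using C(2) by simp
  also have "\<dots> \<le> C * (K * norm (?P (x - k)))" using K(2)[of T] C(1) by (intro mult_left_mono) auto
  also have "\<dots> < C * (K * \<eta>)" using k(2) C(1) K(1) by simp
  also have "\<dots> = \<epsilon>" using C(1) K(1) by (simp add: \<eta>_def)
  finally have first: "N (lin_traj A B T x u - y) < \<epsilon>" .
  have tT: "t - T \<ge> T" "t - T \<ge> 0" "t = T + (t - T)" using u(1) T by auto
  have "lin_traj A B (t - T) (lin_traj A B T k u) (\<lambda>r. u (T + r)) = 0"
    using lin_traj_add[OF U u(2) _ tT(2), of T A B k] T u(3) by simp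
  then have "lin_traj A B (t - T) y (\<lambda>r. u (T + r)) = flow A (t - T) (flow A T w)"
    by (simp add: y_def lin_traj_plus)
  then have second: "norm_step N A B U \<epsilon> T y (flow A (t - T) (flow A T w))"
    unfolding norm_step_iff using controls_shift[OF U u(2)] tT(1) \<epsilon> is_norm_0[OF N]
    by (metis diff_self)
  have "flow A (t - T) (flow A T w) \<in> center_stable_space A"
    by (intro center_stable_space_flow w)
  then have "chain_to_zero (flow A T) (flow A (t - T) (flow A T w))"
    by (rule center_stable_chain_to_zero[OF _ T])
  moreover have "\<epsilon> / C > 0" using \<epsilon> C(1) by simp
  ultimately obtain xs n where xs: "xs 0 = flow A (t - T) (flow A T w)" "\<forall>j\<ge>n. xs j = 0"
      "\<forall>j. norm (flow A T (xs j) - xs (Suc j)) < \<epsilon> / C"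
    unfolding chain_to_zero_def by blast
  have "norm_step N A B U \<epsilon> T (xs j) (xs (Suc j))" for j
  proof -
    have "N (lin_traj A B T (xs j) (\<lambda>_. 0) - xs (Suc j)) \<le> C * norm (flow A T (xs j) - xs (Suc j))"
      using lin_traj_zero_control[OF U, of T A B] T C(2) by simp
    also have "\<dots> < C * (\<epsilon> / C)" using xs(3) C(1) by (intro mult_strict_left_mono) auto
    also have "\<dots> = \<epsilon>" using C(1) by simp
    finally show ?thesis unfolding norm_step_iff using controls_zero[OF U] by blast
  qed
  then have "(norm_step N A B U \<epsilon> T ^^ n) (xs 0) (xs n)"
    unfolding relpowp_fun_conv by (intro exI[of _ xs]) simp
  then have "(norm_step N A B U \<epsilon> T)\<^sup>*\<^sup>* (xs 0) 0"
    using xs(2) unfolding rtranclp_power by auto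
  then have "(norm_step N A B U \<epsilon> T)\<^sup>*\<^sup>* y 0"
    unfolding xs(1) using second by (rule converse_rtranclp_into_rtranclp[rotated])
  then show thesis using that u(2) first by blast
qed

lemma null_strip_chain:
  fixes A :: "real^'n^'n" and B :: "real^'m^'n" and N :: "real^'n \<Rightarrow> real"
  assumes "compact U" "0 \<in> U" "is_norm N" "x \<in> null_strip A B U" "\<epsilon> > 0" "T > 0"
  shows "(norm_step N A B U \<epsilon> T)\<^sup>+\<^sup>+ x 0"
proof -
  obtain u y where uy: "u \<in> controls U" "N (lin_traj A B T x u - y) < \<epsilon>" "(norm_step N A B U \<epsilon> T)\<^sup>*\<^sup>* y 0"
    using null_strip_chain_to_zero[OF assms] by blast
  have "norm_step N A B U \<epsilon> T x y" unfolding norm_step_iff using uy(1,2) by blast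
  then show ?thesis using uy(3) by (rule rtranclp_into_tranclp2)
qed

text \<open>Read backward, a chain of the reversed system consists of jumps followed by segments. It becomes a
  chain by starting with a segment that rests at the origin and ending with a jump of size 0.\<close>

lemma reverse_strip_chain_from_zero:
  fixes A :: "real^'n^'n" and B :: "real^'m^'n" and N :: "real^'n \<Rightarrow> real"
  assumes U: "compact U" "0 \<in> U" and N: "is_norm N" and x: "x \<in> null_strip (- A) (- B) U"
    and \<epsilon>: "\<epsilon> > 0" and T: "T > 0"
  shows "(norm_step N A B U \<epsilon> T)\<^sup>+\<^sup>+ 0 x"
proof -
  have backstep: "\<exists>w. N (w - b) < \<epsilon> \<and> norm_step N A B U \<epsilon> T w y" 
    if ab: "norm_step N (- A) (- B) U \<epsilon> T a b" and y: "N (a - y) < \<epsilon>" for a b y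
  proof -
    obtain u t where ut: "u \<in> controls U" "t \<ge> T" "N (lin_traj (- A) (- B) t a u - b) < \<epsilon>"
      using ab unfolding norm_step_iff by blast
    have "lin_traj A B t (lin_traj (- A) (- B) t a u) (\<lambda>s. u (t - s)) = a"
      using lin_traj_reverse[OF U ut(1), of t "- A" "- B"] ut(2) T by simp
    then have "norm_step N A B U \<epsilon> T (lin_traj (- A) (- B) t a u) y"
      unfolding norm_step_iff using controls_reverse[OF U ut(1), of t] ut(2) y by metis
    then show ?thesis using ut(3) by blast
  qed
  have "\<exists>w. N (w - y) < \<epsilon> \<and> (norm_step N A B U \<epsilon> T)\<^sup>+\<^sup>+ w x"
    if "(norm_step N (- A) (- B) U \<epsilon> T)\<^sup>+\<^sup>+ x y" for y
    using that
  proof (induction rule: tranclp_induct)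
    case (base y)
    then show ?case using backstep[of x y x] \<epsilon> is_norm_0[OF N] by auto
  next
    case (step y z)
    then obtain w where w: "N (w - y) < \<epsilon>" "(norm_step N A B U \<epsilon> T)\<^sup>+\<^sup>+ w x" by blast
    have "N (y - w) < \<epsilon>" using w(1) is_norm_minus[OF N, of "w - y"] by simp
    then obtain v where "N (v - z) < \<epsilon>" "norm_step N A B U \<epsilon> T v w" using backstep[OF step(2)] by blast
    then show ?case using w(2) tranclp_into_tranclp2 by metis
  qed
  then obtain w where w: "N (w - 0) < \<epsilon>" "(norm_step N A B U \<epsilon> T)\<^sup>+\<^sup>+ w x"
    using null_strip_chain[OF U N x \<epsilon> T] by blast
  have "lin_traj A B T 0 (\<lambda>_. 0) = 0" using lin_traj_zero_control[OF U, of T A B 0] T by simp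
  then have "norm_step N A B U \<epsilon> T 0 w"
    unfolding norm_step_iff using w(1) is_norm_minus[OF N, of w] controls_zero[OF U]
    by (intro bexI[of _ "\<lambda>_. 0"] exI[of _ T]) auto
  then show ?thesis using w(2) by (rule tranclp_into_tranclp2)
qed

section \<open>Chains in projective space\<close>

lemma lifted_traj_nonzero:
  fixes A :: "real^'n^'n"
  assumes "z \<noteq> 0" shows "lifted_traj A B t z u \<noteq> 0"
proof
  assume 0: "lifted_traj A B t z u = 0"
  then have snd: "snd z = 0" by (simp add: lifted_traj_def prod_eq_iff)
  then have "flow A t (fst z) = 0" using 0 by (simp add: lifted_traj_def prod_eq_iff flow_def)
  then have "fst z = 0" using flow_inverse(2)[of A t "fst z"] by simp
  then show False using snd assms by (simp add: prod_eq_iff)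
qed

lemma size_excess_pos:
  fixes A :: "real^'n^'n" and B :: "real^'m^'n"
  assumes U: "compact U" "0 \<in> U" and z: "z \<noteq> 0"
  shows "center_stable_size A z + unstable_excess A B U z > 0"
proof (rule ccontr)
  assume n: "\<not> ?thesis"
  obtain x r where xr: "z = (x, r)" by (cases z)
  have "center_stable_size A z \<ge> 0" "unstable_excess A B U z \<ge> 0"
    by (simp_all add: center_stable_size_def unstable_excess_def infdist_nonneg)
  then have 0: "center_stable_size A z = 0" "unstable_excess A B U z = 0" using n by linarith+
  have "norm (x - unstable_proj A x) + \<bar>r\<bar> = 0" using 0(1) by (simp add: center_stable_size_def xr)
  then have x: "x = unstable_proj A x" "r = 0" by (auto simp: add_nonneg_eq_0_iff)
  have "norm (unstable_proj A x) \<le> unstable_excess A B U (x, 0)"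
    by (rule unstable_excess_greatest[OF U]) simp
  then have "x = 0" using 0(2) x by (simp add: xr)
  then show False using z x(2) by (simp add: xr zero_prod_def)
qed

text \<open>At \<open>(x, 1)\<close> the size is positive, which excludes one alternative of the dichotomy. For the reversed
  system size and excess exchange their roles: what expands backward contracts forward.\<close>

lemma proj_chain_controllable_excess_zero:
  fixes A :: "real^'n^'n" and B :: "real^'m^'n" and N1 :: "(real^'n) \<times> real \<Rightarrow> real"
  assumes U: "compact U" "0 \<in> U" and N1: "is_norm N1"
    and S: "chain_controllable proj_space (proj_dist N1) (controls U) (proj_traj A B) S"
    and z: "proj (x, 1) \<in> S" and w: "w \<noteq> 0" "proj w \<in> S"
  shows "unstable_excess A B U w = 0" "unstable_excess (- A) (- B) U w = 0"
proof -
  have z0: "(x, 1::real) \<noteq> 0" by (simp add: zero_prod_def)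
  have size: "center_stable_size A (x, 1) > 0" for A :: "real^'n^'n"
    by (simp add: center_stable_size_def add_nonneg_pos)
  have nonneg: "center_stable_size A z \<ge> 0" "unstable_excess A B U z \<ge> 0"
    for A :: "real^'n^'n" and B :: "real^'m^'n" and z
    by (simp_all add: center_stable_size_def unstable_excess_def infdist_nonneg)
  obtain T where T: "T > 0" "\<And>t u z. t \<ge> T \<Longrightarrow> u \<in> controls U \<Longrightarrow>
      2 * center_stable_size A (lifted_traj A B t z u) * unstable_excess A B U z \<le>
      center_stable_size A z * unstable_excess A B U (lifted_traj A B t z u)"
    using excess_ratio_doubles[OF U, of A B] by blast
  have "(center_stable_size A (x, 1) = 0 \<and> center_stable_size A w = 0) \<or>
      (unstable_excess A B U (x, 1) = 0 \<and> unstable_excess A B U w = 0)"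
    by (rule proj_chain_controllable_dichotomy[where \<alpha> = "center_stable_size A"
        and \<beta> = "unstable_excess A B U" and F = "lifted_traj A B", OF N1 nonneg center_stable_size_homogeneous
        unstable_excess_homogeneous[OF U] continuous_center_stable_size continuous_unstable_excess[OF U]
        size_excess_pos[OF U] proj_traj_proj lifted_traj_nonzero T S z0 z w])
  then show "unstable_excess A B U w = 0" using size[of A] by auto
  obtain T' where T': "T' > 0" "\<And>t u z. t \<ge> T' \<Longrightarrow> u \<in> controls U \<Longrightarrow>
      2 * center_stable_size (- A) (lifted_traj (- A) (- B) t z u) * unstable_excess (- A) (- B) U z \<le>
      center_stable_size (- A) z * unstable_excess (- A) (- B) U (lifted_traj (- A) (- B) t z u)"
    using excess_ratio_doubles[OF U, of "- A" "- B"] by blast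
  have ratio: "2 * unstable_excess (- A) (- B) U (lifted_traj A B t z u) * center_stable_size (- A) z \<le>
      unstable_excess (- A) (- B) U z * center_stable_size (- A) (lifted_traj A B t z u)"
    if t: "t \<ge> T'" and u: "u \<in> controls U" for t u z
  proof -
    have "t \<ge> 0" using t T'(1) by simp
    show ?thesis
      using T'(2)[OF t controls_reverse[OF U u, of t], of "lifted_traj A B t z u"]
      unfolding lifted_traj_reverse[OF U u \<open>t \<ge> 0\<close>] by (simp add: mult_ac)
  qed
  have pos: "unstable_excess (- A) (- B) U z + center_stable_size (- A) z > 0" if "z \<noteq> 0" for z
    using size_excess_pos[OF U that, of "- A" "- B"] by simp
  have "(unstable_excess (- A) (- B) U (x, 1) = 0 \<and> unstable_excess (- A) (- B) U w = 0) \<or>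
      (center_stable_size (- A) (x, 1) = 0 \<and> center_stable_size (- A) w = 0)"
    by (rule proj_chain_controllable_dichotomy[where \<alpha> = "unstable_excess (- A) (- B) U"
        and \<beta> = "center_stable_size (- A)" and F = "lifted_traj A B", OF N1 nonneg(2,1) unstable_excess_homogeneous[OF U]
        center_stable_size_homogeneous continuous_unstable_excess[OF U] continuous_center_stable_size
        pos proj_traj_proj lifted_traj_nonzero T'(1) ratio S z0 z w])
  then show "unstable_excess (- A) (- B) U w = 0" using size[of "- A"] by auto
qed

text \<open>Representatives with last coordinate 1 stay away from the origin, where normalization is
  Lipschitz.\<close>

lemma proj_dist_affine_chart:
  fixes N :: "real^'n \<Rightarrow> real" and N1 :: "(real^'n) \<times> real \<Rightarrow> real"
  assumes N: "is_norm N" and N1: "is_norm N1"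
  shows "\<exists>L>0. \<forall>a b. proj_dist N1 (proj (a, 1)) (proj (b, 1)) \<le> L * N (a - b)"
proof -
  obtain c C where C: "c > 0" "C > 0" "\<And>v. c * norm v \<le> N1 v" "\<And>v. N1 v \<le> C * norm v"
    using is_norm_equivalent[OF N1] by metis
  obtain e where e: "e > 0" "\<And>v. e * norm v \<le> N v" using is_norm_equivalent[OF N] by metis
  have "proj_dist N1 (proj (a, 1)) (proj (b, 1)) \<le> (2 * C / (c * e)) * N (a - b)" for a b
  proof -
    have "1 \<le> norm (a, 1::real)" using norm_snd_le[of "1::real" a] by simp
    then have "c * 1 \<le> c * norm (a, 1::real)" using C(1) by (intro mult_left_mono) auto
    then have c: "c \<le> N1 (a, 1)" using C(3)[of "(a, 1)"] by linarith
    have "N1 ((a, 1) - (b, 1)) \<le> C * norm (a - b)" using C(4)[of "(a - b, 0)"] by (simp add: norm_Pair)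
    also have "\<dots> \<le> C * (N (a - b) / e)" using e(1) e(2)[of "a - b"] C(2) by (intro mult_left_mono) (auto simp: field_simps)
    finally have d: "N1 ((a, 1) - (b, 1)) \<le> C * (N (a - b) / e)" .
    have "proj_dist N1 (proj (a, 1)) (proj (b, 1)) \<le> 2 * N1 ((a, 1) - (b, 1)) / N1 (a, 1)"
      by (rule proj_dist_le[OF N1]) (simp_all add: zero_prod_def)
    also have "\<dots> \<le> 2 * (C * (N (a - b) / e)) / c"
      using d c C(1,2) e(1) is_norm_nonneg[OF N, of "a - b"] by (intro frac_le) auto
    finally show ?thesis by (simp add: mult_ac)
  qed
  moreover have "2 * C / (c * e) > 0" using C e by simp
  ultimately show ?thesis by blast
qed

lemma proj_traj_in_proj_space:
  fixes A :: "real^'n^'n"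
  assumes "p \<in> proj_space" shows "proj_traj A B t p u \<in> proj_space"
proof -
  obtain z where "p = proj z" "z \<noteq> 0" using assms by (auto simp: proj_space_def)
  then show ?thesis by (simp only: proj_traj_proj proj_in_proj_space lifted_traj_nonzero not_False_eq_True)
qed

text \<open>For fixed \<open>T\<close> the lifted trajectories are linear in the initial state, with norms bounded above
  and below uniformly in the control.\<close>

lemma proj_traj_uniformly_continuous:
  fixes A :: "real^'n^'n" and B :: "real^'m^'n" and N1 :: "(real^'n) \<times> real \<Rightarrow> real"
  assumes U: "compact U" "0 \<in> U" and N1: "is_norm N1" and T: "T > 0" and \<epsilon>: "\<epsilon> > 0"
  obtains \<eta> where "\<eta> > 0" "\<And>u p q. u \<in> controls U \<Longrightarrow> p \<in> proj_space \<Longrightarrow> q \<in> proj_space \<Longrightarrow>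
    proj_dist N1 p q < \<eta> \<Longrightarrow> proj_dist N1 (proj_traj A B T p u) (proj_traj A B T q u) < \<epsilon>"
proof -
  obtain c C where C: "c > 0" "C > 0" "\<And>v. c * norm v \<le> N1 v" "\<And>v. N1 v \<le> C * norm v"
    using is_norm_equivalent[OF N1] by metis
  obtain K where K: "K > 0" "\<And>t x. - T \<le> t \<Longrightarrow> t \<le> T \<Longrightarrow> norm (flow A t x) \<le> K * norm x"
    using flow_bounded by blast
  obtain M where M: "M > 0" "\<And>x. x \<in> U \<Longrightarrow> norm (B *v x) \<le> M" using input_bound[OF U, of B] by blast
  define R where "R = K * T * M"
  have R: "norm (pullback_input A B T u) \<le> R" if u: "u \<in> controls U" for u
  proof -
    have "norm (pullback_input A B T u) \<le> (K * T - K * 0) * M"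
    proof (rule pullback_input_bound[OF U u M(2), where Q = "\<lambda>x. x" and h = "\<lambda>s. K * s" and h' = "\<lambda>_. K"])
      show "linear (\<lambda>x :: real^'n. x)" by (rule linear_ident)
      show "0 \<le> T" using T by simp
      show "norm (flow A (- s) x) \<le> K * norm x" if "0 \<le> s" "s \<le> T" for s x
        using K(2)[of "- s" x] that T by simp
      show "((\<lambda>s. K * s) has_real_derivative K) (at s)" for s by (auto intro!: derivative_eq_intros)
    qed
    then show ?thesis by (simp add: R_def)
  qed
  have R0: "R \<ge> 0" using K M T by (simp add: R_def)
  define L where "L = K + K * R + R + 1"
  have L: "L > 0" using K R0 by (simp add: L_def add_nonneg_pos)
  have up: "norm (lifted_traj A B T z u) \<le> L * norm z" and low: "norm z \<le> L * norm (lifted_traj A B T z u)"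
    if u: "u \<in> controls U" for u z
  proof -
    obtain x r where z: "z = (x, r)" by (cases z)
    let ?g = "pullback_input A B T u"
    define X where "X = flow A T (x + r *\<^sub>R ?g)"
    have zX: "lifted_traj A B T z u = (X, r)" using lifted_traj_eq[OF U u, of T A B x r] T by (simp add: z X_def)
    have rg: "norm (r *\<^sub>R ?g) \<le> \<bar>r\<bar> * R" using R[OF u] by (simp add: mult_left_mono)
    have xr: "norm x \<le> norm z" "\<bar>r\<bar> \<le> norm z" using norm_fst_le[of x r] norm_snd_le[of r x] by (simp_all add: z)
    have Xr: "norm X \<le> norm (X, r)" "\<bar>r\<bar> \<le> norm (X, r)" using norm_fst_le[of X r] norm_snd_le[of r X] by simp_all
    have "norm X \<le> K * norm (x + r *\<^sub>R ?g)" unfolding X_def using K(2) T by simp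
    also have "\<dots> \<le> K * (norm z + norm z * R)"
      using norm_triangle_ineq[of x "r *\<^sub>R ?g"] rg xr R0 K(1) mult_right_mono[OF xr(2) R0]
      by (intro mult_left_mono) auto
    finally have "norm X \<le> K * (norm z + norm z * R)" .
    then have "norm (X, r) \<le> K * (norm z + norm z * R) + norm z"
      using norm_Pair_le[of X r] xr(2) by simp
    also have "\<dots> \<le> L * norm z" using R0 by (simp add: L_def algebra_simps)
    finally show "norm (lifted_traj A B T z u) \<le> L * norm z" by (simp add: zX)
    have "x = flow A (- T) X - r *\<^sub>R ?g" by (simp add: X_def flow_inverse)
    then have "norm x \<le> norm (flow A (- T) X) + norm (r *\<^sub>R ?g)" by (metis norm_triangle_ineq4)
    also have "\<dots> \<le> K * norm (X, r) + norm (X, r) * R"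
    proof (rule add_mono)
      have "norm (flow A (- T) X) \<le> K * norm X" using K(2) T by simp
      also have "\<dots> \<le> K * norm (X, r)" using Xr(1) K(1) by simp
      finally show "norm (flow A (- T) X) \<le> K * norm (X, r)" .
      show "norm (r *\<^sub>R ?g) \<le> norm (X, r) * R" using rg mult_right_mono[OF Xr(2) R0] by linarith
    qed
    finally have "norm z \<le> K * norm (X, r) + norm (X, r) * R + norm (X, r)"
      using norm_Pair_le[of x r] Xr(2) by (simp add: z)
    also have "\<dots> \<le> L * norm (X, r)" using R0 K(1) by (simp add: L_def algebra_simps)
    finally show "norm z \<le> L * norm (lifted_traj A B T z u)" by (simp add: zX)
  qed
  \<comment> \<open>\<open>c / (L * C)\<close> bounds the images of unit vectors from below, \<open>C * L / c\<close> is a Lipschitz constant\<close>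
  define \<eta> where "\<eta> = \<epsilon> * (c / (L * C)) * c / (2 * C * L)"
  have \<eta>: "\<eta> > 0" using \<epsilon> C L by (simp add: \<eta>_def)
  have "proj_dist N1 (proj_traj A B T p u) (proj_traj A B T q u) < \<epsilon>"
    if u: "u \<in> controls U" and pq: "p \<in> proj_space" "q \<in> proj_space" "proj_dist N1 p q < \<eta>" for u p q
  proof -
    let ?F = "\<lambda>z. lifted_traj A B T z u"
    obtain a b where ab: "p = proj a" "q = proj b" "N1 a = 1" "N1 b = 1" "N1 (a - b) < \<eta>"
      using proj_dist_representatives[OF N1 pq] .
    have ab0: "a \<noteq> 0" "b \<noteq> 0" using ab is_norm_0[OF N1] by auto
    have "1 / C \<le> norm a" using C(4)[of a] ab(3) C(2) by (simp add: field_simps)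
    also have "\<dots> \<le> L * norm (?F a)" by (rule low[OF u])
    also have "\<dots> \<le> L * (N1 (?F a) / c)" using C(1) C(3)[of "?F a"] L by (intro mult_left_mono) (auto simp: field_simps)
    finally have lowa: "c / (L * C) \<le> N1 (?F a)" using C(1,2) L by (simp add: field_simps)
    have "N1 (?F a - ?F b) \<le> C * norm (?F (a - b))"
      using C(4) by (simp add: linear_diff[OF linear_lifted_traj])
    also have "\<dots> \<le> C * (L * norm (a - b))" using up[OF u] C(2) by (intro mult_left_mono) auto
    also have "\<dots> \<le> C * (L * (N1 (a - b) / c))"
      using C(1,2) C(3)[of "a - b"] L by (intro mult_left_mono) (auto simp: field_simps)
    also have "\<dots> < C * (L * (\<eta> / c))"
      using C(1,2) L ab(5) by (intro mult_strict_left_mono divide_strict_right_mono) auto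
    also have "\<dots> = \<epsilon> * (c / (L * C)) / 2" using C(1,2) L by (simp add: \<eta>_def)
    finally have diff: "N1 (?F a - ?F b) < \<epsilon> * (c / (L * C)) / 2" .
    have "proj_dist N1 (proj_traj A B T p u) (proj_traj A B T q u) \<le> 2 * N1 (?F a - ?F b) / N1 (?F a)"
      unfolding ab(1,2) proj_traj_proj by (intro proj_dist_le[OF N1] lifted_traj_nonzero ab0)
    also have "\<dots> \<le> 2 * N1 (?F a - ?F b) / (c / (L * C))"
      using lowa C(1,2) L is_norm_nonneg[OF N1] by (intro frac_le) auto
    also have "\<dots> < \<epsilon>"
    proof -
      have m: "c / (L * C) > 0" using C(1,2) L by simp
      have half: "x < y / 2 \<Longrightarrow> 2 * x < y" for x y :: real by simp
      show ?thesis unfolding pos_divide_less_eq[OF m] by (rule half[OF diff])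
    qed
    finally show ?thesis .
  qed
  then show thesis using that \<eta> by blast
qed

abbreviation proj_step ::
  "((real^'n) \<times> real \<Rightarrow> real) \<Rightarrow> real^'n^'n \<Rightarrow> real^'m^'n \<Rightarrow> (real^'m) set \<Rightarrow> real \<Rightarrow> real \<Rightarrow>
    ((real^'n) \<times> real) set \<Rightarrow> ((real^'n) \<times> real) set \<Rightarrow> bool" where
  "proj_step N1 A B U \<equiv> chain_step proj_space (proj_dist N1) (controls U) (proj_traj A B)"

lemma affine_chart_in_proj_space: "proj (x, 1::real) \<in> proj_space"
  by (rule proj_in_proj_space) (simp add: zero_prod_def)

lemma norm_step_proj_step:
  assumes L: "L > 0" "\<And>a b. proj_dist N1 (proj (a, 1)) (proj (b, 1)) \<le> L * N (a - b)"
    and step: "norm_step N A B U (\<epsilon> / L) T x y"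
  shows "proj_step N1 A B U \<epsilon> T (proj (x, 1)) (proj (y, 1))"
proof -
  obtain u t where ut: "u \<in> controls U" "t \<ge> T" "N (lin_traj A B t x u - y) < \<epsilon> / L"
    using step unfolding norm_step_iff by blast
  have "proj_dist N1 (proj_traj A B t (proj (x, 1)) u) (proj (y, 1)) \<le> L * N (lin_traj A B t x u - y)"
    unfolding proj_traj_proj lifted_traj_one by (rule L(2))
  also have "\<dots> < \<epsilon>" using ut(3) L(1) by (simp add: pos_less_divide_eq mult.commute)
  finally show ?thesis unfolding chain_step_def using ut(1,2) affine_chart_in_proj_space by blast
qed

lemma
  assumes L: "L > 0" "\<And>a b. proj_dist N1 (proj (a, 1)) (proj (b, 1)) \<le> L * N (a - b)"
  shows norm_chain_proj_chain: "(norm_step N A B U (\<epsilon> / L) T)\<^sup>+\<^sup>+ x y \<Longrightarrow>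
      (proj_step N1 A B U \<epsilon> T)\<^sup>+\<^sup>+ (proj (x, 1)) (proj (y, 1))"
    and norm_chain_proj_chain_refl: "(norm_step N A B U (\<epsilon> / L) T)\<^sup>*\<^sup>* x y \<Longrightarrow>
      (proj_step N1 A B U \<epsilon> T)\<^sup>*\<^sup>* (proj (x, 1)) (proj (y, 1))"
proof -
  show "(proj_step N1 A B U \<epsilon> T)\<^sup>+\<^sup>+ (proj (x, 1)) (proj (y, 1))"
    if "(norm_step N A B U (\<epsilon> / L) T)\<^sup>+\<^sup>+ x y"
    using that
  proof (induction rule: tranclp_induct)
    case (base y)
    then show ?case using norm_step_proj_step[OF L] by blast
  next
    case (step y z)
    show ?case by (rule tranclp.trancl_into_trancl[OF step(3) norm_step_proj_step[OF L step(2)]])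
  qed
  show "(proj_step N1 A B U \<epsilon> T)\<^sup>*\<^sup>* (proj (x, 1)) (proj (y, 1))"
    if "(norm_step N A B U (\<epsilon> / L) T)\<^sup>*\<^sup>* x y"
    using that
  proof (induction rule: rtranclp_induct)
    case (step y z)
    show ?case by (rule rtranclp.rtrancl_into_rtrancl[OF step(3) norm_step_proj_step[OF L step(2)]])
  qed simp
qed

lemma chain_step_mono: "chain_step M d C f \<delta> T x y \<Longrightarrow> \<delta> \<le> \<epsilon> \<Longrightarrow> chain_step M d C f \<epsilon> T x y"
  unfolding chain_step_def by (meson less_le_trans)

lemma chain_move_endpoint:
  assumes metric: "Metric_space M d" and f: "\<And>t p u. p \<in> M \<Longrightarrow> f t p u \<in> M"
    and chain: "(chain_step M d C f \<delta> T)\<^sup>+\<^sup>+ x y" and y: "d y y' < \<delta>'" "y \<in> M" "y' \<in> M" and "\<delta>' \<ge> 0"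
  shows "(chain_step M d C f (\<delta> + \<delta>') T)\<^sup>+\<^sup>+ x y'"
proof -
  let ?R = "chain_step M d C f \<delta> T" and ?R' = "chain_step M d C f (\<delta> + \<delta>') T"
  have last: "?R' z y'" if zy: "?R z y" for z
  proof -
    obtain u t where ut: "z \<in> M" "u \<in> C" "t \<ge> T" "d (f t z u) y < \<delta>"
      using zy unfolding chain_step_def by blast
    have "d (f t z u) y' \<le> d (f t z u) y + d y y'"
      by (rule Metric_space.triangle[OF metric f[OF ut(1)] y(2,3)])
    then have "d (f t z u) y' < \<delta> + \<delta>'" using ut(4) y(1) by linarith
    then show ?thesis unfolding chain_step_def using ut(1-3) y(3) by blast
  qed
  have mono: "?R' a b" if "?R a b" for a b
    by (rule chain_step_mono[OF that]) (use \<open>\<delta>' \<ge> 0\<close> in simp)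
  from chain show ?thesis
  proof cases
    case r_into_trancl
    then show ?thesis using last by blast
  next
    case step: (trancl_into_trancl z)
    have "?R'\<^sup>+\<^sup>+ x z"
      using step(1)
    proof (induction rule: tranclp_induct)
      case (base y)
      then show ?case by (intro tranclp.r_into_trancl mono)
    next
      case (step y z)
      show ?case by (rule tranclp.trancl_into_trancl[OF step(3) mono[OF step(2)]])
    qed
    then show ?thesis using last[OF step(2)] by (rule tranclp.trancl_into_trancl)
  qed
qed

text \<open>The chain passes through the origin of the affine chart. Its first segment starts at the limit point \<open>p\<close>
  instead of a nearby point of the first strip, and its last jump ends at \<open>q\<close> instead of a nearby
  point of the second strip.\<close>

lemma proj_closure_chain_controllable:
  fixes A :: "real^'n^'n" and B :: "real^'m^'n" and N1 :: "(real^'n) \<times> real \<Rightarrow> real"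
  assumes U: "compact U" "0 \<in> U" and N1: "is_norm N1"
    and cl: "\<And>p. p \<in> S \<Longrightarrow> p \<in> proj_space \<and> (\<forall>r>0. \<exists>x\<in>null_strip A B U \<inter> null_strip (- A) (- B) U.
        proj_dist N1 p (proj (x, 1)) < r)"
  shows "chain_controllable proj_space (proj_dist N1) (controls U) (proj_traj A B) S"
  unfolding chain_controllable_iff
proof (intro ballI allI impI)
  fix p q and \<epsilon> T :: real assume pq: "p \<in> S" "q \<in> S" and \<epsilon>: "\<epsilon> > 0" and T: "T > 0"
  have N: "is_norm (norm :: real^'n \<Rightarrow> real)" by (simp add: is_norm_def norm_triangle_ineq)
  obtain L where L: "L > 0" "\<And>a b. proj_dist N1 (proj (a, 1)) (proj (b, 1)) \<le> L * norm (a - b :: real^'n)"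
    using proj_dist_affine_chart[OF N N1] by blast
  have e2: "\<epsilon> / 2 > 0" "\<epsilon> / 2 / L > 0" using \<epsilon> L(1) by simp_all
  obtain \<eta> where \<eta>: "\<eta> > 0" "\<And>u p q. u \<in> controls U \<Longrightarrow> p \<in> proj_space \<Longrightarrow> q \<in> proj_space \<Longrightarrow>
      proj_dist N1 p q < \<eta> \<Longrightarrow> proj_dist N1 (proj_traj A B T p u) (proj_traj A B T q u) < \<epsilon> / 2"
    using proj_traj_uniformly_continuous[OF U N1 T e2(1), of A B] by blast
  have pM: "p \<in> proj_space" and qM: "q \<in> proj_space"
    using cl[OF pq(1)] cl[OF pq(2)] by (simp_all only:)
  from cl[OF pq(1), THEN conjunct2, rule_format, OF \<eta>(1)]
  obtain x where x: "x \<in> null_strip A B U" "proj_dist N1 p (proj (x, 1)) < \<eta>" by blast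
  from cl[OF pq(2), THEN conjunct2, rule_format, OF e2(1)]
  obtain y where y: "y \<in> null_strip (- A) (- B) U" "proj_dist N1 q (proj (y, 1)) < \<epsilon> / 2" by blast
  obtain u x1 where u: "u \<in> controls U" "norm (lin_traj A B T x u - x1) < \<epsilon> / 2 / L"
      "(norm_step norm A B U (\<epsilon> / 2 / L) T)\<^sup>*\<^sup>* x1 0"
    using null_strip_chain_to_zero[OF U N x(1) e2(2) T] by metis
  have "proj_dist N1 (proj_traj A B T p u) (proj (x1, 1)) \<le>
      proj_dist N1 (proj_traj A B T p u) (proj_traj A B T (proj (x, 1)) u) +
      proj_dist N1 (proj_traj A B T (proj (x, 1)) u) (proj (x1, 1))"
    by (intro Metric_space.triangle[OF Metric_space_proj[OF N1]] proj_traj_in_proj_space pM affine_chart_in_proj_space)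
  also have "\<dots> < \<epsilon> / 2 + \<epsilon> / 2"
  proof (rule add_strict_mono)
    show "proj_dist N1 (proj_traj A B T p u) (proj_traj A B T (proj (x, 1)) u) < \<epsilon> / 2"
      by (rule \<eta>(2)[OF u(1) pM affine_chart_in_proj_space x(2)])
    have "proj_dist N1 (proj_traj A B T (proj (x, 1)) u) (proj (x1, 1)) \<le> L * norm (lin_traj A B T x u - x1)"
      unfolding proj_traj_proj lifted_traj_one by (rule L(2))
    also have "\<dots> < \<epsilon> / 2" using u(2) L(1) by (simp add: pos_less_divide_eq mult.commute)
    finally show "proj_dist N1 (proj_traj A B T (proj (x, 1)) u) (proj (x1, 1)) < \<epsilon> / 2" .
  qed
  finally have first: "proj_step N1 A B U \<epsilon> T p (proj (x1, 1))"
    unfolding chain_step_def using u(1) pM affine_chart_in_proj_space[of x1] by auto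
  have mono: "proj_step N1 A B U (\<epsilon> / 2) T \<le> proj_step N1 A B U \<epsilon> T"
  proof (intro predicate2I)
    have "\<epsilon> / 2 \<le> \<epsilon>" using \<epsilon> by linarith
    then show "proj_step N1 A B U \<epsilon> T a b" if "proj_step N1 A B U (\<epsilon> / 2) T a b" for a b
      using chain_step_mono[OF that] by blast
  qed
  have second: "(proj_step N1 A B U \<epsilon> T)\<^sup>*\<^sup>* (proj (x1, 1)) (proj (0, 1))"
    by (rule rtranclp_mono[THEN predicate2D, OF mono norm_chain_proj_chain_refl[OF L u(3)]])
  have to_y: "(proj_step N1 A B U (\<epsilon> / 2) T)\<^sup>+\<^sup>+ (proj (0, 1)) (proj (y, 1))"
    by (rule norm_chain_proj_chain[OF L reverse_strip_chain_from_zero[OF U N y(1) e2(2) T]])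
  have yq: "proj_dist N1 (proj (y, 1)) q < \<epsilon> / 2"
    using y(2) by (simp only: proj_dist_commute[OF N1, of q])
  have "(proj_step N1 A B U (\<epsilon> / 2 + \<epsilon> / 2) T)\<^sup>+\<^sup>+ (proj (0, 1)) q"
    by (rule chain_move_endpoint[OF Metric_space_proj[OF N1] proj_traj_in_proj_space to_y yq
        affine_chart_in_proj_space qM less_imp_le[OF e2(1)]])
  then have third: "(proj_step N1 A B U \<epsilon> T)\<^sup>+\<^sup>+ (proj (0, 1)) q" by simp
  show "(proj_step N1 A B U \<epsilon> T)\<^sup>+\<^sup>+ p q"
    using first second third by (meson rtranclp_into_tranclp2 tranclp_trans)
qed

section \<open>The chain control set on the Poincare sphere\<close>

theorem corollary5p4:
  fixes A :: "real ^ 'n ^ 'n" and B :: "real ^ 'm ^ 'n" and U :: "(real ^ 'm) set"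
    and N :: "real ^ 'n \<Rightarrow> real" and N1 :: "(real ^ 'n) \<times> real \<Rightarrow> real"
    and E :: "(real ^ 'n) set" and Ec :: "((real ^ 'n) \<times> real) set set"
  assumes "compact U" and "convex U" and "0 \<in> interior U"
    and "is_norm N" and "is_norm N1"
    and "chain_control_set UNIV (\<lambda>x y. N (x - y)) (controls U) (lin_traj A B) E"
    and "chain_control_set proj_space (proj_dist N1) (controls U) (proj_traj A B) Ec"
    and "Ec \<inter> {proj (x, 1) | x. True} \<noteq> {}"
  shows "Ec = Metric_space.mtopology proj_space (proj_dist N1) closure_of (proj ` (E \<times> {1}))"
proof -
  have U: "compact U" "0 \<in> U" using assms(1,3) interior_subset by auto
  note N = assms(4) and N1 = assms(5)
  define F where "F = null_strip A B U \<inter> null_strip (- A) (- B) U"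
  have E: "E \<noteq> {}" "chain_controllable UNIV (\<lambda>x y. N (x - y)) (controls U) (lin_traj A B) E"
    using assms(6) by (auto simp: chain_control_set_def)
  obtain L where L: "L > 0" "\<And>a b. proj_dist N1 (proj (a, 1)) (proj (b, 1)) \<le> L * N (a - b)"
    using proj_dist_affine_chart[OF N N1] by blast
  have "chain_controllable proj_space (proj_dist N1) (controls U) (proj_traj A B) (proj ` (E \<times> {1}))"
    unfolding chain_controllable_iff
  proof (intro ballI allI impI)
    fix p q :: "((real^'n) \<times> real) set" and \<epsilon> T :: real
    assume pq: "p \<in> proj ` (E \<times> {1})" "q \<in> proj ` (E \<times> {1})" and eT: "\<epsilon> > 0" "T > 0"
    then obtain x y where xy: "p = proj (x, 1)" "q = proj (y, 1)" "x \<in> E" "y \<in> E" by blast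
    have "(norm_step N A B U (\<epsilon> / L) T)\<^sup>+\<^sup>+ x y"
      using E(2) xy(3,4) eT L(1) unfolding chain_controllable_iff norm_step_def by simp
    then show "(proj_step N1 A B U \<epsilon> T)\<^sup>+\<^sup>+ p q"
      unfolding xy by (rule norm_chain_proj_chain[OF L])
  qed
  note ES = proj_chain_controllable_excess_zero[OF U N1 this]
  have "E \<subseteq> F"
  proof
    fix x assume x: "x \<in> E"
    then have px: "proj (x, 1::real) \<in> proj ` (E \<times> {1})" by blast
    have "(x, 1::real) \<noteq> 0" by (simp add: zero_prod_def)
    then show "x \<in> F" using ES[OF px _ px] by (simp add: F_def null_strip_def)
  qed
  moreover have "chain_controllable UNIV (\<lambda>x y. N (x - y)) (controls U) (lin_traj A B) F"
    unfolding chain_controllable_iff norm_step_def[symmetric]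
  proof (intro ballI allI impI)
    fix x y and \<epsilon> T :: real assume xy: "x \<in> F" "y \<in> F" and eT: "\<epsilon> > 0" "T > 0"
    have "(norm_step N A B U \<epsilon> T)\<^sup>+\<^sup>+ x 0"
      using xy(1) by (intro null_strip_chain[OF U N _ eT]) (simp add: F_def)
    moreover have "(norm_step N A B U \<epsilon> T)\<^sup>+\<^sup>+ 0 y"
      using xy(2) by (intro reverse_strip_chain_from_zero[OF U N _ eT]) (simp add: F_def)
    ultimately show "(norm_step N A B U \<epsilon> T)\<^sup>+\<^sup>+ x y" by (rule tranclp_trans)
  qed
  ultimately have EF: "E = F" using assms(6) unfolding chain_control_set_def by blast
  define cl where "cl = Metric_space.mtopology proj_space (proj_dist N1) closure_of (proj ` (E \<times> {1}))"
  have cl: "p \<in> cl \<longleftrightarrow> p \<in> proj_space \<and> (\<forall>r>0. \<exists>x\<in>F. proj_dist N1 p (proj (x, 1)) < r)" for p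
    unfolding cl_def Metric_space.metric_closure_of[OF Metric_space_proj[OF N1]] EF
    by (auto simp: Metric_space.in_mball[OF Metric_space_proj[OF N1]] affine_chart_in_proj_space)
  have Ec: "Ec \<subseteq> proj_space" "chain_controllable proj_space (proj_dist N1) (controls U) (proj_traj A B) Ec"
    using assms(7) by (auto simp: chain_control_set_def)
  obtain x0 where x0: "proj (x0, 1) \<in> Ec" using assms(8) by blast
  note EcS = proj_chain_controllable_excess_zero[OF U N1 Ec(2) x0]
  have in_cl: "proj (x, 1) \<in> cl" if "x \<in> F" for x
  proof -
    have "proj_dist N1 (proj (x, 1)) (proj (x, 1)) = 0"
      using Metric_space.mdist_zero[OF Metric_space_proj[OF N1]] affine_chart_in_proj_space by blast
    then show ?thesis unfolding cl using that affine_chart_in_proj_space by metis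
  qed
  have "Ec \<subseteq> cl"
  proof
    fix p assume p: "p \<in> Ec"
    then obtain z where z: "z \<noteq> 0" "p = proj z" using Ec(1) by (auto simp: proj_space_def)
    obtain x r where xr: "z = (x, r)" by (cases z)
    have excess: "unstable_excess A B U (x, r) = 0" "unstable_excess (- A) (- B) U (x, r) = 0"
      using EcS[OF z(1)] p z(2) xr by auto
    show "p \<in> cl"
    proof (cases "r = 0")
      case False
      define y where "y = (1 / r) *\<^sub>R x"
      have y: "(1 / r) *\<^sub>R (x, r) = (y, 1)" using False by (simp add: y_def)
      have r: "1 / r \<noteq> 0" using False by simp
      have "unstable_excess A B U (y, 1) = 0" "unstable_excess (- A) (- B) U (y, 1) = 0"
        unfolding y[symmetric] unstable_excess_homogeneous[OF U r] excess by simp_all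
      then have "y \<in> F" by (simp add: F_def null_strip_def)
      moreover have "proj z = proj (y, 1)"
        using False z(1) by (subst proj_eq_iff) (auto simp: xr y_def zero_prod_def intro!: exI[of _ r])
      ultimately show ?thesis using in_cl z(2) by simp
    next
      case True
      have vanish: "unstable_proj A' x = 0" if "unstable_excess A' B' U (x, 0) = 0"
        for A' :: "real^'n^'n" and B' :: "real^'m^'n"
      proof -
        have "norm (unstable_proj A' x) \<le> unstable_excess A' B' U (x, 0)"
          by (rule unstable_excess_greatest[OF U]) simp
        then show ?thesis using that by simp
      qed
      have strip: "c *\<^sub>R x \<in> null_strip A' B' U" if "unstable_proj A' x = 0"
        for A' :: "real^'n^'n" and B' :: "real^'m^'n" and c
      proof -
        have "unstable_excess A' B' U (c *\<^sub>R x, 1) \<le> 0"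
          using unstable_excess_le[OF U zero_null_controllable[OF U], of A' B' "c *\<^sub>R x" 1] that
          by (simp add: linear_scale[OF linear_unstable_proj] linear_0[OF linear_unstable_proj])
        then show ?thesis by (simp add: null_strip_def unstable_excess_def infdist_nonneg order_antisym)
      qed
      have F: "c *\<^sub>R x \<in> F" for c
        using strip vanish excess True by (auto simp: F_def)
      have x: "(x, 0::real) \<noteq> 0" using z(1) True by (simp add: xr)
      have "\<exists>y\<in>F. proj_dist N1 p (proj (y, 1)) < \<rho>" if \<rho>: "\<rho> > 0" for \<rho>
      proof -
        have pos: "N1 (x, 0) > 0" "N1 (0, 1) > 0"
          using is_norm_zero[OF N1] is_norm_nonneg[OF N1] x
          by (metis less_eq_real_def, metis less_eq_real_def prod.inject zero_neq_one zero_prod_def)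
        \<comment> \<open>chosen such that the line through \<open>(x, e)\<close> has distance at most \<open>\<rho> / 2\<close> from \<open>p\<close>\<close>
        define e where "e = \<rho> * N1 (x, 0) / (4 * N1 (0, 1))"
        have e: "e > 0" using \<rho> pos by (simp add: e_def)
        have "proj (x, e) = proj ((1 / e) *\<^sub>R x, 1)"
          using e by (subst proj_eq_iff) (auto simp: zero_prod_def intro!: exI[of _ e])
        moreover have "proj_dist N1 (proj (x, 0)) (proj (x, e)) \<le> 2 * N1 ((x, 0) - (x, e)) / N1 (x, 0)"
          using e by (intro proj_dist_le[OF N1] x) (simp add: zero_prod_def)
        moreover have "N1 ((x, 0) - (x, e)) = e * N1 (0, 1)"
          using is_norm_scale[OF N1, of "- e" "(0, 1)"] e by (simp add: zero_prod_def)
        moreover have "2 * (e * N1 (0, 1)) / N1 (x, 0) < \<rho>"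
          using pos \<rho> by (simp add: e_def)
        ultimately have "proj_dist N1 (proj (x, 0)) (proj ((1 / e) *\<^sub>R x, 1)) < \<rho>"
          by (simp only: order_le_less_trans)
        then show ?thesis unfolding z(2) xr True using F[of "1 / e"] by blast
      qed
      then show ?thesis using p Ec(1) unfolding cl by blast
    qed
  qed
  moreover have "cl \<subseteq> Ec"
  proof (rule chain_control_set_absorbs[OF assms(7)])
    show "chain_controllable proj_space (proj_dist N1) (controls U) (proj_traj A B) cl"
      by (rule proj_closure_chain_controllable[OF U N1]) (simp add: cl F_def)
    show "cl \<subseteq> proj_space" using cl by blast
    show "cl \<inter> Ec \<noteq> {}" using x0 calculation by blast
  qed
  ultimately show ?thesis unfolding cl_def by blast
qed

end
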